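(* Let $d\ge 3$ be an integer. For any $p\in\left(1,\frac{d}{d-2}\right)$ there exists $\gamma^\ast>0$, with $\gamma^\ast\le d-(d-2)\,p$, such that for all $\gamma\in(0,\gamma^\ast)$ one has $$\inf_{w\in\mathcal D^\star(\mathbb R^d)\setminus\{0\}}\mathcal Q_\gamma[w]=\mathcal Q_\gamma[w_\star]=\inf_{w\in\mathcal D(\mathbb R^d)\setminus\{0\}}\mathcal Q_\gamma[w]\,,$$ where $w_\star(x)=\left(1+|x|^{2-\gamma}\right)^{-\frac1{p-1}}$. Equivalently, $\mathsf C^\star_\gamma=\mathsf C_\gamma$ for all $\gamma\in(0,\gamma^\ast)$, where $(\mathsf C_\gamma^\star)^{-1}$ and $(\mathsf C_\gamma)^{-1}$ denote the infimum of $\mathcal Q_\gamma$ over $\mathcal D^\star(\mathbb R^d)\setminus\{0\}$ and over $\mathcal D(\mathbb R^d)\setminus\{0\}$ respectively.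
   Context: $\mathcal D(\mathbb R^d)$ is the space of smooth functions on $\mathbb R^d$ with compact support, and $\mathcal D^\star(\mathbb R^d)$ is its subset of radial functions (functions depending only on $|x|$). For $q\ge1$ and $\gamma\ge0$, $\|w\|_{q,\gamma}:=\left(\int_{\mathbb R^d}|w|^q\,|x|^{-\gamma}\,dx\right)^{1/q}$ and $\|w\|_q:=\|w\|_{q,0}$. The parameters satisfy $d\ge3$, $\gamma\in(0,2)$ and $1<p<\frac{d-\gamma}{d-2}$ (the latter is equivalent to $p>1$ and $\gamma<d-(d-2)p$). For such parameters, $$\vartheta:=\frac{(d-\gamma)\,(p-1)}{p\,\big(d+2-2\,\gamma-p\,(d-2)\big)}\,,\qquad \mathcal Q_\gamma[w]:=\frac{\|\nabla w\|_2^{\vartheta}\,\|w\|_{p+1,\gamma}^{1-\vartheta}}{\|w\|_{2p,\gamma}}\,.$$ *)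

theory Defs
  imports "HOL-Analysis.Analysis"
begin

text \<open>\<open>C_diff k f\<close>: \<open>f\<close> is of class \<open>C\<^sup>k\<close> on the whole space.\<close>

primrec C_diff :: "nat \<Rightarrow> ('a::euclidean_space \<Rightarrow> real) \<Rightarrow> bool" where
  "C_diff 0 f \<longleftrightarrow> continuous_on UNIV f"
| "C_diff (Suc k) f \<longleftrightarrow>
     f differentiable_on UNIV \<and> (\<forall>v. C_diff k (\<lambda>x. frechet_derivative f (at x) v))"

definition test_functions :: "('a::euclidean_space \<Rightarrow> real) set" where
  "test_functions = {w. (\<forall>k. C_diff k w) \<and> compact (closure {x. w x \<noteq> 0})}"

definition radial_test_functions :: "('a::euclidean_space \<Rightarrow> real) set" where
  "radial_test_functions = {w \<in> test_functions. \<forall>x y. norm x = norm y \<longrightarrow> w x = w y}"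

text \<open>Where \<open>w\<close> is not differentiable the value is unspecified; for the functions considered here
  this can happen only at the origin, hence does not affect integrals.\<close>

definition grad :: "('a::euclidean_space \<Rightarrow> real) \<Rightarrow> 'a \<Rightarrow> 'a" where
  "grad w x = (THE D. GDERIV w x :> D)"

text \<open>In HOL \<open>0 powr a = 0\<close> for every \<open>a\<close>, so the weight \<open>norm x powr (- \<gamma>)\<close> vanishes at the origin
  (also for \<open>\<gamma> = 0\<close>); this is a null set.\<close>

definition wnorm :: "real \<Rightarrow> real \<Rightarrow> ('a::euclidean_space \<Rightarrow> 'b::real_normed_vector) \<Rightarrow> real" where
  "wnorm q \<gamma> w = (LINT x|lborel. norm (w x) powr q * norm x powr (- \<gamma>)) powr (1 / q)"

definition vartheta :: "nat \<Rightarrow> real \<Rightarrow> real \<Rightarrow> real" where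
  "vartheta d p \<gamma> =
     ((real d - \<gamma>) * (p - 1)) / (p * (real d + 2 - 2 * \<gamma> - p * (real d - 2)))"

definition Q_functional :: "real \<Rightarrow> real \<Rightarrow> ('a::euclidean_space \<Rightarrow> real) \<Rightarrow> real" where
  "Q_functional p \<gamma> w =
     wnorm 2 0 (grad w) powr vartheta DIM('a) p \<gamma>
       * wnorm (p + 1) \<gamma> w powr (1 - vartheta DIM('a) p \<gamma>)
     / wnorm (2 * p) \<gamma> w"

definition w_star :: "real \<Rightarrow> real \<Rightarrow> 'a::euclidean_space \<Rightarrow> real" where
  "w_star p \<gamma> x = (1 + norm x powr (2 - \<gamma>)) powr (- 1 / (p - 1))"

text \<open>The optimal constant in the interpolation inequality restricted to the class \<open>S\<close>.\<close>

definition optimal_const :: "('a::euclidean_space \<Rightarrow> real) set \<Rightarrow> real \<Rightarrow> real \<Rightarrow> real" where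
  "optimal_const S p \<gamma> = inverse (INF w\<in>S - {\<lambda>_. 0}. Q_functional p \<gamma> w)"

end

theory Submission imports Defs
begin

text \<open>
  With \<open>\<mu>\<close> the measure of density \<open>norm x powr (- \<gamma>)\<close> and \<open>n = 2 * (d - \<gamma>) / (2 - \<gamma>)\<close>, the mass
  of the centred ball of radius \<open>r\<close> is proportional to \<open>r powr (d - \<gamma>)\<close>, and \<open>w_star\<close>, read as a function of
  this mass \<open>y\<close>, is a Talenti-type profile in \<open>y powr (2 / n)\<close>: \<open>n\<close> acts as an effective dimension.

  Brunn--Minkowski gives the Euclidean isoperimetric inequality in functional form. The change of
  variables \<open>x = norm y powr (b - 1) *\<^sub>R y\<close> and the bathtub principle turn it into an isoperimetric
  inequality on the superlevel sets of \<open>w\<close>, with \<open>\<mu>\<close> as volume and \<open>norm x powr (- \<gamma> / 2)\<close> as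
  perimeter density, in which centred balls are extremal. This holds with an arbitrary multiplier
  \<open>l (\<bar>w x\<bar>)\<close>.

  In the spirit of Cordero-Erausquin, Nazaret and Villani, transport the decreasing rearrangement of
  \<open>w\<close> with respect to \<open>\<mu>\<close> monotonically onto the profile of \<open>w_star\<close>. The arithmetic-geometric mean
  inequality for the transport map, the isoperimetric inequality with the multiplier read off the
  transport map, and Cauchy--Schwarz give an interpolation inequality that is an equality for \<open>w_star\<close>.
  After a dilation and a multiplication by a constant it says that \<open>w_star\<close> minimises \<open>Q_functional\<close>,
  radially or not, for every admissible \<open>\<gamma>\<close>, so \<open>\<gamma>s = d - (d - 2) * p\<close> can be taken. Radial test functions
  approximating \<open>w_star\<close> show that the bound is the infimum.
\<close>

section \<open>The Brunn--Minkowski inequality\<close>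

text \<open>The densities are tied together by Cauchy-Schwarz: for the Dirichlet energy to come out
  unweighted and the other factor to be integrated against \<open>norm x powr (- \<gamma>)\<close>,
  the perimeter density has to be the square root \<open>norm x powr (- \<gamma> / 2)\<close>. That
  centred balls are extremal for this pair is not evident; it holds because the power map that
  flattens the perimeter density leaves a volume density that is nonincreasing in the radius. The
  mass of a ball then enters its perimeter with the exponent \<open>1 - 1 / n\<close>, which is how
  \<open>n\<close> arises. Transport takes place on the half-line of masses, so the angular
  variables are felt only through isoperimetry. The obstacle is regularity: the rearrangement is
  merely continuous and the modulus of \<open>w\<close> merely Lipschitz. Derivatives of level-set
  quantities are therefore avoided; layer-cake formulas replace the coarea formula and the
  integration by parts. The multiplier is what lets the transport map, a function of the level, pass
  through the isoperimetric inequality.\<close>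

lemma set_plus_iff: "z \<in> A + B \<longleftrightarrow> (\<exists>x\<in>A. \<exists>y\<in>B. z = x + y)" for A B :: "'a::plus set"
  by (auto simp: set_plus_def)

lemma open_set_plus: "open A \<Longrightarrow> open (A + B)" for A B :: "'a::real_normed_vector set"
proof -
  assume "open A"
  moreover have "A + B = (\<Union>x\<in>A. \<Union>y\<in>B. {x + y})" by (auto simp: set_plus_iff)
  ultimately show ?thesis by (simp add: open_sums)
qed

lemma bounded_set_plus: "bounded A \<Longrightarrow> bounded B \<Longrightarrow> bounded (A + B)" for A B :: "'a::real_normed_vector set"
  unfolding set_plus_image by (rule bounded_plus)

lemma fmeasurable_open_bounded: "open A \<Longrightarrow> bounded A \<Longrightarrow> A \<in> fmeasurable lborel" for A :: "'a::euclidean_space set"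
  by (auto intro!: fmeasurableI emeasure_bounded_finite borel_open simp: top.not_eq_extremum[symmetric])

text \<open>The family is kept instead of its union because the induction runs on the number of
  boxes. Open boxes remain boxes when cut by open half-spaces, and nonempty ones have positive
  volume, so that volume proportions make sense.\<close>

definition box_family :: "'a::euclidean_space set set \<Rightarrow> bool" where
  "box_family F \<longleftrightarrow> finite F \<and> F \<noteq> {} \<and> disjoint F \<and> (\<forall>Q\<in>F. Q \<noteq> {} \<and> (\<exists>a b. Q = box a b))"

lemma box_familyD:
  assumes "box_family F"
  shows "finite F" "F \<noteq> {}" "disjoint F" "open (\<Union>F)" "bounded (\<Union>F)" "\<Union>F \<noteq> {}"
    "\<Union>F \<in> fmeasurable lborel" "0 < measure lborel (\<Union>F)"
    "measure lborel (\<Union>F) = (\<Sum>Q\<in>F. measure lborel Q)"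
proof -
  show "finite F" "F \<noteq> {}" "disjoint F" "\<Union>F \<noteq> {}" using assms by (auto simp: box_family_def)
  show o: "open (\<Union>F)" using assms unfolding box_family_def by (intro open_Union) (metis open_box)
  show b: "bounded (\<Union>F)" using assms unfolding box_family_def by (intro bounded_Union) (blast, metis bounded_box)
  show fm: "\<Union>F \<in> fmeasurable lborel" using o b by (rule fmeasurable_open_bounded)
  show s: "measure lborel (\<Union>F) = (\<Sum>Q\<in>F. measure lborel Q)"
  proof (rule measure_Union')
    show "S \<in> fmeasurable lborel" if "S \<in> F" for S
      using that assms unfolding box_family_def by (metis fmeasurable_box)
  qed (use \<open>disjoint F\<close> \<open>finite F\<close> in \<open>auto simp: disjoint_def pairwise_def disjnt_def\<close>)
  obtain Q where Q: "Q \<in> F" using \<open>F \<noteq> {}\<close> by auto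
  then obtain a b where "Q = box a b" "Q \<noteq> {}" using assms unfolding box_family_def by blast
  then have "0 < measure lborel Q"
    by (auto simp: measure_lborel_box_eq box_ne_empty intro!: prod_pos simp: inner_diff_left less_imp_le)
  then show "0 < measure lborel (\<Union>F)"
    unfolding s using Q \<open>finite F\<close> by (meson measure_nonneg sum_pos2)
qed

lemma box_Int_halfspace_lt:
  fixes a b :: "'a::euclidean_space"
  assumes "i \<in> Basis"
  shows "box a b \<inter> {x. x \<bullet> i < s} = box a (b + (min (b \<bullet> i) s - b \<bullet> i) *\<^sub>R i)"
  using assms by (auto simp: box_def inner_add_left inner_Basis split: if_splits)

lemma box_Int_halfspace_gt:
  fixes a b :: "'a::euclidean_space"
  assumes "i \<in> Basis"
  shows "box a b \<inter> {x. s < x \<bullet> i} = box (a + (max (a \<bullet> i) s - a \<bullet> i) *\<^sub>R i) b"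
  using assms by (auto simp: box_def inner_add_left inner_Basis split: if_splits)

text \<open>The closed form makes continuity in \<open>s\<close> visible, which feeds the
  intermediate value argument of \<open>box_family_bisect\<close>.\<close>

lemma measure_box_halfspace:
  fixes a b :: "'a::euclidean_space"
  assumes i: "i \<in> Basis" and ne: "box a b \<noteq> {}"
  shows "measure lborel (box a b \<inter> {x. x \<bullet> i < s})
    = max 0 (min (b \<bullet> i) s - a \<bullet> i) * (\<Prod>j\<in>Basis - {i}. (b - a) \<bullet> j)"
proof -
  let ?b = "b + (min (b \<bullet> i) s - b \<bullet> i) *\<^sub>R i"
  have le: "a \<bullet> j < b \<bullet> j" if "j \<in> Basis" for j using ne that by (auto simp: box_ne_empty)
  have bj: "?b \<bullet> j = (if j = i then min (b \<bullet> i) s else b \<bullet> j)" if "j \<in> Basis" for j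
    using i that by (auto simp: inner_add_left inner_Basis)
  have "(\<forall>j\<in>Basis. a \<bullet> j \<le> ?b \<bullet> j) \<longleftrightarrow> a \<bullet> i \<le> min (b \<bullet> i) s"
    using i le by (auto simp: bj less_imp_le split: if_splits)
  moreover have "(\<Prod>j\<in>Basis. (?b - a) \<bullet> j) = (min (b \<bullet> i) s - a \<bullet> i) * (\<Prod>j\<in>Basis - {i}. (b - a) \<bullet> j)"
    using i by (subst prod.remove[OF _ i]) (auto simp: inner_diff_left bj simp del: inner_add_left intro!: prod.cong)
  ultimately show ?thesis
    unfolding box_Int_halfspace_lt[OF i] measure_lborel_box_eq by (auto simp: max_def)
qed

text \<open>Cutting never increases the number of boxes and decreases it as soon as one box misses
  the half-space. This decrease drives the induction for Brunn-Minkowski.\<close>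

lemma box_family_split:
  fixes F :: "'a::euclidean_space set set"
  assumes F: "box_family F" and i: "i \<in> Basis"
    and H: "H = {x. x \<bullet> i < s} \<or> H = {x. s < x \<bullet> i}" and ne: "\<Union>F \<inter> H \<noteq> {}"
  shows "box_family ((\<lambda>Q. Q \<inter> H) ` F - {{}})" "\<Union>((\<lambda>Q. Q \<inter> H) ` F - {{}}) = \<Union>F \<inter> H"
    "card ((\<lambda>Q. Q \<inter> H) ` F - {{}}) \<le> card F"
    "(\<exists>Q\<in>F. Q \<inter> H = {}) \<Longrightarrow> card ((\<lambda>Q. Q \<inter> H) ` F - {{}}) < card F"
proof -
  have fin: "finite F" using F by (simp add: box_family_def)
  show U: "\<Union>((\<lambda>Q. Q \<inter> H) ` F - {{}}) = \<Union>F \<inter> H" by auto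
  have bx: "\<exists>a b. Q \<inter> H = box a b" if "Q \<in> F" for Q
  proof -
    from that F obtain a b where "Q = box a b" unfolding box_family_def by blast
    then show ?thesis using H box_Int_halfspace_lt[OF i] box_Int_halfspace_gt[OF i] by metis
  qed
  have dj: "disjoint ((\<lambda>Q. Q \<inter> H) ` F - {{}})"
    using F unfolding box_family_def disjoint_def by blast
  show "box_family ((\<lambda>Q. Q \<inter> H) ` F - {{}})"
    unfolding box_family_def using fin ne dj bx by (auto) 
  have *: "(\<lambda>Q. Q \<inter> H) ` F - {{}} \<subseteq> (\<lambda>Q. Q \<inter> H) ` {Q\<in>F. Q \<inter> H \<noteq> {}}" by auto
  have c: "card ((\<lambda>Q. Q \<inter> H) ` F - {{}}) \<le> card {Q\<in>F. Q \<inter> H \<noteq> {}}"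
    using card_mono[OF _ *] card_image_le[of "{Q\<in>F. Q \<inter> H \<noteq> {}}" "\<lambda>Q. Q \<inter> H"] fin by (auto intro: order_trans)
  also have "\<dots> \<le> card F" using fin by (intro card_mono) auto
  finally show "card ((\<lambda>Q. Q \<inter> H) ` F - {{}}) \<le> card F" .
  assume "\<exists>Q\<in>F. Q \<inter> H = {}"
  then have "card {Q\<in>F. Q \<inter> H \<noteq> {}} < card F" using fin by (intro psubset_card_mono) auto
  with c show "card ((\<lambda>Q. Q \<inter> H) ` F - {{}}) < card F" by simp
qed

lemma measure_halfspace_split:
  fixes A :: "'a::euclidean_space set"
  assumes A: "A \<in> fmeasurable lborel" and i: "i \<in> Basis"
  shows "measure lborel A = measure lborel (A \<inter> {x. x \<bullet> i < s}) + measure lborel (A \<inter> {x. s < x \<bullet> i})"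
proof -
  have m: "{x::'a. x \<bullet> i < s} \<in> sets lborel" "{x::'a. s < x \<bullet> i} \<in> sets lborel" "{x::'a. x \<bullet> i = s} \<in> sets lborel"
    by measurable
  have "negligible {x::'a. x \<bullet> i = s}" using i by (rule negligible_standard_hyperplane)
  then have z0: "{x::'a. x \<bullet> i = s} \<in> null_sets lborel"
    using m(3) by (simp add: negligible_iff_null_sets null_sets_completion_iff)
  then have z: "A \<inter> {x::'a. x \<bullet> i = s} \<in> null_sets lborel"
    using A m(3) by (intro null_sets_subset[OF z0]) auto
  have "measure lborel A = measure lborel ((A \<inter> {x. x \<bullet> i < s}) \<union> (A \<inter> {x. s < x \<bullet> i}) \<union> (A \<inter> {x::'a. x \<bullet> i = s}))"
    by (rule arg_cong[where f="measure lborel"]) auto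
  also have "\<dots> = measure lborel ((A \<inter> {x. x \<bullet> i < s}) \<union> (A \<inter> {x. s < x \<bullet> i}))"
    using z A m by (intro measure_Un_null_set) auto
  also have "\<dots> = measure lborel (A \<inter> {x. x \<bullet> i < s}) + measure lborel (A \<inter> {x. s < x \<bullet> i})"
    using A m by (intro measure_Un2[THEN trans] ) (auto intro!: arg_cong[where f="measure lborel"] fmeasurable_Int_fmeasurable simp: fmeasurable_Int_fmeasurable)
  finally show ?thesis .
qed

lemma powr_inverse_power:
  fixes x :: real
  assumes "0 < x" "0 < n"
  shows "(x powr (1 / real n)) ^ n = x"
  using assms by (simp add: powr_power)

text \<open>The sum contains a box with side lengths \<open>u j + v j\<close>. After division by the
  volume of that box, the arithmetic-geometric mean inequality bounds the two roots by the averages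
  of \<open>u j / (u j + v j)\<close> and of \<open>v j / (u j + v j)\<close>, which add up to
  1.\<close>

lemma brunn_minkowski_boxes:
  fixes a b a' b' :: "'a::euclidean_space"
  assumes ne: "box a b \<noteq> {}" and ne': "box a' b' \<noteq> {}"
  shows "(measure lborel (box a b) powr (1 / DIM('a)) + measure lborel (box a' b') powr (1 / DIM('a))) ^ DIM('a)
    \<le> measure lborel (box a b + box a' b')"
proof -
  let ?d = "DIM('a)"
  define u where "u = (\<lambda>j. (b - a) \<bullet> j)"
  define v where "v = (\<lambda>j. (b' - a') \<bullet> j)"
  have up: "0 < u j" and vp: "0 < v j" if "j \<in> Basis" for j
    using that ne ne' by (auto simp: u_def v_def box_ne_empty inner_diff_left)
  have sub: "box (a + a') (b + b') \<subseteq> box a b + box a' b'"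
  proof
    fix z assume z: "z \<in> box (a + a') (b + b')"
    \<comment> \<open>\<open>th j\<close> is the relative position of \<open>z\<close> in direction
      \<open>j\<close>; \<open>x\<close> and \<open>y\<close> are placed at the same relative
      position in their own boxes.\<close>
    define th where "th = (\<lambda>j. ((z - a - a') \<bullet> j) / (u j + v j))"
    have th: "0 < th j" "th j < 1" if "j \<in> Basis" for j
      using z that up[OF that] vp[OF that]
      by (auto simp: th_def u_def v_def box_def inner_simps field_simps)
    define x where "x = (\<Sum>j\<in>Basis. (a \<bullet> j + th j * u j) *\<^sub>R j)"
    define y where "y = (\<Sum>j\<in>Basis. (a' \<bullet> j + th j * v j) *\<^sub>R j)"
    have "x \<in> box a b" using th up 
      by (auto simp: x_def box_def) (smt (verit) inner_diff_left mult_less_cancel_right2 u_def)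
    moreover have "y \<in> box a' b'" using th vp 
      by (auto simp: y_def box_def) (smt (verit) inner_diff_left mult_less_cancel_right2 v_def)
    moreover have "z = x + y"
    proof (rule euclidean_eqI)
      fix j :: 'a assume j: "j \<in> Basis"
      have "th j * u j + th j * v j = (z - a - a') \<bullet> j"
        using up[OF j] vp[OF j] unfolding distrib_left[symmetric] by (simp add: th_def)
      then show "z \<bullet> j = (x + y) \<bullet> j" using j by (simp add: x_def y_def inner_simps)
    qed
    ultimately show "z \<in> box a b + box a' b'" by (auto simp: set_plus_iff)
  qed
  have m1: "measure lborel (box a b) = (\<Prod>j\<in>Basis. u j)" 
    using up unfolding measure_lborel_box_eq u_def by (auto simp: inner_diff_left less_imp_le)
  have m2: "measure lborel (box a' b') = (\<Prod>j\<in>Basis. v j)" 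
    using vp unfolding measure_lborel_box_eq v_def by (auto simp: inner_diff_left less_imp_le)
  have m3: "measure lborel (box (a+a') (b+b')) = (\<Prod>j\<in>Basis. u j + v j)" 
  proof -
    have "a \<bullet> j \<le> b \<bullet> j" "a' \<bullet> j \<le> b' \<bullet> j" if "j \<in> Basis" for j
      using up[OF that] vp[OF that] by (auto simp: u_def v_def inner_simps)
    then show ?thesis
      unfolding measure_lborel_box_eq u_def v_def 
      by (auto simp: inner_simps algebra_simps add_mono intro!: prod.cong)
  qed
  let ?P = "\<Prod>j\<in>Basis. u j + v j"
  have uv: "u j + v j \<noteq> 0" if "j \<in> Basis" for j using up[OF that] vp[OF that] by simp
  have Pp: "0 < ?P" using up vp by (intro prod_pos) (auto intro: add_pos_pos)
  have q: "(\<Prod>j\<in>Basis. f j) powr (1 / ?d) \<le> ?P powr (1 / ?d) * (\<Sum>j\<in>Basis. f j / (u j + v j)) / ?d"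
    if f: "\<And>j. j \<in> Basis \<Longrightarrow> 0 < f j" for f :: "'a \<Rightarrow> real"
  proof -
    have "(\<Prod>j\<in>Basis. f j) = ?P * (\<Prod>j\<in>Basis. f j / (u j + v j))"
      using uv by (subst prod.distrib[symmetric], intro prod.cong) auto
    also have "\<dots> powr (1 / ?d) = ?P powr (1 / ?d) * (\<Prod>j\<in>Basis. f j / (u j + v j)) powr (1 / ?d)"
      by (rule powr_mult) 
    also have "\<dots> \<le> ?P powr (1 / ?d) * (\<Sum>j\<in>Basis. (f j / (u j + v j)) / ?d)"
    proof (intro mult_left_mono arith_geom_mean)
      show "\<And>i. i \<in> Basis \<Longrightarrow> 0 \<le> f i / (u i + v i)" using f up vp by (meson add_pos_pos divide_pos_pos less_imp_le)
    qed auto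
    finally show ?thesis unfolding sum_divide_distrib[symmetric] by simp
  qed
  have "(\<Prod>j\<in>Basis. u j) powr (1 / ?d) + (\<Prod>j\<in>Basis. v j) powr (1 / ?d)
    \<le> ?P powr (1 / ?d) * (\<Sum>j\<in>Basis. u j / (u j + v j)) / ?d + ?P powr (1 / ?d) * (\<Sum>j\<in>Basis. v j / (u j + v j)) / ?d"
    using q[of u] q[of v] up vp by (intro add_mono) auto
  also have "\<dots> = ?P powr (1 / ?d) * (\<Sum>j\<in>Basis. u j / (u j + v j) + v j / (u j + v j)) / ?d"
    by (simp add: sum.distrib algebra_simps add_divide_distrib)
  also have "(\<Sum>j\<in>Basis. u j / (u j + v j) + v j / (u j + v j)) = (\<Sum>j\<in>(Basis::'a set). 1)"
    using up vp by (intro sum.cong) (auto simp: add_divide_distrib[symmetric] less_imp_neq[THEN not_sym] add_pos_pos)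
  finally have "(\<Prod>j\<in>Basis. u j) powr (1 / ?d) + (\<Prod>j\<in>Basis. v j) powr (1 / ?d) \<le> ?P powr (1 / ?d)"
    by simp
  then have "((\<Prod>j\<in>Basis. u j) powr (1 / ?d) + (\<Prod>j\<in>Basis. v j) powr (1 / ?d)) ^ ?d \<le> (?P powr (1 / ?d)) ^ ?d"
    by (intro power_mono) auto
  also have "\<dots> = ?P" using Pp by (intro powr_inverse_power) auto
  also have "\<dots> \<le> measure lborel (box a b + box a' b')"
    unfolding m3[symmetric]
    by (intro measure_mono_fmeasurable sub fmeasurable_open_bounded open_set_plus bounded_set_plus) auto
  finally show ?thesis unfolding m1 m2 .
qed

text \<open>The volume on one side of a moving hyperplane grows continuously from 0 to the full
  volume, so it passes through the proportion \<open>r\<close>; the hyperplane itself is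
  null.\<close>

lemma box_family_bisect:
  fixes G :: "'a::euclidean_space set set"
  assumes G: "box_family G" and i: "i \<in> Basis" and r: "0 < r" "r < 1"
  obtains s where "measure lborel (\<Union>G \<inter> {x. x \<bullet> i < s}) = r * measure lborel (\<Union>G)"
    "measure lborel (\<Union>G \<inter> {x. s < x \<bullet> i}) = (1 - r) * measure lborel (\<Union>G)"
proof -
  note D = box_familyD[OF G]
  define g where "g = (\<lambda>s. measure lborel (\<Union>G \<inter> {x. x \<bullet> i < s}))"
  have "g s = (\<Sum>Q\<in>G. measure lborel (Q \<inter> {x. x \<bullet> i < s}))" for s
  proof -
    have "\<Union>G \<inter> {x. x \<bullet> i < s} = (\<Union>Q\<in>G. Q \<inter> {x. x \<bullet> i < s})" by auto
    moreover have "Q \<inter> {x. x \<bullet> i < s} \<in> fmeasurable lborel" if "Q \<in> G" for Q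
    proof -
      from that G obtain a b where "Q = box a b" unfolding box_family_def by blast
      then show ?thesis using box_Int_halfspace_lt[OF i] fmeasurable_box by metis
    qed
    moreover have "disjoint_family_on (\<lambda>Q. Q \<inter> {x. x \<bullet> i < s}) G"
      using D(3) by (auto simp: disjoint_family_on_def disjoint_def)
    ultimately show ?thesis using D(1) unfolding g_def
      by (simp only:) (rule measure_finite_Union; fastforce simp: fmeasurable_def)
  qed
  then have g: "g = (\<lambda>s. \<Sum>Q\<in>G. measure lborel (Q \<inter> {x. x \<bullet> i < s}))" by auto
  have cont: "continuous_on S g" for S
    unfolding g
  proof (intro continuous_on_sum)
    fix Q assume "Q \<in> G"
    then obtain a b where Q: "Q = box a b" "box a b \<noteq> {}" using G unfolding box_family_def by blast
    show "continuous_on S (\<lambda>s. measure lborel (Q \<inter> {x. x \<bullet> i < s}))"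
      unfolding Q measure_box_halfspace[OF i Q(2)] by (intro continuous_intros)
  qed
  obtain R where R: "\<And>x. x \<in> \<Union>G \<Longrightarrow> norm x \<le> R" using D(5) unfolding bounded_iff by blast
  have R': "\<bar>x \<bullet> i\<bar> \<le> R" if "x \<in> \<Union>G" for x
    using R[OF that] Basis_le_norm[OF i, of x] by simp
  have R0: "0 \<le> R" using D(6) R norm_ge_zero by (meson all_not_in_conv order_trans)
  have "\<Union>G \<inter> {x. x \<bullet> i < -R-1} = {}" using R' by fastforce
  then have g0: "g (-R-1) = 0" by (simp add: g_def)
  have "\<Union>G \<inter> {x. x \<bullet> i < R+1} = \<Union>G" using R' by fastforce
  then have g1: "g (R+1) = measure lborel (\<Union>G)" by (simp add: g_def)
  have "\<exists>s\<ge>-R-1. s \<le> R+1 \<and> g s = r * measure lborel (\<Union>G)"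
    using r D(8) R0 by (intro IVT' cont) (auto simp: g0 g1)
  then obtain s where "g s = r * measure lborel (\<Union>G)" by blast
  moreover from this have "measure lborel (\<Union>G \<inter> {x. s < x \<bullet> i}) = (1 - r) * measure lborel (\<Union>G)"
    using measure_halfspace_split[OF D(7) i, of s] by (simp add: g_def algebra_simps)
  ultimately show ?thesis using that unfolding g_def by blast
qed

text \<open>Cutting \<open>F\<close> by a hyperplane that separates two of its boxes and \<open>G\<close> by a parallel hyperplane
  in the same volume proportion: the two halves add up on opposite sides of a hyperplane.\<close>

lemma brunn_minkowski_step:
  fixes F G :: "'a::euclidean_space set set"
  assumes F: "box_family F" and G: "box_family G" and c: "2 \<le> card F"
    and IH: "\<And>(F' :: 'a set set) (G' :: 'a set set). box_family F' \<Longrightarrow> box_family G' \<Longrightarrow> card F' < card F \<Longrightarrow> card G' \<le> card G \<Longrightarrow>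
      (measure lborel (\<Union>F') powr (1 / DIM('a)) + measure lborel (\<Union>G') powr (1 / DIM('a))) ^ DIM('a)
        \<le> measure lborel (\<Union>F' + \<Union>G')"
  shows "(measure lborel (\<Union>F) powr (1 / DIM('a)) + measure lborel (\<Union>G) powr (1 / DIM('a))) ^ DIM('a)
        \<le> measure lborel (\<Union>F + \<Union>G)"
proof -
  note DF = box_familyD[OF F] and DG = box_familyD[OF G]
  \<comment> \<open>Disjoint boxes have disjoint projections to some axis. Since \<open>P\<close>
    and \<open>R\<close> lie on opposite sides of the cut, each half of \<open>F\<close> loses one
    of them, so both halves have fewer boxes than \<open>F\<close>.\<close>
  obtain i c0 P R where i: "i \<in> Basis" and P: "P \<in> F" "P \<subseteq> {x. x \<bullet> i < c0}" and R: "R \<in> F" "R \<subseteq> {x. c0 < x \<bullet> i}"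
  proof -
    obtain Q1 Q2 where Q: "Q1 \<in> F" "Q2 \<in> F" "Q1 \<noteq> Q2"
      using c by (metis One_nat_def card_le_Suc0_iff_eq DF(1) not_less_eq_eq numeral_2_eq_2)
    obtain a b where ab: "Q1 = box a b" "box a b \<noteq> {}" using Q F unfolding box_family_def by blast
    obtain a' b' where ab': "Q2 = box a' b'" "box a' b' \<noteq> {}" using Q F unfolding box_family_def by blast
    have "box a b \<inter> box a' b' = {}" using Q DF(3) ab ab' unfolding disjoint_def by blast
    then obtain i where i: "i \<in> Basis" "b \<bullet> i \<le> a' \<bullet> i \<or> b' \<bullet> i \<le> a \<bullet> i"
      using ab(2) ab'(2) unfolding disjoint_interval box_ne_empty by (metis not_less)
    from i(2) show ?thesis
    proof
      assume "b \<bullet> i \<le> a' \<bullet> i"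
      then show ?thesis using i(1) Q ab ab' by (intro that[of i Q1 "b \<bullet> i" Q2]) (auto simp: box_def intro: le_less_trans)
    next
      assume "b' \<bullet> i \<le> a \<bullet> i"
      then show ?thesis using i(1) Q ab ab' by (intro that[of i Q2 "b' \<bullet> i" Q1]) (auto simp: box_def intro: le_less_trans)
    qed
  qed
  define H1 where "H1 = {x::'a. x \<bullet> i < c0}"
  define H2 where "H2 = {x::'a. c0 < x \<bullet> i}"
  have PH: "P \<inter> H2 = {}" "P \<subseteq> H1" "R \<inter> H1 = {}" "R \<subseteq> H2" using P R by (auto simp: H1_def H2_def)
  have PR: "P \<noteq> {}" "R \<noteq> {}" using P R F by (auto simp: box_family_def)
  have ne: "\<Union>F \<inter> H1 \<noteq> {}" "\<Union>F \<inter> H2 \<noteq> {}" using P R PH PR by blast+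
  let ?F1 = "(\<lambda>Q. Q \<inter> H1) ` F - {{}}" and ?F2 = "(\<lambda>Q. Q \<inter> H2) ` F - {{}}"
  have F1: "box_family ?F1" "\<Union>?F1 = \<Union>F \<inter> H1" "card ?F1 < card F"
    using box_family_split[OF F i, of H1 c0] ne P R PH by (auto simp: H1_def)
  have F2: "box_family ?F2" "\<Union>?F2 = \<Union>F \<inter> H2" "card ?F2 < card F"
    using box_family_split[OF F i, of H2 c0] ne P R PH by (auto simp: H2_def)
  define \<alpha> where "\<alpha> = measure lborel (\<Union>F)"
  define \<beta> where "\<beta> = measure lborel (\<Union>G)"
  have ap: "0 < \<alpha>" "0 < \<beta>" using DF(8) DG(8) by (simp_all add: \<alpha>_def \<beta>_def)
  have sum: "\<alpha> = measure lborel (\<Union>?F1) + measure lborel (\<Union>?F2)"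
    unfolding F1(2) F2(2) \<alpha>_def unfolding H1_def H2_def by (rule measure_halfspace_split[OF DF(7) i])
  have p12: "0 < measure lborel (\<Union>?F1)" "0 < measure lborel (\<Union>?F2)" using box_familyD(8)[OF F1(1)] box_familyD(8)[OF F2(1)] .
  define r where "r = measure lborel (\<Union>?F1) / \<alpha>"
  have r: "0 < r" "r < 1" using p12 sum ap by (simp_all add: r_def)
  have m1: "measure lborel (\<Union>?F1) = r * \<alpha>" using ap by (simp add: r_def)
  have m2: "measure lborel (\<Union>?F2) = (1 - r) * \<alpha>" using m1 sum by (simp add: algebra_simps)
  obtain s where s: "measure lborel (\<Union>G \<inter> {x. x \<bullet> i < s}) = r * \<beta>"
    "measure lborel (\<Union>G \<inter> {x. s < x \<bullet> i}) = (1 - r) * \<beta>"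
    using box_family_bisect[OF G i r] unfolding \<beta>_def by blast
  define K1 where "K1 = {x::'a. x \<bullet> i < s}"
  define K2 where "K2 = {x::'a. s < x \<bullet> i}"
  let ?G1 = "(\<lambda>Q. Q \<inter> K1) ` G - {{}}" and ?G2 = "(\<lambda>Q. Q \<inter> K2) ` G - {{}}"
  have "r * \<beta> \<noteq> 0" "(1 - r) * \<beta> \<noteq> 0" using r ap by auto
  then have neG: "\<Union>G \<inter> K1 \<noteq> {}" "\<Union>G \<inter> K2 \<noteq> {}" using s unfolding K1_def K2_def by fastforce+
  have G1: "box_family ?G1" "\<Union>?G1 = \<Union>G \<inter> K1" "card ?G1 \<le> card G"
    using box_family_split[OF G i, of K1 s] neG by (auto simp: K1_def)
  have G2: "box_family ?G2" "\<Union>?G2 = \<Union>G \<inter> K2" "card ?G2 \<le> card G"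
    using box_family_split[OF G i, of K2 s] neG by (auto simp: K2_def)
  have n1: "measure lborel (\<Union>?G1) = r * \<beta>" "measure lborel (\<Union>?G2) = (1 - r) * \<beta>"
    using s by (simp_all only: G1 G2) (simp_all add: K1_def K2_def)
  \<comment> \<open>The bound is homogeneous of degree one in the two volumes, so the bounds for the
    proportions \<open>r\<close> and \<open>1 - r\<close> add up to the bound for the whole.\<close>
  have scale: "((q * \<alpha>) powr (1 / DIM('a)) + (q * \<beta>) powr (1 / DIM('a))) ^ DIM('a) =
      q * (\<alpha> powr (1 / DIM('a)) + \<beta> powr (1 / DIM('a))) ^ DIM('a)" if "0 < q" for q
  proof -
    have "((q * \<alpha>) powr (1 / DIM('a)) + (q * \<beta>) powr (1 / DIM('a))) =
      q powr (1 / DIM('a)) * (\<alpha> powr (1 / DIM('a)) + \<beta> powr (1 / DIM('a)))"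
      using that ap by (simp add: powr_mult algebra_simps)
    moreover have "(q powr (1 / DIM('a))) ^ DIM('a) = q" using that by (simp add: powr_power)
    ultimately show ?thesis by (simp add: power_mult_distrib)
  qed
  let ?S = "\<Union>F + \<Union>G"
  let ?S1 = "\<Union>?F1 + \<Union>?G1" and ?S2 = "\<Union>?F2 + \<Union>?G2"
  have fm: "\<Union>F' + \<Union>G' \<in> fmeasurable lborel" if "box_family F'" "box_family G'" for F' G' :: "'a set set"
    using box_familyD(4,5)[OF that(1)] box_familyD(5)[OF that(2)]
    by (intro fmeasurable_open_bounded open_set_plus bounded_set_plus)
  have "?S1 \<subseteq> {x. x \<bullet> i < c0 + s}" "?S2 \<subseteq> {x. c0 + s < x \<bullet> i}"
    unfolding F1 F2 G1 G2 H1_def H2_def K1_def K2_def by (auto simp: set_plus_iff inner_add_left)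
  then have disj: "?S1 \<inter> ?S2 = {}" by fastforce
  have "(\<alpha> powr (1 / DIM('a)) + \<beta> powr (1 / DIM('a))) ^ DIM('a) =
    r * (\<alpha> powr (1 / DIM('a)) + \<beta> powr (1 / DIM('a))) ^ DIM('a) +
    (1 - r) * (\<alpha> powr (1 / DIM('a)) + \<beta> powr (1 / DIM('a))) ^ DIM('a)" by (simp add: algebra_simps)
  also have "\<dots> \<le> measure lborel ?S1 + measure lborel ?S2"
    using IH[OF F1(1) G1(1) F1(3) G1(3)] IH[OF F2(1) G2(1) F2(3) G2(3)] r
    unfolding m1 m2 n1 by (simp add: scale)
  also have "\<dots> = measure lborel (?S1 \<union> ?S2)"
    using fm[OF F1(1) G1(1)] fm[OF F2(1) G2(1)] disj by (subst measure_Un2) (auto simp: Diff_triv Int_commute)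
  also have "\<dots> \<le> measure lborel ?S"
  proof (rule measure_mono_fmeasurable)
    show "?S1 \<union> ?S2 \<subseteq> ?S" by (intro Un_least set_plus_mono2) auto
    show "?S1 \<union> ?S2 \<in> sets lborel"
      by (intro sets.Un fmeasurableD fm F1(1) F2(1) G1(1) G2(1))
  qed (rule fm[OF F G])
  finally show ?thesis unfolding \<alpha>_def \<beta>_def .
qed

text \<open>Induction on the total number of boxes. The cutting step asks for two boxes in one of
  the families only, and commutativity of the sum exchanges the roles; two single boxes are the base
  case.\<close>

lemma brunn_minkowski_families:
  fixes F G :: "'a::euclidean_space set set"
  assumes "box_family F" "box_family G"
  shows "(measure lborel (\<Union>F) powr (1 / DIM('a)) + measure lborel (\<Union>G) powr (1 / DIM('a))) ^ DIM('a)
        \<le> measure lborel (\<Union>F + \<Union>G)"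
  using assms
proof (induction "card F + card G" arbitrary: F G rule: less_induct)
  case less
  show ?case
  proof (cases "2 \<le> card F")
    case True
    show ?thesis
    proof (rule brunn_minkowski_step[OF less(2,3) True])
      fix F' G' :: "'a set set"
      assume *: "box_family F'" "box_family G'" "card F' < card F" "card G' \<le> card G"
      show "(measure lborel (\<Union>F') powr (1 / DIM('a)) + measure lborel (\<Union>G') powr (1 / DIM('a))) ^ DIM('a)
          \<le> measure lborel (\<Union>F' + \<Union>G')"
        by (rule less(1)[OF _ *(1,2)]) (use *(3,4) in linarith)
    qed
  next
    case F1: False
    show ?thesis
    proof (cases "2 \<le> card G")
      case True
      have "(measure lborel (\<Union>G) powr (1 / DIM('a)) + measure lborel (\<Union>F) powr (1 / DIM('a))) ^ DIM('a)
        \<le> measure lborel (\<Union>G + \<Union>F)"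
      proof (rule brunn_minkowski_step[OF less(3,2) True])
        fix F' G' :: "'a set set"
        assume *: "box_family F'" "box_family G'" "card F' < card G" "card G' \<le> card F"
        then have "card G' + card F' < card F + card G" by linarith
        from less(1)[OF this *(2,1)] show "(measure lborel (\<Union>F') powr (1 / DIM('a)) + measure lborel (\<Union>G') powr (1 / DIM('a))) ^ DIM('a)
          \<le> measure lborel (\<Union>F' + \<Union>G')"
          by (simp only: add.commute)
      qed
      then show ?thesis
        by (simp only: add.commute)
    next
      case G1: False
      have "card F \<noteq> 0" "card G \<noteq> 0"
        using box_familyD(1,2)[OF less(2)] box_familyD(1,2)[OF less(3)] by simp_all
      then have "card F = 1" "card G = 1" using F1 G1 by linarith+
      then obtain P Q where PQ: "F = {P}" "G = {Q}" by (metis card_1_singletonE)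
      obtain a b where ab: "P = box a b" "box a b \<noteq> {}"
        using less(2) unfolding PQ box_family_def by (metis singletonI)
      obtain a' b' where ab': "Q = box a' b'" "box a' b' \<noteq> {}"
        using less(3) unfolding PQ box_family_def by (metis singletonI)
      have "\<Union>F = box a b" "\<Union>G = box a' b'" unfolding PQ ab(1) ab'(1) by simp_all
      then show ?thesis using brunn_minkowski_boxes[OF ab(2) ab'(2)] by (simp only:)
    qed
  qed
qed

section \<open>From unions of boxes to bounded open sets\<close>

text \<open>A countable covering of \<open>A\<close> by nonoverlapping closed boxes inside
  \<open>A\<close> exhausts its volume. Finitely many of them miss less than \<open>e\<close>, and
  passing to interiors removes only null frontiers.\<close>

lemma open_bounded_inner_approx:
  fixes A :: "'a::euclidean_space set"
  assumes A: "open A" "bounded A" "A \<noteq> {}" and e: "0 < e"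
  obtains F where "box_family F" "\<Union>F \<subseteq> A" "measure lborel A - e < measure lborel (\<Union>F)"
proof -
  obtain c where c: "A \<subseteq> cbox (-c) c" using bounded_subset_cbox_symmetric[OF A(2)] by blast
  have "A \<subseteq> box (-c) c" using A(1) c interior_maximal interior_cbox by metis
  then have ne: "box (-c) c \<noteq> {}" using A(3) by blast
  \<comment> \<open>With this gauge a covering box tagged by a point of \<open>A\<close> is forced
    to lie in \<open>A\<close>.\<close>
  have "gauge (\<lambda>x. if x \<in> A then A else UNIV)" using A(1) by (auto simp: gauge_def)
  from covering_lemma[OF c ne this] obtain \<D> where \<D>: "countable \<D>" "\<And>K. K \<in> \<D> \<Longrightarrow> interior K \<noteq> {} \<and> (\<exists>c d. K = cbox c d)"
    "pairwise (\<lambda>A B. interior A \<inter> interior B = {}) \<D>"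
    "\<And>K. K \<in> \<D> \<Longrightarrow> \<exists>x \<in> A \<inter> K. K \<subseteq> (if x \<in> A then A else UNIV)"
    "A \<subseteq> \<Union>\<D>"
    by metis
  have sub: "K \<subseteq> A" if "K \<in> \<D>" for K using \<D>(4)[OF that] by auto
  have ne\<D>: "\<D> \<noteq> {}" using \<D>(5) A(3) by auto
  define X where "X = (\<lambda>n. \<Union>k\<le>n. from_nat_into \<D> k)"
  have X\<D>: "from_nat_into \<D> k \<in> \<D>" for k using ne\<D> by (rule from_nat_into)
  have XU: "(\<Union>n. X n) = A"
  proof
    show "(\<Union>n. X n) \<subseteq> A" using sub X\<D> by (auto simp: X_def)
    show "A \<subseteq> (\<Union>n. X n)"
    proof
      fix x assume "x \<in> A"
      then obtain K where "K \<in> \<D>" "x \<in> K" using \<D>(5) by auto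
      moreover obtain k where "K = from_nat_into \<D> k" using \<open>K \<in> \<D>\<close> \<D>(1) by (metis from_nat_into_surj)
      ultimately show "x \<in> (\<Union>n. X n)" by (auto simp: X_def)
    qed
  qed
  have KB: "K \<in> sets lborel" if "K \<in> \<D>" for K using \<D>(2)[OF that] by auto
  have fmA: "A \<in> fmeasurable lborel" using A by (intro fmeasurable_open_bounded)
  have "(\<lambda>n. measure lborel (X n)) \<longlonglongrightarrow> measure lborel (\<Union>n. X n)"
  proof (rule Lim_measure_incseq)
    show "range X \<subseteq> sets lborel" using KB X\<D> by (auto simp: X_def)
    show "incseq X" unfolding X_def incseq_def by (intro allI impI UN_mono) auto
    show "emeasure lborel (\<Union>n. X n) \<noteq> \<infinity>" using fmA unfolding XU fmeasurable_def by auto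
  qed
  then have "\<forall>\<^sub>F n in sequentially. measure lborel A - e < measure lborel (X n)"
    unfolding XU using e by (intro order_tendstoD) auto
  then obtain n where n: "measure lborel A - e < measure lborel (X n)" by (auto simp: eventually_sequentially)
  define I where "I = (\<lambda>k. interior (from_nat_into \<D> k))"
  define F where "F = I ` {..n}"
  have I: "I k \<noteq> {}" "\<exists>a b. I k = box a b" "I k \<subseteq> from_nat_into \<D> k" for k
    using \<D>(2)[OF X\<D>, of k] interior_subset unfolding I_def by (metis interior_cbox)+
  have dj: "I k \<inter> I l = {}" if "I k \<noteq> I l" for k l
    using \<D>(3) X\<D>[of k] X\<D>[of l] that unfolding pairwise_def I_def by metis
  have F: "box_family F"
    unfolding box_family_def F_def disjoint_def using I(1,2) dj by blast
  moreover have "\<Union>F \<subseteq> X n" unfolding F_def X_def using I(3) by blast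
  moreover have "X n \<subseteq> A" using XU by blast
  moreover have "measure lborel (X n) = measure lborel (\<Union>F)"
  proof -
    have null: "from_nat_into \<D> k - I k \<in> null_sets lborel" for k
    proof -
      obtain a b where K: "from_nat_into \<D> k = cbox a b" using \<D>(2)[OF X\<D>, of k] by blast
      have "negligible (from_nat_into \<D> k - I k)" unfolding K I_def interior_cbox by (rule negligible_frontier_interval)
      moreover have "from_nat_into \<D> k - I k \<in> sets lborel" unfolding K I_def by simp
      ultimately show ?thesis by (simp add: negligible_iff_null_sets null_sets_completion_iff)
    qed
    have N: "(\<Union>k\<in>{..n}. from_nat_into \<D> k - I k) \<in> null_sets lborel"
      using null by (intro null_sets_UN') auto
    have E: "X n = \<Union>F \<union> (\<Union>k\<in>{..n}. from_nat_into \<D> k - I k)"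
      unfolding X_def F_def using I(3) by blast
    show ?thesis
      unfolding E by (rule measure_Un_null_set[OF fmeasurableD[OF box_familyD(7)[OF F]] N])
  qed
  ultimately show ?thesis using n that[of F] by simp
qed

lemma measure_open_pos:
  fixes A :: "'a::euclidean_space set"
  assumes A: "open A" "bounded A" "A \<noteq> {}"
  shows "0 < measure lborel A"
proof -
  obtain F where F: "box_family F" "\<Union>F \<subseteq> A" using open_bounded_inner_approx[OF A zero_less_one] .
  have "measure lborel (\<Union>F) \<le> measure lborel A"
    using F A box_familyD(7)[OF F(1)] fmeasurable_open_bounded[of A] by (intro measure_mono_fmeasurable) auto
  then show ?thesis using box_familyD(8)[OF F(1)] by simp
qed

text \<open>Sums of inner approximations stay inside \<open>A + B\<close>, so only the left-hand
  side has to pass to the limit.\<close>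

theorem brunn_minkowski:
  fixes A B :: "'a::euclidean_space set"
  assumes A: "open A" "bounded A" "A \<noteq> {}" and B: "open B" "bounded B" "B \<noteq> {}"
  shows "(measure lborel A powr (1 / DIM('a)) + measure lborel B powr (1 / DIM('a))) ^ DIM('a)
        \<le> measure lborel (A + B)"
proof -
  have fmS: "A + B \<in> fmeasurable lborel"
    using A B by (intro fmeasurable_open_bounded open_set_plus bounded_set_plus)
  have "\<exists>F. \<forall>k::nat. box_family (F k) \<and> \<Union>(F k) \<subseteq> A \<and> measure lborel A - 1 / Suc k < measure lborel (\<Union>(F k))"
    by (intro choice allI) (metis open_bounded_inner_approx[OF A] zero_less_divide_1_iff of_nat_0_less_iff zero_less_Suc)
  then obtain F where F: "\<And>k. box_family (F k)" "\<And>k. \<Union>(F k) \<subseteq> A" "\<And>k. measure lborel A - 1 / Suc k < measure lborel (\<Union>(F k))"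
    by blast
  have "\<exists>F. \<forall>k::nat. box_family (F k) \<and> \<Union>(F k) \<subseteq> B \<and> measure lborel B - 1 / Suc k < measure lborel (\<Union>(F k))"
    by (intro choice allI) (metis open_bounded_inner_approx[OF B] zero_less_divide_1_iff of_nat_0_less_iff zero_less_Suc)
  then obtain G where G: "\<And>k. box_family (G k)" "\<And>k. \<Union>(G k) \<subseteq> B" "\<And>k. measure lborel B - 1 / Suc k < measure lborel (\<Union>(G k))"
    by blast
  have lim: "(\<lambda>k. measure lborel (\<Union>(F' k))) \<longlonglongrightarrow> measure lborel C"
    if "\<And>k. box_family (F' k)" "\<And>k. \<Union>(F' k) \<subseteq> C" "\<And>k. measure lborel C - 1 / Suc k < measure lborel (\<Union>(F' k))"
      "C \<in> fmeasurable lborel"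
    for F' :: "nat \<Rightarrow> 'a set set" and C
  proof (rule tendsto_sandwich)
    show "(\<lambda>k. measure lborel C - 1 / Suc k) \<longlonglongrightarrow> measure lborel C"
      by (rule tendsto_eq_intros LIMSEQ_inverse_real_of_nat[unfolded inverse_eq_divide] refl)+ simp
    show "\<forall>\<^sub>F k in sequentially. measure lborel C - 1 / Suc k \<le> measure lborel (\<Union>(F' k))"
      using that(3) less_imp_le by (intro always_eventually) blast
    show "\<forall>\<^sub>F k in sequentially. measure lborel (\<Union>(F' k)) \<le> measure lborel C"
      using that(2,4) box_familyD(7)[OF that(1)] by (intro always_eventually allI measure_mono_fmeasurable fmeasurableD)
  qed simp
  have "(\<lambda>k. (measure lborel (\<Union>(F k)) powr (1 / DIM('a)) + measure lborel (\<Union>(G k)) powr (1 / DIM('a))) ^ DIM('a))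
    \<longlonglongrightarrow> (measure lborel A powr (1 / DIM('a)) + measure lborel B powr (1 / DIM('a))) ^ DIM('a)"
    using measure_open_pos[OF A] measure_open_pos[OF B]
    by (intro tendsto_intros lim F G fmeasurable_open_bounded A B) auto
  moreover have "(measure lborel (\<Union>(F k)) powr (1 / DIM('a)) + measure lborel (\<Union>(G k)) powr (1 / DIM('a))) ^ DIM('a)
    \<le> measure lborel (A + B)" for k
  proof -
    have "measure lborel ((\<Union>(F k)) + (\<Union>(G k))) \<le> measure lborel (A + B)"
      using box_familyD[OF F(1)] box_familyD[OF G(1)]
      by (intro measure_mono_fmeasurable set_plus_mono2 F G fmS fmeasurableD fmeasurable_open_bounded open_set_plus bounded_set_plus)
    then show ?thesis using brunn_minkowski_families[OF F(1) G(1)] order_trans by blast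
  qed
  ultimately show ?thesis by (intro LIMSEQ_le_const2) auto
qed

section \<open>Volume growth of parallel sets\<close>

text \<open>These are the first two terms of the binomial expansion; they linearise Brunn-Minkowski
  in the radius of the added ball.\<close>

lemma power_add_ge:
  fixes a x :: real
  assumes "0 \<le> a" "0 \<le> x"
  shows "a ^ Suc n + Suc n * x * a ^ n \<le> (a + x) ^ Suc n"
proof (induction n)
  case (Suc n)
  have "a ^ Suc (Suc n) + Suc (Suc n) * x * a ^ Suc n \<le> (a + x) * (a ^ Suc n + Suc n * x * a ^ n)"
    using assms by (simp add: algebra_simps)
  also have "\<dots> \<le> (a + x) * (a + x) ^ Suc n" using Suc assms by (intro mult_left_mono) auto
  finally show ?case by simp
qed (use assms in auto)

text \<open>Brunn-Minkowski with a ball of radius \<open>e\<close>, linearised. The coefficient of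
  \<open>e\<close> is the surface area of the ball that has the volume of \<open>A\<close>.\<close>

lemma measure_parallel_set_ge:
  fixes A :: "'a::euclidean_space set"
  assumes A: "open A" "bounded A" and e: "0 < e"
  shows "measure lborel A + e * (DIM('a) * unit_ball_vol DIM('a) powr (1 / DIM('a)) * measure lborel A powr (1 - 1 / DIM('a)))
    \<le> measure lborel (A + ball 0 e)"
proof (cases "A = {}")
  case False
  define \<alpha> where "\<alpha> = measure lborel A powr (1 / DIM('a))"
  define \<omega> where "\<omega> = unit_ball_vol DIM('a)"
  have \<omega>: "0 < \<omega>" by (simp add: \<omega>_def)
  obtain n where n: "DIM('a) = Suc n" by (metis DIM_positive gr0_conv_Suc)
  have \<alpha>1: "\<alpha> ^ Suc n = measure lborel A"
    unfolding n[symmetric] \<alpha>_def using measure_open_pos[OF A False] by (simp add: powr_power)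
  have \<alpha>2: "\<alpha> ^ n = measure lborel A powr (1 - 1 / DIM('a))"
  proof -
    have "\<alpha> ^ n = measure lborel A powr (real n / DIM('a))"
      using measure_open_pos[OF A False] by (simp add: \<alpha>_def powr_power)
    also have "real n / DIM('a) = 1 - 1 / DIM('a)" unfolding n by (simp add: field_simps)
    finally show ?thesis .
  qed
  have b: "measure lborel (ball (0::'a) e) powr (1 / DIM('a)) = e * \<omega> powr (1 / DIM('a))"
  proof -
    have "measure lborel (ball (0::'a) e) = e powr DIM('a) * \<omega>" using e by (simp add: content_ball \<omega>_def powr_realpow)
    then show ?thesis using e \<omega> by (simp add: powr_mult powr_powr)
  qed
  have "measure lborel A + e * (DIM('a) * \<omega> powr (1 / DIM('a)) * measure lborel A powr (1 - 1 / DIM('a)))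
     = \<alpha> ^ Suc n + Suc n * (e * \<omega> powr (1 / DIM('a))) * \<alpha> ^ n"
    unfolding \<alpha>1 \<alpha>2 n by (simp add: algebra_simps)
  also have "\<dots> \<le> (\<alpha> + e * \<omega> powr (1 / DIM('a))) ^ Suc n"
    using e by (intro power_add_ge) (auto simp: \<alpha>_def)
  also have "\<dots> \<le> measure lborel (A + ball 0 e)"
    using brunn_minkowski[OF A False, of "ball 0 e"] e unfolding b \<alpha>_def n[symmetric] by simp
  finally show ?thesis by (simp add: \<omega>_def)
\<comment> \<open>For empty \<open>A\<close> both sides are 0, because \<open>0 powr a = 0\<close>
  for every \<open>a\<close>, even for the exponent 0 that occurs in dimension 1.\<close>
qed (simp add: set_plus_def)

section \<open>The isoperimetric inequality in functional form\<close>

lemma nn_integral_layer_cake: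
  fixes v :: "'a::euclidean_space \<Rightarrow> real" and l :: "real \<Rightarrow> real"
  assumes v[measurable]: "v \<in> borel_measurable borel" and l[measurable]: "l \<in> borel_measurable borel"
  shows "(\<integral>\<^sup>+y. (\<integral>\<^sup>+t. ennreal (l t) * indicator {0<..<v y} t \<partial>lborel) \<partial>lborel)
    = (\<integral>\<^sup>+t. ennreal (l t) * indicator {0<..} t * emeasure lborel {y. t < v y} \<partial>lborel)"
proof -
  have "(\<integral>\<^sup>+y. (\<integral>\<^sup>+t. ennreal (l t) * indicator {0<..<v y} t \<partial>lborel) \<partial>lborel)
    = (\<integral>\<^sup>+y. (\<integral>\<^sup>+t. ennreal (l t) * indicator {0<..} t * indicator {x. snd x < v (fst x)} (y, t) \<partial>lborel) \<partial>lborel)"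
    by (intro nn_integral_cong) (auto split: split_indicator)
  also have "\<dots> = (\<integral>\<^sup>+t. (\<integral>\<^sup>+y. ennreal (l t) * indicator {0<..} t * indicator {x. snd x < v (fst x)} (y, t) \<partial>lborel) \<partial>lborel)"
    by (rule lborel_pair.Fubini') measurable
  also have "\<dots> = (\<integral>\<^sup>+t. ennreal (l t) * indicator {0<..} t * emeasure lborel {y. t < v y} \<partial>lborel)"
  proof (rule nn_integral_cong)
    fix t :: real
    have "(\<integral>\<^sup>+y. ennreal (l t) * indicator {0<..} t * indicator {x. snd x < v (fst x)} (y, t) \<partial>lborel)
      = ennreal (l t) * indicator {0<..} t * (\<integral>\<^sup>+y. indicator {x. snd x < v (fst x)} (y, t) \<partial>lborel)"
      by (rule nn_integral_cmult) measurable
    also have "(\<integral>\<^sup>+y. indicator {x. snd x < v (fst x)} (y, t) \<partial>lborel) = (\<integral>\<^sup>+y. indicator {y. t < v y} y \<partial>lborel)"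
      by (intro nn_integral_cong) (auto split: split_indicator)
    also have "\<dots> = emeasure lborel {y. t < v y}"
      by (rule nn_integral_indicator) measurable
    finally show "(\<integral>\<^sup>+y. ennreal (l t) * indicator {0<..} t * indicator {x. snd x < v (fst x)} (y, t) \<partial>lborel)
      = ennreal (l t) * indicator {0<..} t * emeasure lborel {y. t < v y}" .
  qed
  finally show ?thesis .
qed

text \<open>The supremum of \<open>u\<close> over balls of radius \<open>e\<close> has the parallel sets of the superlevel sets of
  \<open>u\<close> as superlevel sets, so Brunn--Minkowski bounds its integral from below; letting \<open>e\<close> tend to
  \<open>0\<close> produces the gradient.\<close>

theorem isoperimetric_functional:
  fixes u G :: "'a::euclidean_space \<Rightarrow> real" and l :: "real \<Rightarrow> real"
  assumes u0: "\<And>y. 0 \<le> u y" and supp: "\<And>y. R \<le> norm y \<Longrightarrow> u y = 0"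
    and Lip: "\<And>y z. \<bar>u y - u z\<bar> \<le> L * norm (y - z)"
    and slope: "\<And>y \<eta>. 0 < \<eta> \<Longrightarrow> \<exists>\<delta>>0. \<forall>z. norm (z - y) < \<delta> \<longrightarrow> u z \<le> u y + (G y + \<eta>) * norm (z - y)"
    and G0: "\<And>y. 0 \<le> G y"
    and l[measurable]: "l \<in> borel_measurable borel" and l0: "\<And>t. 0 \<le> l t" and lB: "\<And>t. l t \<le> B"
    and lr: "\<And>t. 0 \<le> t \<Longrightarrow> (l \<longlongrightarrow> l t) (at_right t)"
  shows "(\<integral>\<^sup>+t. ennreal (l t * (DIM('a) * unit_ball_vol DIM('a) powr (1 / DIM('a)) *
      measure lborel {y. t < u y} powr (1 - 1 / DIM('a)))) * indicator {0<..} t \<partial>lborel)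
    \<le> (\<integral>\<^sup>+y. ennreal (l (u y) * G y) \<partial>lborel)"
proof -
  \<comment> \<open>Surface area of the ball that has the volume of the superlevel set at height
    \<open>t\<close>.\<close>
  define c where "c = (\<lambda>t. DIM('a) * unit_ball_vol DIM('a) powr (1 / DIM('a)) *
      measure lborel {y. t < u y} powr (1 - 1 / DIM('a)))"
  have c0: "0 \<le> c t" for t by (simp add: c_def)
  define I where "I = (\<integral>\<^sup>+t. ennreal (l t * c t) * indicator {0<..} t \<partial>lborel)"
  have L0: "0 \<le> L"
    using Lip[of "SOME i. i \<in> Basis" 0] nonempty_Basis
    by (metis abs_ge_zero diff_zero mult_1_right norm_Basis order_trans some_in_eq)
  have cont: "continuous_on UNIV u"
  proof (rule continuous_onI)
    fix y :: 'a and e :: real assume "0 < e"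
    show "\<exists>d>0. \<forall>z\<in>UNIV. dist z y < d \<longrightarrow> dist (u z) (u y) \<le> e"
    proof (intro exI[of _ "e / (L + 1)"] conjI ballI impI)
      fix z assume "dist z y < e / (L + 1)"
      then have "(L + 1) * norm (z - y) < e" using L0 by (simp add: dist_norm field_simps)
      then show "dist (u z) (u y) \<le> e"
        using Lip[of z y] by (simp add: dist_real_def algebra_simps) (smt (verit) norm_ge_zero)
    qed (use \<open>0 < e\<close> L0 in auto)
  qed
  have um[measurable]: "u \<in> borel_measurable borel" using cont by (rule borel_measurable_continuous_onI)
  have lev: "open {y. t < u y}" "0 < t \<Longrightarrow> bounded {y. t < u y}" for t
  proof -
    show "open {y. t < u y}" using cont open_Collect_less[of "\<lambda>_. t" u] by (simp add: continuous_intros)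
    assume "0 < t"
    then have "{y. t < u y} \<subseteq> ball 0 R" using supp by (force simp: not_le[symmetric])
    then show "bounded {y. t < u y}" using bounded_ball bounded_subset by blast
  qed
  define e where "e = (\<lambda>k::nat. 1 / Suc k)"
  have e0: "0 < e k" "e k \<le> 1" for k by (auto simp: e_def)
  define v where "v = (\<lambda>k y. SUP z\<in>ball y (e k). u z)"
  have uB: "u z \<le> u y + L * e k" if "z \<in> ball y (e k)" for y z k
  proof -
    have "L * norm (z - y) \<le> L * e k" using that L0 by (intro mult_left_mono) (auto simp: dist_norm norm_minus_commute)
    then show ?thesis using Lip[of z y] by (simp add: abs_le_iff)
  qed
  have bdd: "bdd_above (u ` ball y (e k))" for y k using uB by (intro bdd_aboveI2)
  have vle: "v k y \<le> a" if "\<And>z. z \<in> ball y (e k) \<Longrightarrow> u z \<le> a" for k y a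
    unfolding v_def using that e0(1)[of k] by (intro cSUP_least) (auto simp: not_le)
  have uv: "u y \<le> v k y" for y k unfolding v_def using e0 bdd by (intro cSUP_upper2[where x=y]) auto
  have vu: "v k y \<le> u y + L * e k" for y k using uB by (rule vle)
  have vlev: "{y. t < v k y} = {y. t < u y} + ball 0 (e k)" for t k
  proof -
    have "t < v k y \<longleftrightarrow> (\<exists>z\<in>ball y (e k). t < u z)" for y
      unfolding v_def using e0(1)[of k] bdd by (subst less_cSUP_iff) (auto simp: not_le)
    moreover have "(\<exists>z\<in>ball y (e k). t < u z) \<longleftrightarrow> y \<in> {y. t < u y} + ball 0 (e k)" for y
    proof
      assume "\<exists>z\<in>ball y (e k). t < u z"
      then obtain z where "dist y z < e k" "t < u z" by auto
      then show "y \<in> {y. t < u y} + ball 0 (e k)"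
        unfolding set_plus_iff by (auto simp: dist_norm norm_minus_commute intro!: exI[of _ z] bexI[of _ "y - z"])
    next
      assume "y \<in> {y. t < u y} + ball 0 (e k)"
      then show "\<exists>z\<in>ball y (e k). t < u z" by (auto simp: set_plus_iff dist_norm)
    qed
    ultimately show ?thesis by auto
  qed
  have vm[measurable]: "v k \<in> borel_measurable borel" for k
    by (rule borel_measurableI_greater) (auto simp: vlev intro!: borel_open open_set_plus lev(1))
  \<comment> \<open>The gain of the layer-cake integral of \<open>l\<close> between
    \<open>u y\<close> and \<open>v k y\<close>. Divided by \<open>e k\<close> it is a difference
    quotient whose upper limit is at most \<open>l (u y) * G y\<close>.\<close>
  define D where "D = (\<lambda>k y. \<integral>\<^sup>+t. ennreal (l t) * indicator {t. 0 < t \<and> u y \<le> t \<and> t < v k y} t \<partial>lborel)"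
  have split: "(\<integral>\<^sup>+t. ennreal (l t) * indicator {0<..<v k y} t \<partial>lborel) =
      (\<integral>\<^sup>+t. ennreal (l t) * indicator {0<..<u y} t \<partial>lborel) + D k y" for k y
    unfolding D_def using uv[of y k]
    by (subst nn_integral_add[symmetric]) (auto intro!: nn_integral_cong split: split_indicator)
  have Dm[measurable]: "D k \<in> borel_measurable lborel" for k
    unfolding D_def by measurable
  have Dle: "D k y \<le> ennreal (b * (a - u y))" if "\<And>t. u y \<le> t \<Longrightarrow> t < v k y \<Longrightarrow> l t \<le> b" "v k y \<le> a" "0 \<le> b" for a b k y
  proof -
    have "D k y \<le> (\<integral>\<^sup>+t. ennreal b * indicator {u y..a} t \<partial>lborel)"
      unfolding D_def using that by (intro nn_integral_mono) (auto split: split_indicator intro!: ennreal_leI)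
    also have "\<dots> = ennreal b * ennreal (a - u y)"
      using uv[of y k] that by (simp add: nn_integral_cmult)
    finally show ?thesis using that uv[of y k] by (simp add: ennreal_mult)
  qed
  have im: "(\<lambda>y. \<integral>\<^sup>+t. ennreal (l t) * indicator {0<..<u y} t \<partial>lborel) \<in> borel_measurable lborel"
  proof -
    have "(\<lambda>y. \<integral>\<^sup>+t. ennreal (l t) * indicator {t. 0 < t \<and> t < u y} t \<partial>lborel) \<in> borel_measurable lborel"
      by measurable
    moreover have "{0<..<a} = {t. 0 < t \<and> t < a}" for a :: real by auto
    ultimately show ?thesis by simp
  qed
  have B0: "0 \<le> B" using l0 lB order_trans by blast
  \<comment> \<open>Finiteness allows the integral belonging to \<open>u\<close> to be cancelled in
    \<open>key\<close>.\<close>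
  have fin: "(\<integral>\<^sup>+y. (\<integral>\<^sup>+t. ennreal (l t) * indicator {0<..<u y} t \<partial>lborel) \<partial>lborel) < \<infinity>"
  proof -
    obtain M where M: "\<And>y. u y \<le> M"
    proof
      fix y
      show "u y \<le> u 0 + L * \<bar>R\<bar>"
      proof (cases "R \<le> norm y")
        case True
        then show ?thesis using supp[of y] u0[of 0] L0 by simp
      next
        case False
        then have "L * norm y \<le> L * \<bar>R\<bar>" using L0 by (intro mult_left_mono) auto
        then show ?thesis using Lip[of y 0] by simp
      qed
    qed
    have M0: "0 \<le> M" using u0 M order_trans by blast
    have "(\<integral>\<^sup>+y. (\<integral>\<^sup>+t. ennreal (l t) * indicator {0<..<u y} t \<partial>lborel) \<partial>lborel)
      \<le> (\<integral>\<^sup>+y. ennreal (B * M) * indicator (ball (0::'a) R) y \<partial>lborel)"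
    proof (rule nn_integral_mono)
      fix y :: 'a
      have "(\<integral>\<^sup>+t. ennreal (l t) * indicator {0<..<u y} t \<partial>lborel) \<le> (\<integral>\<^sup>+t. ennreal B * indicator {0..u y} t \<partial>lborel)"
        using lB by (intro nn_integral_mono) (auto split: split_indicator intro!: ennreal_leI)
      also have "\<dots> = ennreal (B * u y)" using u0 B0 by (simp add: nn_integral_cmult ennreal_mult)
      also have "\<dots> \<le> ennreal (B * M) * indicator (ball 0 R) y"
        using M[of y] B0 supp[of y] by (auto split: split_indicator intro!: ennreal_leI mult_left_mono)
      finally show "(\<integral>\<^sup>+t. ennreal (l t) * indicator {0<..<u y} t \<partial>lborel) \<le> ennreal (B * M) * indicator (ball 0 R) y" .
    qed
    also have "\<dots> = ennreal (B * M) * emeasure lborel (ball (0::'a) R)" by (rule nn_integral_cmult_indicator) simp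
    also have "\<dots> < \<infinity>" using emeasure_lborel_ball_finite[of "0::'a" R] by (simp add: ennreal_mult_less_top)
    finally show ?thesis .
  qed
  have key: "I \<le> (\<integral>\<^sup>+y. ennreal (1 / e k) * D k y \<partial>lborel)" for k
  proof -
    let ?U = "\<integral>\<^sup>+y. (\<integral>\<^sup>+t. ennreal (l t) * indicator {0<..<u y} t \<partial>lborel) \<partial>lborel"
    have lower: "emeasure lborel {y. t < u y} + ennreal (e k * c t) \<le> emeasure lborel {y. t < v k y}" if "0 < t" for t
    proof -
      have f1: "{y. t < u y} \<in> fmeasurable lborel" using lev that by (intro fmeasurable_open_bounded)
      have f2: "{y. t < v k y} \<in> fmeasurable lborel" using lev that unfolding vlev
        by (intro fmeasurable_open_bounded open_set_plus bounded_set_plus) auto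
      have "measure lborel {y. t < u y} + e k * c t \<le> measure lborel {y. t < v k y}"
        unfolding vlev c_def using lev that e0 by (intro measure_parallel_set_ge)
      then have "ennreal (measure lborel {y. t < u y} + e k * c t) \<le> ennreal (measure lborel {y. t < v k y})"
        by (rule ennreal_leI)
      then show ?thesis using f1 f2 c0 e0[of k] by (simp add: fmeasurable_def emeasure_eq_ennreal_measure less_top ennreal_plus)
    qed
    have lm: "(\<lambda>t. emeasure lborel {y. t < u y}) \<in> borel_measurable borel"
    proof -
      have "(\<lambda>t. \<integral>\<^sup>+y. indicator {x. fst x < u (snd x)} (t, y) \<partial>lborel) \<in> borel_measurable borel" by measurable
      moreover have "(\<integral>\<^sup>+y. indicator {x. fst x < u (snd x)} (t, y) \<partial>lborel) = emeasure lborel {y. t < u y}" for t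
      proof -
        have "(\<integral>\<^sup>+y. indicator {x. fst x < u (snd x)} (t, y) \<partial>lborel) = (\<integral>\<^sup>+y. indicator {y. t < u y} y \<partial>lborel)"
          by (intro nn_integral_cong) (auto split: split_indicator)
        then show ?thesis by simp
      qed
      ultimately show ?thesis by simp
    qed
    have cm[measurable]: "c \<in> borel_measurable borel" unfolding c_def measure_def using lm by measurable
    have "?U + ennreal (e k) * I = 
      (\<integral>\<^sup>+t. ennreal (l t) * indicator {0<..} t * emeasure lborel {y. t < u y} + ennreal (e k) * (ennreal (l t * c t) * indicator {0<..} t) \<partial>lborel)"
      unfolding nn_integral_layer_cake[OF um l] I_def using lm
      by (subst nn_integral_cmult[symmetric]) (auto intro!: nn_integral_add[symmetric])
    also have "\<dots> \<le> (\<integral>\<^sup>+t. ennreal (l t) * indicator {0<..} t * emeasure lborel {y. t < v k y} \<partial>lborel)"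
    proof (rule nn_integral_mono)
      fix t :: real
      show "ennreal (l t) * indicator {0<..} t * emeasure lborel {y. t < u y} + ennreal (e k) * (ennreal (l t * c t) * indicator {0<..} t)
        \<le> ennreal (l t) * indicator {0<..} t * emeasure lborel {y. t < v k y}"
      proof (cases "0 < t")
        case True
        have "ennreal (l t) * emeasure lborel {y. t < u y} + ennreal (e k) * ennreal (l t * c t) = ennreal (l t) * (emeasure lborel {y. t < u y} + ennreal (e k * c t))"
          using l0 c0 e0[of k] by (simp add: ennreal_mult distrib_left mult_ac)
        also have "\<dots> \<le> ennreal (l t) * emeasure lborel {y. t < v k y}" by (intro mult_left_mono lower True) auto
        finally show ?thesis using True by simp
      qed simp
    qed
    also have "\<dots> = ?U + (\<integral>\<^sup>+y. D k y \<partial>lborel)"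
      unfolding nn_integral_layer_cake[OF vm l, symmetric] split
      by (rule nn_integral_add[OF im Dm])
    finally have "ennreal (e k) * I \<le> (\<integral>\<^sup>+y. D k y \<partial>lborel)"
      using fin by (auto simp: ennreal_add_left_cancel_le)
    then have "ennreal (1 / e k) * (ennreal (e k) * I) \<le> ennreal (1 / e k) * (\<integral>\<^sup>+y. D k y \<partial>lborel)"
      by (intro mult_left_mono) auto
    also have "ennreal (1 / e k) * (ennreal (e k) * I) = I"
      using e0[of k] by (simp add: mult.assoc[symmetric] ennreal_mult[symmetric])
    also have "ennreal (1 / e k) * (\<integral>\<^sup>+y. D k y \<partial>lborel) = (\<integral>\<^sup>+y. ennreal (1 / e k) * D k y \<partial>lborel)"
      by (intro nn_integral_cmult[symmetric]) measurable
    finally show ?thesis .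
  qed
  have "I \<le> limsup (\<lambda>k. \<integral>\<^sup>+y. ennreal (1 / e k) * D k y \<partial>lborel)"
    using key by (intro le_Limsup) auto
  also have "\<dots> \<le> (\<integral>\<^sup>+y. limsup (\<lambda>k. ennreal (1 / e k) * D k y) \<partial>lborel)"
  \<comment> \<open>Reverse Fatou. The Lipschitz constant bounds the difference quotients, and
    \<open>e k \<le> 1\<close> confines them to the ball of radius \<open>R + 1\<close>.\<close>
  proof (rule nn_integral_limsup[where w="\<lambda>y. ennreal (B * L) * indicator (ball (0::'a) (R + 1)) y"])
    show "AE y in lborel. ennreal (1 / e k) * D k y \<le> ennreal (B * L) * indicator (ball (0::'a) (R + 1)) y" for k
    proof (intro AE_I2)
      fix y :: 'a
      show "ennreal (1 / e k) * D k y \<le> ennreal (B * L) * indicator (ball (0::'a) (R + 1)) y"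
      proof (cases "norm y < R + 1")
        case True
        have "D k y \<le> ennreal (B * (u y + L * e k - u y))" using lB vu B0 by (intro Dle)
        then have "ennreal (1 / e k) * D k y \<le> ennreal (1 / e k) * ennreal (B * (L * e k))" by (intro mult_left_mono) auto
        also have "\<dots> = ennreal (B * L)" using e0[of k] B0 L0 by (subst ennreal_mult[symmetric]) auto
        finally show ?thesis using True by simp
      next
        case False
        have "u z = 0" if "z \<in> ball y (e k)" for z
        proof (rule supp)
          show "R \<le> norm z" using that False e0[of k] norm_triangle_ineq2[of y z] by (auto simp: dist_norm)
        qed
        then have "v k y \<le> 0" by (intro vle) auto
        then have "D k y \<le> ennreal (B * (0 - u y))" using lB B0 by (intro Dle)
        also have "\<dots> = 0" using False supp[of y] by simp
        finally show ?thesis by simp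
      qed
    qed
    show "(\<integral>\<^sup>+y. ennreal (B * L) * indicator (ball (0::'a) (R + 1)) y \<partial>lborel) < \<infinity>"
      using emeasure_lborel_ball_finite[of "0::'a" "R + 1"] by (subst nn_integral_cmult_indicator) (auto simp: ennreal_mult_less_top)
    show "(\<lambda>y. ennreal (1 / e k) * D k y) \<in> borel_measurable lborel" for k by measurable
    show "(\<lambda>y. ennreal (B * L) * indicator (ball (0::'a) (R + 1)) y) \<in> borel_measurable lborel"
      by (intro borel_measurable_times_ennreal borel_measurable_indicator) auto
  qed
  also have "\<dots> \<le> (\<integral>\<^sup>+y. ennreal (l (u y) * G y) \<partial>lborel)"
  proof (rule nn_integral_mono)
    fix y :: 'a
    \<comment> \<open>For small \<open>e k\<close> only the values of \<open>l\<close> at or just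
      above the level \<open>u y\<close> occur, which is why right continuity of \<open>l\<close> is
      the appropriate hypothesis. The loss \<open>\<eta>\<close> is sent to 0 afterwards.\<close>
    have lim: "limsup (\<lambda>k. ennreal (1 / e k) * D k y) \<le> ennreal ((l (u y) + \<eta>) * (G y + \<eta>))" if \<eta>: "0 < \<eta>" for \<eta>
    proof (rule Limsup_bounded)
      obtain \<delta> where \<delta>: "0 < \<delta>" "\<And>z. norm (z - y) < \<delta> \<Longrightarrow> u z \<le> u y + (G y + \<eta>) * norm (z - y)" using slope[OF \<eta>] by blast
      have "\<forall>\<^sub>F t in at_right (u y). l t < l (u y) + \<eta>" using lr[OF u0] \<eta> by (intro order_tendstoD) auto
      then obtain r where r: "u y < r" "\<And>t. u y < t \<Longrightarrow> t < r \<Longrightarrow> l t < l (u y) + \<eta>" by (auto simp: eventually_at_right_field)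
      have elim: "e \<longlonglongrightarrow> 0" unfolding e_def using LIMSEQ_inverse_real_of_nat by (simp add: inverse_eq_divide)
      have "(\<lambda>k. u y + (G y + \<eta>) * e k) \<longlonglongrightarrow> u y + (G y + \<eta>) * 0" by (intro tendsto_intros elim)
      then have "\<forall>\<^sub>F k in sequentially. u y + (G y + \<eta>) * e k < r" using r by (intro order_tendstoD) auto
      moreover have "\<forall>\<^sub>F k in sequentially. e k < \<delta>" using elim \<delta> by (intro order_tendstoD) auto
      ultimately show "\<forall>\<^sub>F k in sequentially. ennreal (1 / e k) * D k y \<le> ennreal ((l (u y) + \<eta>) * (G y + \<eta>))"
      proof eventually_elim
        case (elim k)
        have ge: "0 \<le> G y + \<eta>" using G0[of y] \<eta> by simp
        have v: "v k y \<le> u y + (G y + \<eta>) * e k"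
        proof (rule vle)
          fix z assume z: "z \<in> ball y (e k)"
          then have n: "norm (z - y) < e k" by (simp add: dist_norm norm_minus_commute)
          then have "u z \<le> u y + (G y + \<eta>) * norm (z - y)" using elim by (intro \<delta>) auto
          also have "\<dots> \<le> u y + (G y + \<eta>) * e k" using n ge by (intro add_left_mono mult_left_mono) auto
          finally show "u z \<le> u y + (G y + \<eta>) * e k" .
        qed
        have "D k y \<le> ennreal ((l (u y) + \<eta>) * (u y + (G y + \<eta>) * e k - u y))"
        proof (rule Dle[OF _ v])
          fix t assume t: "u y \<le> t" "t < v k y"
          show "l t \<le> l (u y) + \<eta>"
          proof (cases "t = u y")
            case False
            then show ?thesis using t v elim r(2)[of t] by auto
          qed (use \<eta> in auto)
        qed (use l0[of "u y"] \<eta> in auto)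
        then have "ennreal (1 / e k) * D k y \<le> ennreal (1 / e k) * ennreal ((l (u y) + \<eta>) * ((G y + \<eta>) * e k))" by (intro mult_left_mono) auto
        also have "\<dots> = ennreal ((l (u y) + \<eta>) * (G y + \<eta>))"
          using e0[of k] l0[of "u y"] ge \<eta> by (subst ennreal_mult[symmetric]) auto
        finally show ?case .
      qed
    qed
    have "(\<lambda>k. ennreal ((l (u y) + 1 / Suc k) * (G y + 1 / Suc k))) \<longlonglongrightarrow> ennreal ((l (u y) + 0) * (G y + 0))"
      using LIMSEQ_inverse_real_of_nat by (intro tendsto_intros) (simp_all add: inverse_eq_divide)
    then have "limsup (\<lambda>k. ennreal (1 / e k) * D k y) \<le> ennreal ((l (u y) + 0) * (G y + 0))"
      using lim by (intro LIMSEQ_le_const[where a="limsup (\<lambda>k. ennreal (1 / e k) * D k y)"]) auto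
    then show "limsup (\<lambda>k. ennreal (1 / e k) * D k y) \<le> ennreal (l (u y) * G y)" by simp
  qed
  finally show ?thesis unfolding I_def c_def .
qed

section \<open>Radial changes of variables\<close>

lemma nn_integral_indicator_UN_incseq:
  fixes h :: "'a \<Rightarrow> ennreal"
  assumes X: "incseq X" "\<And>k. X k \<in> sets M" and h[measurable]: "h \<in> borel_measurable M"
  shows "(\<integral>\<^sup>+x. h x * indicator (\<Union>k. X k) x \<partial>M) = (SUP k. \<integral>\<^sup>+x. h x * indicator (X k) x \<partial>M)"
proof -
  have [measurable]: "X k \<in> sets M" for k by (rule X(2))
  have "(\<integral>\<^sup>+x. (SUP k. h x * indicator (X k) x) \<partial>M) = (SUP k. \<integral>\<^sup>+x. h x * indicator (X k) x \<partial>M)"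
  proof (rule nn_integral_monotone_convergence_SUP)
    show "incseq (\<lambda>k x. h x * indicator (X k) x)"
      using X(1) by (auto simp: incseq_def le_fun_def split: split_indicator intro!: mult_left_mono)
  qed measurable
  moreover have "(SUP k. h x * indicator (X k) x) = h x * indicator (\<Union>k. X k) x" for x
  proof (cases "x \<in> (\<Union>k. X k)")
    case True
    then obtain k where k: "x \<in> X k" by auto
    show ?thesis
    proof (rule antisym)
      show "(SUP k. h x * indicator (X k) x) \<le> h x * indicator (\<Union>k. X k) x"
        using True by (intro SUP_least) (auto split: split_indicator)
      show "h x * indicator (\<Union>k. X k) x \<le> (SUP k. h x * indicator (X k) x)"
        using True k by (intro SUP_upper2[of k]) auto
    qed
  qed auto
  ultimately show ?thesis by simp
qed

text \<open>Exhausting \<open>A\<close> by compact intervals, on each of which the usual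
  substitution applies, admits unbounded intervals and derivatives that blow up at an end.\<close>

lemma nn_integral_substitution_exhaust:
  fixes f :: "real \<Rightarrow> ennreal" and g g' :: "real \<Rightarrow> real" and a b :: "nat \<Rightarrow> real"
  assumes f[measurable]: "f \<in> borel_measurable borel"
    and der: "\<And>x. x \<in> A \<Longrightarrow> (g has_real_derivative g' x) (at x)"
    and cont: "continuous_on A g'" and nonneg: "\<And>x. x \<in> A \<Longrightarrow> 0 \<le> g' x"
    and ab: "\<And>k. a k < b k" "decseq a" "incseq b" and A: "A = (\<Union>k. {a k..b k})"
  shows "(\<integral>\<^sup>+x. f (g x) * ennreal (g' x) * indicator A x \<partial>lborel)
    = (\<integral>\<^sup>+y. f y * indicator (\<Union>k. {g (a k)..g (b k)}) y \<partial>lborel)"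
proof -
  have am: "a l \<le> a k" "b k \<le> b l" if "k \<le> l" for k l using ab that by (auto simp: decseq_def incseq_def)
  have inA: "{a k..b k} \<subseteq> A" for k using A by auto
  have icc: "{a k..b k} \<subseteq> {a l..b l}" if "k \<le> l" for k l using am[OF that] by auto
  have mono: "g x \<le> g y" if xA: "x \<in> A" and yA: "y \<in> A" and xy: "x \<le> y" for x y
  proof (rule DERIV_nonneg_imp_nondecreasing[OF xy])
    fix z assume z: "x \<le> z" "z \<le> y"
    obtain k where "x \<in> {a k..b k}" using xA unfolding A by blast
    moreover obtain l where "y \<in> {a l..b l}" using yA unfolding A by blast
    ultimately have "x \<in> {a (max k l)..b (max k l)}" "y \<in> {a (max k l)..b (max k l)}"
      using icc[of k "max k l"] icc[of l "max k l"] by auto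
    then have "z \<in> A" using z inA[of "max k l"] by auto
    then show "\<exists>d. (g has_real_derivative d) (at z) \<and> 0 \<le> d" using der nonneg by blast
  qed
  have cg: "continuous_on A g" using der DERIV_isCont by (intro continuous_at_imp_continuous_on) blast
  have Ab[measurable]: "A \<in> sets borel" unfolding A by auto
  \<comment> \<open>\<open>g\<close> and \<open>g'\<close> are controlled on \<open>A\<close> only,
    so measurability is obtained for their truncations by 0.\<close>
  define G where "G = (\<lambda>x. indicator A x *\<^sub>R g x)"
  define G' where "G' = (\<lambda>x. indicator A x *\<^sub>R g' x)"
  have [measurable]: "G \<in> borel_measurable borel" "G' \<in> borel_measurable borel"
    unfolding G_def G'_def by (intro borel_measurable_continuous_on_indicator cg cont Ab)+
  have "(\<integral>\<^sup>+x. f (g x) * ennreal (g' x) * indicator A x \<partial>lborel) = (\<integral>\<^sup>+x. f (G x) * ennreal (G' x) * indicator A x \<partial>lborel)"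
    by (rule nn_integral_cong) (auto simp: G_def G'_def split: split_indicator)
  also have "\<dots> = (SUP k. \<integral>\<^sup>+x. f (G x) * ennreal (G' x) * indicator {a k..b k} x \<partial>lborel)"
    unfolding A by (rule nn_integral_indicator_UN_incseq) (auto simp: incseq_def intro: am order_trans)
  also have "\<dots> = (SUP k. \<integral>\<^sup>+y. f y * indicator {g (a k)..g (b k)} y \<partial>lborel)"
  proof (rule SUP_cong[OF refl])
    fix k
    have "(\<integral>\<^sup>+y. f y * indicator {g (a k)..g (b k)} y \<partial>lborel) = (\<integral>\<^sup>+x. f (g x) * g' x * indicator {a k..b k} x \<partial>lborel)"
      using inA[of k] der nonneg by (intro nn_integral_substitution_aux[OF f _ _ _ _ ab(1)] continuous_on_subset[OF cont]) auto
    also have "\<dots> = (\<integral>\<^sup>+x. f (G x) * ennreal (G' x) * indicator {a k..b k} x \<partial>lborel)"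
      using inA[of k] by (intro nn_integral_cong) (auto simp: G_def G'_def split: split_indicator)
    finally show "(\<integral>\<^sup>+x. f (G x) * ennreal (G' x) * indicator {a k..b k} x \<partial>lborel) = (\<integral>\<^sup>+y. f y * indicator {g (a k)..g (b k)} y \<partial>lborel)" ..
  qed
  also have "\<dots> = (\<integral>\<^sup>+y. f y * indicator (\<Union>k. {g (a k)..g (b k)}) y \<partial>lborel)"
  proof (rule nn_integral_indicator_UN_incseq[symmetric])
    have "a k \<in> A" "b k \<in> A" for k using inA[of k] ab(1)[of k] by auto
    then have "g (a l) \<le> g (a k)" "g (b k) \<le> g (b l)" if "k \<le> l" for k l using am[OF that] by (auto intro: mono)
    then show "incseq (\<lambda>k. {g (a k)..g (b k)})" unfolding incseq_def by (meson atLeastatMost_subset_iff)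
  qed auto
  finally show ?thesis .
qed

lemma nn_integral_powr_substitution:
  fixes f :: "real \<Rightarrow> ennreal"
  assumes f[measurable]: "f \<in> borel_measurable borel" and b: "0 < b" and c: "0 < c"
  shows "(\<integral>\<^sup>+t. f (c * t powr b) * ennreal (c * b * t powr (b - 1)) * indicator {0<..} t \<partial>lborel)
    = (\<integral>\<^sup>+s. f s * indicator {0<..} s \<partial>lborel)"
proof -
  define g where "g = (\<lambda>t::real. c * t powr b)"
  define g' where "g' = (\<lambda>t::real. c * b * t powr (b - 1))"
  define a where "a = (\<lambda>k::nat. 1 / real (Suc k))"
  \<comment> \<open>The shift by two keeps the first interval nondegenerate: it is
    \<open>{1..2}\<close>.\<close>
  define B where "B = (\<lambda>k::nat. real (Suc (Suc k)))"
  have a0: "0 < a k" "a k < B k" for k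
  proof -
    have "a k \<le> 1" "1 < B k" by (simp_all add: a_def B_def)
    then show "a k < B k" by linarith
  qed (simp add: a_def)
  have gm: "g s \<le> g t" if "0 \<le> s" "s \<le> t" for s t using that b c by (auto simp: g_def intro!: powr_mono2)
  have amono: "a l \<le> a k" "B k \<le> B l" if "k \<le> l" for k l
    using that by (auto simp: a_def B_def field_simps)
  have alim: "a \<longlonglongrightarrow> 0" unfolding a_def using LIMSEQ_inverse_real_of_nat by (simp add: inverse_eq_divide)
  have Blim: "filterlim B at_top sequentially"
    unfolding B_def by (intro filterlim_compose[OF filterlim_real_sequentially] filterlim_compose[OF filterlim_Suc filterlim_Suc])
  have cover: "\<exists>k. a k \<le> t \<and> t \<le> B k" if "0 < t" for t
  proof -
    have "\<forall>\<^sub>F k in sequentially. a k < t" using alim that by (intro order_tendstoD)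
    moreover have "\<forall>\<^sub>F k in sequentially. t \<le> B k" using Blim by (simp add: filterlim_at_top)
    ultimately have "\<forall>\<^sub>F k in sequentially. a k \<le> t \<and> t \<le> B k" by eventually_elim auto
    then show ?thesis by (auto simp: eventually_sequentially)
  qed
  have U1: "(\<Union>k. {a k..B k}) = {0<..}"
    using cover a0 by (auto, meson less_le_trans)
  have U2: "(\<Union>k. {g (a k)..g (B k)}) = {0<..}"
  proof (intro equalityI subsetI)
    fix s assume "s \<in> (\<Union>k. {g (a k)..g (B k)})"
    then obtain k where "g (a k) \<le> s" by auto
    moreover have "0 < g (a k)" using a0[of k] c by (simp add: g_def)
    ultimately show "s \<in> {0<..}" by simp
  next
    fix s :: real assume s: "s \<in> {0<..}"
    define t where "t = (s / c) powr (1 / b)"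
    have t: "0 < t" "g t = s" using s b c by (auto simp: t_def g_def powr_powr)
    obtain k where "a k \<le> t" "t \<le> B k" using cover[OF t(1)] by blast
    then have "g (a k) \<le> g t" "g t \<le> g (B k)" using a0[of k] t by (auto intro!: gm)
    then show "s \<in> (\<Union>k. {g (a k)..g (B k)})" using t by auto
  qed
  have "(\<integral>\<^sup>+x. f (g x) * ennreal (g' x) * indicator {0<..} x \<partial>lborel) = (\<integral>\<^sup>+y. f y * indicator (\<Union>k. {g (a k)..g (B k)}) y \<partial>lborel)"
  proof (rule nn_integral_substitution_exhaust[OF f _ _ _ a0(2) _ _ U1[symmetric]])
    show "(g has_real_derivative g' x) (at x)" if "x \<in> {0<..}" for x
      using that unfolding g_def g'_def by (auto intro!: derivative_eq_intros)
    show "continuous_on {0<..} g'" unfolding g'_def by (intro continuous_intros) auto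
    show "0 \<le> g' x" if "x \<in> {0<..}" for x using b c by (simp add: g'_def)
    show "decseq a" "incseq B" using amono by (auto simp: decseq_def incseq_def)
  qed
  then show ?thesis unfolding U2 by (simp add: g_def g'_def)
qed

lemma nn_integral_scale:
  fixes f :: "'a::euclidean_space \<Rightarrow> ennreal"
  assumes f[measurable]: "f \<in> borel_measurable borel" and c: "0 < c"
  shows "(\<integral>\<^sup>+x. f x \<partial>lborel) = ennreal (c ^ DIM('a)) * (\<integral>\<^sup>+x. f (c *\<^sub>R x) \<partial>lborel)"
proof -
  have "(\<integral>\<^sup>+x. f x \<partial>lborel) = (\<integral>\<^sup>+x. f x \<partial>density (distr lborel borel (\<lambda>x. 0 + c *\<^sub>R x)) (\<lambda>_. \<bar>c\<bar>^DIM('a)))"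
    using lborel_affine[of c "0::'a"] c by simp
  also have "\<dots> = (\<integral>\<^sup>+x. ennreal (c ^ DIM('a)) * f (c *\<^sub>R x) \<partial>lborel)"
    using c by (subst nn_integral_density) (auto simp: nn_integral_distr)
  finally show ?thesis by (simp add: nn_integral_cmult)
qed

text \<open>A substitute for polar coordinates: averaging over dilations concentrates the angular
  information on an annulus, on which the function \<open>t \<mapsto> 1 / t\<close> has total mass one.\<close>

lemma nn_integral_radial_average:
  fixes f :: "'a::euclidean_space \<Rightarrow> ennreal"
  assumes f[measurable]: "f \<in> borel_measurable borel"
  shows "(\<integral>\<^sup>+x. f x \<partial>lborel) = (\<integral>\<^sup>+z. indicator {z. 1 \<le> norm z \<and> norm z \<le> exp 1} z *
    (\<integral>\<^sup>+t. f (t *\<^sub>R z) * ennreal (t ^ (DIM('a) - 1)) * indicator {0<..} t \<partial>lborel) \<partial>lborel)"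
proof -
  let ?A = "{z::'a. 1 \<le> norm z \<and> norm z \<le> exp 1}"
  \<comment> \<open>With \<open>r\<close> the norm of \<open>x\<close>, the dilation
    \<open>x = t z\<close> turns the condition \<open>r / exp 1 \<le> t \<le> r\<close> into
    membership of \<open>z\<close> in an annulus that does not depend on \<open>t\<close>.\<close>
  have mass: "(\<integral>\<^sup>+t. ennreal (1 / t) * indicator {r / exp 1..r} t \<partial>lborel) = 1" if "0 < r" for r :: real
  proof -
    have "(\<integral>\<^sup>+t. ennreal (1 / t) * indicator {r / exp 1..r} t \<partial>lborel) = ennreal (ln r - ln (r / exp 1))"
    proof (rule nn_integral_FTC_Icc[where F=ln])
      have pos: "0 < t" if "r / exp 1 \<le> t" for t
        using \<open>0 < r\<close> that by (smt (verit) divide_pos_pos exp_gt_zero)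
      show "\<And>t. t \<in> {r / exp 1..r} \<Longrightarrow> (ln has_real_derivative 1 / t) (at t)"
        using pos by (auto intro!: derivative_eq_intros)
      show "\<And>t. t \<in> {r / exp 1..r} \<Longrightarrow> 0 \<le> 1 / t" using pos by (auto simp: less_imp_le)
      show "r / exp 1 \<le> r" using that by (simp add: field_simps)
    qed measurable
    then show ?thesis using that by (simp add: ln_div)
  qed
  have "(\<integral>\<^sup>+x. f x \<partial>lborel) = (\<integral>\<^sup>+x. (\<integral>\<^sup>+t. f x * (ennreal (1 / t) * indicator {0<..} t * indicator {p. 1 * snd p \<le> norm (fst p) \<and> norm (fst p) \<le> exp 1 * snd p} (x, t)) \<partial>lborel) \<partial>lborel)"
  proof (rule nn_integral_cong_AE)
    have "AE x in lborel. x \<noteq> (0::'a)" by (rule AE_lborel_singleton)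
    then show "AE x in lborel. f x = (\<integral>\<^sup>+t. f x * (ennreal (1 / t) * indicator {0<..} t * indicator {p. 1 * snd p \<le> norm (fst p) \<and> norm (fst p) \<le> exp 1 * snd p} (x, t)) \<partial>lborel)"
    proof eventually_elim
      case (elim x)
      have eq: "ennreal (1 / t) * indicator {0<..} t * indicator {p. 1 * snd p \<le> norm (fst p) \<and> norm (fst p) \<le> exp 1 * snd p} (x, t)
          = ennreal (1 / t) * indicator {norm x / exp 1..norm x} t" for t
      proof (cases "0 < t")
        case True
        then show ?thesis by (auto split: split_indicator simp: field_simps)
      next
        case False
        have "0 < norm x / exp 1" using elim by simp
        then show ?thesis using False by (auto split: split_indicator)
      qed
      have "(\<integral>\<^sup>+t. f x * (ennreal (1 / t) * indicator {norm x / exp 1..norm x} t) \<partial>lborel) = f x * 1"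
        using elim by (subst nn_integral_cmult) (auto simp: mass)
      then show ?case unfolding eq by simp
    qed
  qed
  also have "\<dots> = (\<integral>\<^sup>+t. (\<integral>\<^sup>+x. f x * (ennreal (1 / t) * indicator {0<..} t * indicator {p. 1 * snd p \<le> norm (fst p) \<and> norm (fst p) \<le> exp 1 * snd p} (x, t)) \<partial>lborel) \<partial>lborel)"
    by (rule lborel_pair.Fubini') measurable
  also have "\<dots> = (\<integral>\<^sup>+t. (\<integral>\<^sup>+z. indicator ?A z * (f (t *\<^sub>R z) * ennreal (t ^ (DIM('a) - 1)) * indicator {0<..} t) \<partial>lborel) \<partial>lborel)"
  proof (rule nn_integral_cong)
    fix t :: real
    show "(\<integral>\<^sup>+x. f x * (ennreal (1 / t) * indicator {0<..} t * indicator {p. 1 * snd p \<le> norm (fst p) \<and> norm (fst p) \<le> exp 1 * snd p} (x, t)) \<partial>lborel)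
      = (\<integral>\<^sup>+z. indicator ?A z * (f (t *\<^sub>R z) * ennreal (t ^ (DIM('a) - 1)) * indicator {0<..} t) \<partial>lborel)"
    proof (cases "0 < t")
      case t: True
      have pw: "ennreal (t ^ DIM('a)) * ennreal (1 / t) = ennreal (t ^ (DIM('a) - 1))"
        using t by (subst ennreal_mult[symmetric]) (auto simp: power_diff[OF _ DIM_ge_Suc0] )
      have "(\<integral>\<^sup>+x. f x * (ennreal (1 / t) * indicator {0<..} t * indicator {p. 1 * snd p \<le> norm (fst p) \<and> norm (fst p) \<le> exp 1 * snd p} (x, t)) \<partial>lborel)
        = ennreal (t ^ DIM('a)) * (\<integral>\<^sup>+x. f (t *\<^sub>R x) * (ennreal (1 / t) * indicator {0<..} t * indicator {p. 1 * snd p \<le> norm (fst p) \<and> norm (fst p) \<le> exp 1 * snd p} (t *\<^sub>R x, t)) \<partial>lborel)"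
        by (rule nn_integral_scale[OF _ t]) measurable
      also have "\<dots> = (\<integral>\<^sup>+x. ennreal (t ^ DIM('a)) * (f (t *\<^sub>R x) * (ennreal (1 / t) * indicator {0<..} t * indicator {p. 1 * snd p \<le> norm (fst p) \<and> norm (fst p) \<le> exp 1 * snd p} (t *\<^sub>R x, t))) \<partial>lborel)"
        by (rule nn_integral_cmult[symmetric]) measurable
      also have "\<dots> = (\<integral>\<^sup>+z. indicator ?A z * (f (t *\<^sub>R z) * ennreal (t ^ (DIM('a) - 1)) * indicator {0<..} t) \<partial>lborel)"
        unfolding pw[symmetric] using t by (intro nn_integral_cong) (auto split: split_indicator simp: mult_ac)
      finally show ?thesis .
    qed simp
  qed
  also have "\<dots> = (\<integral>\<^sup>+z. (\<integral>\<^sup>+t. indicator ?A z * (f (t *\<^sub>R z) * ennreal (t ^ (DIM('a) - 1)) * indicator {0<..} t) \<partial>lborel) \<partial>lborel)"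
    by (rule lborel_pair.Fubini'[symmetric]) measurable
  also have "\<dots> = (\<integral>\<^sup>+z. indicator ?A z * (\<integral>\<^sup>+t. f (t *\<^sub>R z) * ennreal (t ^ (DIM('a) - 1)) * indicator {0<..} t \<partial>lborel) \<partial>lborel)"
    by (intro nn_integral_cong nn_integral_cmult) measurable
  finally show ?thesis .
qed

section \<open>Radial power maps\<close>

text \<open>Acts on each ray as \<open>r \<mapsto> r powr b\<close>. Such maps change the exponents
  of power weights and send centred balls to centred balls.\<close>

definition rpow :: "real \<Rightarrow> 'a::real_normed_vector \<Rightarrow> 'a" where
  "rpow b y = norm y powr (b - 1) *\<^sub>R y"

lemma norm_rpow: "norm (rpow b y) = norm y powr b"
  by (cases "y = 0") (auto simp: rpow_def powr_diff)

lemma measurable_rpow[measurable]: "rpow b \<in> borel_measurable (borel :: 'a::euclidean_space measure)"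
  unfolding rpow_def by measurable

text \<open>The Jacobian is the radial stretching \<open>b * r powr (b - 1)\<close> times a factor
  \<open>r powr (b - 1)\<close> for each of the other \<open>d - 1\<close> directions. It is
  obtained ray by ray, from \<open>nn_integral_radial_average\<close> and a substitution in one
  variable.\<close>

lemma nn_integral_rpow:
  fixes f :: "'a::euclidean_space \<Rightarrow> ennreal" and b :: real
  assumes f[measurable]: "f \<in> borel_measurable borel" and b: "0 < b"
  shows "(\<integral>\<^sup>+x. f x \<partial>lborel) = (\<integral>\<^sup>+y. f (rpow b y) * ennreal (b * norm y powr (DIM('a) * (b - 1))) \<partial>lborel)"
proof -
  let ?d = "DIM('a)"
  have in_eq: "(\<integral>\<^sup>+t. f (rpow b (t *\<^sub>R z)) * ennreal (b * norm (t *\<^sub>R z) powr (?d * (b - 1))) * ennreal (t ^ (?d - 1)) * indicator {0<..} t \<partial>lborel)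
      = (\<integral>\<^sup>+s. f (s *\<^sub>R z) * ennreal (s ^ (?d - 1)) * indicator {0<..} s \<partial>lborel)" if "1 \<le> norm z" for z
  proof -
    define c where "c = norm z powr (b - 1)"
    have c: "0 < c" using that by (auto simp: c_def)
    have "(\<integral>\<^sup>+s. f (s *\<^sub>R z) * ennreal (s ^ (?d - 1)) * indicator {0<..} s \<partial>lborel)
       = (\<integral>\<^sup>+t. (f ((c * t powr b) *\<^sub>R z) * ennreal ((c * t powr b) ^ (?d - 1))) * ennreal (c * b * t powr (b - 1)) * indicator {0<..} t \<partial>lborel)"
      using b c by (intro nn_integral_powr_substitution[symmetric]) measurable
    also have "\<dots> = (\<integral>\<^sup>+t. f (rpow b (t *\<^sub>R z)) * ennreal (b * norm (t *\<^sub>R z) powr (?d * (b - 1))) * ennreal (t ^ (?d - 1)) * indicator {0<..} t \<partial>lborel)"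
    proof (rule nn_integral_cong)
      fix t :: real
      show "(f ((c * t powr b) *\<^sub>R z) * ennreal ((c * t powr b) ^ (?d - 1))) * ennreal (c * b * t powr (b - 1)) * indicator {0<..} t
        = f (rpow b (t *\<^sub>R z)) * ennreal (b * norm (t *\<^sub>R z) powr (?d * (b - 1))) * ennreal (t ^ (?d - 1)) * indicator {0<..} t"
      proof (cases "0 < t")
        case t: True
        have r: "rpow b (t *\<^sub>R z) = (c * t powr b) *\<^sub>R z"
          using t by (simp add: rpow_def c_def powr_mult powr_diff)
        obtain n where n: "?d = Suc n" by (metis DIM_positive gr0_conv_Suc)
        have "(c * t powr b) ^ n * (c * b * t powr (b - 1)) = b * (c ^ Suc n * (t powr (b * n) * t powr (b - 1)))"
          using t by (simp add: power_mult_distrib powr_power mult_ac)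
        also have "t powr (b * n) * t powr (b - 1) = t powr (?d * (b - 1)) * t ^ n"
          using t unfolding n by (simp add: powr_realpow[symmetric] powr_add[symmetric] algebra_simps)
        also have "c ^ Suc n = norm z powr (?d * (b - 1))"
          using that unfolding c_def n by (subst powr_power) (auto simp: mult.commute)
        finally have e: "(c * t powr b) ^ n * (c * b * t powr (b - 1)) = b * norm (t *\<^sub>R z) powr (?d * (b - 1)) * t ^ n"
          using t by (simp add: powr_mult mult_ac)
        have "ennreal ((c * t powr b) ^ (?d - 1)) * ennreal (c * b * t powr (b - 1)) = ennreal ((c * t powr b) ^ n * (c * b * t powr (b - 1)))"
          using b c unfolding n by (subst ennreal_mult[symmetric]) auto
        also have "\<dots> = ennreal (b * norm (t *\<^sub>R z) powr (?d * (b - 1))) * ennreal (t ^ (?d - 1))"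
          using b t unfolding e by (subst ennreal_mult[symmetric]) (auto simp: n)
        finally show ?thesis unfolding r by (simp add: mult.assoc)
      qed simp
    qed
    finally show ?thesis by simp
  qed
  have "(\<integral>\<^sup>+y. f (rpow b y) * ennreal (b * norm y powr (?d * (b - 1))) \<partial>lborel)
    = (\<integral>\<^sup>+z. indicator {z. 1 \<le> norm z \<and> norm z \<le> exp 1} z *
    (\<integral>\<^sup>+t. f (rpow b (t *\<^sub>R z)) * ennreal (b * norm (t *\<^sub>R z) powr (?d * (b - 1))) * ennreal (t ^ (?d - 1)) * indicator {0<..} t \<partial>lborel) \<partial>lborel)"
    by (rule nn_integral_radial_average) measurable
  also have "\<dots> = (\<integral>\<^sup>+z. indicator {z. 1 \<le> norm z \<and> norm z \<le> exp 1} z *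
    (\<integral>\<^sup>+t. f (t *\<^sub>R z) * ennreal (t ^ (?d - 1)) * indicator {0<..} t \<partial>lborel) \<partial>lborel)"
    using in_eq by (intro nn_integral_cong) (auto split: split_indicator)
  also have "\<dots> = (\<integral>\<^sup>+x. f x \<partial>lborel)" by (rule nn_integral_radial_average[symmetric]) measurable
  finally show ?thesis by simp
qed

section \<open>The weighted isoperimetric inequality\<close>

definition wmeas :: "real \<Rightarrow> 'a::euclidean_space measure" where
  "wmeas \<gamma> = density lborel (\<lambda>x. ennreal (norm x powr (- \<gamma>)))"

lemma sets_wmeas[simp, measurable_cong]: "sets (wmeas \<gamma>) = sets borel"
  by (simp add: wmeas_def)

lemma space_wmeas[simp]: "space (wmeas \<gamma>) = UNIV"
  by (simp add: wmeas_def)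

lemma nn_integral_wmeas:
  assumes [measurable]: "f \<in> borel_measurable borel"
  shows "(\<integral>\<^sup>+x. f x \<partial>wmeas \<gamma>) = (\<integral>\<^sup>+x. f x * ennreal (norm x powr (- \<gamma>)) \<partial>lborel)"
  unfolding wmeas_def by (subst nn_integral_density) (auto simp: mult.commute)

text \<open>The mass of the unit ball for \<open>wmeas \<gamma>\<close>, see
  \<open>emeasure_wmeas_ball\<close>. The type argument carries the dimension.\<close>

definition wball :: "'a::euclidean_space itself \<Rightarrow> real \<Rightarrow> real" where
  "wball _ \<gamma> = real DIM('a) * unit_ball_vol (real DIM('a)) / (real DIM('a) - \<gamma>)"

lemma wball_pos: "\<gamma> < real DIM('a) \<Longrightarrow> 0 < wball TYPE('a::euclidean_space) \<gamma>"
  by (simp add: wball_def)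

lemma emeasure_wmeas_ball:
  assumes g: "\<gamma> < real DIM('a)" and r: "0 \<le> r"
  shows "emeasure (wmeas \<gamma>) (ball (0::'a::euclidean_space) r) = ennreal (wball TYPE('a) \<gamma> * r powr (real DIM('a) - \<gamma>))"
proof -
  \<comment> \<open>For this exponent the pull-back of the weighted measure by \<open>rpow b\<close>
    is \<open>b\<close> times Lebesgue measure.\<close>
  define b where "b = real DIM('a) / (real DIM('a) - \<gamma>)"
  have b: "0 < b" using g by (simp add: b_def)
  have e0: "real DIM('a) * (b - 1) - b * \<gamma> = 0" using g by (simp add: b_def field_simps)
  have "emeasure (wmeas \<gamma>) (ball (0::'a) r) = (\<integral>\<^sup>+x. indicator {x::'a. norm x < r} x * ennreal (norm x powr (- \<gamma>)) \<partial>lborel)"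
    unfolding wmeas_def by (subst emeasure_density) (auto simp: mult.commute ball_def dist_norm)
  also have "\<dots> = (\<integral>\<^sup>+y. indicator {x::'a. norm x < r} (rpow b y) * ennreal (norm (rpow b y) powr (- \<gamma>)) * ennreal (b * norm y powr (real DIM('a) * (b - 1))) \<partial>lborel)"
    by (rule nn_integral_rpow[OF _ b]) measurable
  also have "\<dots> = (\<integral>\<^sup>+y. ennreal b * indicator (ball (0::'a) (r powr (1 / b))) y \<partial>lborel)"
  proof (rule nn_integral_cong_AE)
    have "AE y in lborel. y \<noteq> (0::'a)" by (rule AE_lborel_singleton)
    then show "AE y in lborel. indicator {x::'a. norm x < r} (rpow b y) * ennreal (norm (rpow b y) powr (- \<gamma>)) * ennreal (b * norm y powr (real DIM('a) * (b - 1)))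
      = ennreal b * indicator (ball 0 (r powr (1 / b))) y"
    proof eventually_elim
      case (elim y)
      have "norm (rpow b y) powr (- \<gamma>) * (b * norm y powr (real DIM('a) * (b - 1))) = b * norm y powr (real DIM('a) * (b - 1) - b * \<gamma>)"
        by (simp add: norm_rpow powr_powr powr_diff powr_minus_divide)
      also have "\<dots> = b" using elim unfolding e0 by simp
      finally have *: "ennreal (norm (rpow b y) powr (- \<gamma>)) * ennreal (b * norm y powr (real DIM('a) * (b - 1))) = ennreal b"
        using b by (subst ennreal_mult[symmetric]) auto
      have "norm (rpow b y) < r \<longleftrightarrow> norm y < r powr (1 / b)"
      proof
        assume "norm (rpow b y) < r"
        then have "(norm y powr b) powr (1 / b) < r powr (1 / b)" using b by (intro powr_less_mono2) (auto simp: norm_rpow)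
        then show "norm y < r powr (1 / b)" using b by (simp add: powr_powr)
      next
        assume "norm y < r powr (1 / b)"
        then have "norm y powr b < (r powr (1 / b)) powr b" using b by (intro powr_less_mono2) auto
        then show "norm (rpow b y) < r" using b r by (simp add: powr_powr norm_rpow)
      qed
      then show ?case by (simp add: mult.assoc * split: split_indicator)
    qed
  qed
  also have "\<dots> = ennreal b * emeasure lborel (ball (0::'a) (r powr (1 / b)))"
    by (rule nn_integral_cmult_indicator) simp
  also have "\<dots> = ennreal (b * (unit_ball_vol (real DIM('a)) * (r powr (1 / b)) ^ DIM('a)))"
    using b by (simp add: emeasure_ball ennreal_mult)
  also have "(r powr (1 / b)) ^ DIM('a) = r powr (real DIM('a) - \<gamma>)"
    using r g b by (cases "r = 0") (auto simp: powr_power b_def)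
  also have "b * (unit_ball_vol (real DIM('a)) * r powr (real DIM('a) - \<gamma>)) = wball TYPE('a) \<gamma> * r powr (real DIM('a) - \<gamma>)"
    by (simp add: b_def wball_def)
  finally show ?thesis .
qed

text \<open>The unshared parts of \<open>E\<close> and of the ball have the same volume, while the
  weight is at most \<open>r powr s\<close> outside the ball and at least \<open>r powr s\<close>
  inside.\<close>

lemma bathtub:
  fixes E :: "'a::euclidean_space set"
  assumes E[measurable]: "E \<in> sets borel" and s: "s \<le> 0" and r: "0 \<le> r"
    and Er: "emeasure lborel E = emeasure lborel (ball (0::'a) r)"
  shows "(\<integral>\<^sup>+y. ennreal (norm y powr s) * indicator E y \<partial>lborel)
    \<le> (\<integral>\<^sup>+y. ennreal (norm y powr s) * indicator (ball (0::'a) r) y \<partial>lborel)"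
proof (cases "r = 0")
  case True
  then have "E \<in> null_sets lborel" using Er by (simp add: null_sets_def)
  then have "AE y in lborel. y \<notin> E" by (rule AE_not_in)
  then have "(\<integral>\<^sup>+y. ennreal (norm y powr s) * indicator E y \<partial>lborel) = (\<integral>\<^sup>+y. 0 \<partial>(lborel :: 'a measure))"
    by (intro nn_integral_cong_AE) auto
  then show ?thesis by simp
next
  case False
  then have r0: "0 < r" using r by simp
  define B where "B = ball (0::'a) r"
  have B[measurable]: "B \<in> sets borel" by (simp add: B_def)
  have fin: "emeasure lborel B < \<infinity>" unfolding B_def using emeasure_lborel_ball_finite[of "0::'a" r] by simp
  have eq: "emeasure lborel (E - B) = emeasure lborel (B - E)"
  proof -
    have "emeasure lborel (E - B) + emeasure lborel (E \<inter> B) = emeasure lborel E"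
      by (subst plus_emeasure) (auto intro!: arg_cong[where f="emeasure lborel"])
    moreover have "emeasure lborel (B - E) + emeasure lborel (E \<inter> B) = emeasure lborel B"
      by (subst plus_emeasure) (auto intro!: arg_cong[where f="emeasure lborel"])
    moreover have "emeasure lborel (E \<inter> B) < \<infinity>"
      using emeasure_mono[of "E \<inter> B" B lborel] fin by (auto simp: less_top le_less_trans)
    ultimately show ?thesis using Er unfolding B_def[symmetric]
      by (metis add.commute ennreal_add_left_cancel less_irrefl infinity_ennreal_def)
  qed
  have "(\<integral>\<^sup>+y. ennreal (norm y powr s) * indicator E y \<partial>lborel)
    = (\<integral>\<^sup>+y. ennreal (norm y powr s) * indicator (E \<inter> B) y + ennreal (norm y powr s) * indicator (E - B) y \<partial>lborel)"
    by (rule nn_integral_cong) (auto split: split_indicator)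
  also have "\<dots> = (\<integral>\<^sup>+y. ennreal (norm y powr s) * indicator (E \<inter> B) y \<partial>lborel) + (\<integral>\<^sup>+y. ennreal (norm y powr s) * indicator (E - B) y \<partial>lborel)"
    by (rule nn_integral_add) measurable
  also have "(\<integral>\<^sup>+y. ennreal (norm y powr s) * indicator (E - B) y \<partial>lborel) \<le> (\<integral>\<^sup>+y. ennreal (r powr s) * indicator (E - B) y \<partial>lborel)"
    using s r0 by (intro nn_integral_mono) (auto split: split_indicator simp: B_def intro!: ennreal_leI powr_mono2')
  also have "\<dots> = ennreal (r powr s) * emeasure lborel (E - B)" by (rule nn_integral_cmult_indicator) measurable
  also have "\<dots> = ennreal (r powr s) * emeasure lborel (B - E)" by (simp add: eq)
  also have "\<dots> = (\<integral>\<^sup>+y. ennreal (r powr s) * indicator (B - E) y \<partial>lborel)" by (rule nn_integral_cmult_indicator[symmetric]) measurable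
  also have "\<dots> \<le> (\<integral>\<^sup>+y. ennreal (norm y powr s) * indicator (B - E) y \<partial>lborel)"
  proof (rule nn_integral_mono_AE)
    \<comment> \<open>The origin is excluded because \<open>0 powr s = 0\<close> breaks the lower
      bound on the weight there.\<close>
    have "AE y in lborel. y \<noteq> (0::'a)" by (rule AE_lborel_singleton)
    then show "AE y in lborel. ennreal (r powr s) * indicator (B - E) y \<le> ennreal (norm y powr s) * indicator (B - E) y"
      by eventually_elim (use s in \<open>auto split: split_indicator simp: B_def intro!: ennreal_leI powr_mono2'\<close>)
  qed
  also have "(\<integral>\<^sup>+y. ennreal (norm y powr s) * indicator (E \<inter> B) y \<partial>lborel) + (\<integral>\<^sup>+y. ennreal (norm y powr s) * indicator (B - E) y \<partial>lborel)
    = (\<integral>\<^sup>+y. ennreal (norm y powr s) * indicator (E \<inter> B) y + ennreal (norm y powr s) * indicator (B - E) y \<partial>lborel)"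
    by (rule nn_integral_add[symmetric]) measurable
  also have "\<dots> = (\<integral>\<^sup>+y. ennreal (norm y powr s) * indicator B y \<partial>lborel)"
    by (rule nn_integral_cong) (auto split: split_indicator)
  finally show ?thesis by (simp add: add_left_mono B_def)
qed

text \<open>Pulled back by \<open>rpow b\<close>, the weighted measure has a density proportional to
  \<open>norm y powr (b * (d - \<gamma>) - d)\<close>. The hypothesis on \<open>b\<close> makes it
  nonincreasing in the radius, so by the bathtub principle a centred ball carries the largest mass
  for a given pulled-back volume.\<close>

lemma wmeas_le_ball_power:
  fixes E :: "'a::euclidean_space set"
  assumes E[measurable]: "E \<in> sets borel" and fin: "emeasure lborel (rpow b -` E) < \<infinity>"
    and g: "\<gamma> < real DIM('a)" and b: "0 < b" and s: "b * (real DIM('a) - \<gamma>) \<le> real DIM('a)"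
  shows "emeasure (wmeas \<gamma>) E \<le> ennreal (wball TYPE('a) \<gamma> *
    (measure lborel (rpow b -` E) / unit_ball_vol (real DIM('a))) powr (b * (real DIM('a) - \<gamma>) / real DIM('a)))"
proof -
  have wf: "emeasure (wmeas \<gamma>) F = (\<integral>\<^sup>+y. ennreal b * (ennreal (norm y powr (b * (real DIM('a) - \<gamma>) - real DIM('a))) * indicator (rpow b -` F) y) \<partial>lborel)"
    if F[measurable]: "F \<in> sets borel" for F :: "'a set"
  proof -
    have "emeasure (wmeas \<gamma>) F = (\<integral>\<^sup>+x. indicator F x * ennreal (norm x powr (- \<gamma>)) \<partial>lborel)"
      unfolding wmeas_def by (subst emeasure_density) (auto simp: mult.commute)
    also have "\<dots> = (\<integral>\<^sup>+y. indicator F (rpow b y) * ennreal (norm (rpow b y) powr (- \<gamma>)) * ennreal (b * norm y powr (real DIM('a) * (b - 1))) \<partial>lborel)"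
      by (rule nn_integral_rpow[OF _ b]) measurable
    also have "\<dots> = (\<integral>\<^sup>+y. ennreal b * (ennreal (norm y powr (b * (real DIM('a) - \<gamma>) - real DIM('a))) * indicator (rpow b -` F) y) \<partial>lborel)"
    proof (rule nn_integral_cong)
      fix y :: 'a
      have "norm (rpow b y) powr (- \<gamma>) * (b * norm y powr (real DIM('a) * (b - 1))) = b * norm y powr (real DIM('a) * (b - 1) - b * \<gamma>)"
        by (simp add: norm_rpow powr_powr powr_diff powr_minus_divide)
      also have "real DIM('a) * (b - 1) - b * \<gamma> = b * (real DIM('a) - \<gamma>) - real DIM('a)" by (simp add: algebra_simps)
      finally have "ennreal (norm (rpow b y) powr (- \<gamma>)) * ennreal (b * norm y powr (real DIM('a) * (b - 1))) = ennreal b * ennreal (norm y powr (b * (real DIM('a) - \<gamma>) - real DIM('a)))"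
        using b by (subst (1 2) ennreal_mult[symmetric]) auto
      then show "indicator F (rpow b y) * ennreal (norm (rpow b y) powr (- \<gamma>)) * ennreal (b * norm y powr (real DIM('a) * (b - 1)))
        = ennreal b * (ennreal (norm y powr (b * (real DIM('a) - \<gamma>) - real DIM('a))) * indicator (rpow b -` F) y)"
        by (simp add: mult.assoc split: split_indicator)
    qed
    finally show ?thesis .
  qed
  have vm: "rpow b -` F \<in> sets borel" if "F \<in> sets borel" for F :: "'a set"
    using measurable_sets_borel[OF measurable_rpow that] by simp
  have om: "0 < unit_ball_vol (real DIM('a))" by simp
  define r where "r = (measure lborel (rpow b -` E) / unit_ball_vol (real DIM('a))) powr (1 / real DIM('a))"
  have r: "0 \<le> r" by (simp add: r_def)
  have rd: "r ^ DIM('a) = measure lborel (rpow b -` E) / unit_ball_vol (real DIM('a))"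
    unfolding r_def using om by (cases "measure lborel (rpow b -` E) = 0") (auto simp: zero_less_measure_iff intro!: powr_inverse_power divide_pos_pos)
  have E': "emeasure lborel (rpow b -` E) = emeasure lborel (ball (0::'a) r)"
  proof -
    have "emeasure lborel (rpow b -` E) = ennreal (measure lborel (rpow b -` E))"
      using fin by (intro emeasure_eq_ennreal_measure) (auto simp: less_top)
    also have "measure lborel (rpow b -` E) = unit_ball_vol (real DIM('a)) * r ^ DIM('a)"
      unfolding rd using less_imp_neq[OF om] by (metis nonzero_mult_div_cancel_left times_divide_eq_right)
    finally show ?thesis using emeasure_ball[OF r, of "0::'a"] by simp
  qed
  have pre: "rpow b -` ball (0::'a) (r powr b) = ball 0 r"
  proof (rule set_eqI)
    fix x :: 'a
    have "norm x powr b < r powr b \<longleftrightarrow> norm x < r"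
      using powr_less_mono2[of b "norm x" r] powr_mono2[of b r "norm x"] b r by (smt (verit) norm_ge_zero)
    then show "x \<in> rpow b -` ball 0 (r powr b) \<longleftrightarrow> x \<in> ball 0 r" by (simp add: norm_rpow)
  qed
  have "emeasure (wmeas \<gamma>) E = ennreal b * (\<integral>\<^sup>+y. ennreal (norm y powr (b * (real DIM('a) - \<gamma>) - real DIM('a))) * indicator (rpow b -` E) y \<partial>lborel)"
    unfolding wf[OF E] using vm[OF E] by (intro nn_integral_cmult) measurable
  also have "\<dots> \<le> ennreal b * (\<integral>\<^sup>+y. ennreal (norm y powr (b * (real DIM('a) - \<gamma>) - real DIM('a))) * indicator (ball (0::'a) r) y \<partial>lborel)"
    using s vm[OF E] r E' by (intro mult_left_mono bathtub) auto
  also have "\<dots> = (\<integral>\<^sup>+y. ennreal b * (ennreal (norm y powr (b * (real DIM('a) - \<gamma>) - real DIM('a))) * indicator (ball (0::'a) r) y) \<partial>lborel)"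
    by (intro nn_integral_cmult[symmetric] borel_measurable_times_ennreal borel_measurable_indicator) auto
  also have "\<dots> = emeasure (wmeas \<gamma>) (ball (0::'a) (r powr b))"
    by (subst wf) (auto simp: pre)
  also have "\<dots> = ennreal (wball TYPE('a) \<gamma> * (r powr b) powr (real DIM('a) - \<gamma>))"
    by (rule emeasure_wmeas_ball[OF g]) simp
  also have "(r powr b) powr (real DIM('a) - \<gamma>) = (measure lborel (rpow b -` E) / unit_ball_vol (real DIM('a))) powr (b * (real DIM('a) - \<gamma>) / real DIM('a))"
    by (simp add: r_def powr_powr)
  finally show ?thesis .
qed

text \<open>The map stretches by \<open>b * norm y powr (b - 1)\<close> radially and by
  \<open>norm y powr (b - 1)\<close> tangentially. The bound is attained in the radial direction, so
  radial functions lose nothing. At the origin the derivative is 0, as \<open>1 < b\<close>.\<close>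

lemma has_derivative_rpow:
  fixes y :: "'a::euclidean_space"
  assumes b: "1 < b"
  shows "\<exists>D. (rpow b has_derivative D) (at y) \<and> (\<forall>h. norm (D h) \<le> b * norm y powr (b - 1) * norm h)"
proof (cases "y = 0")
  case True
  have "(rpow b has_derivative (\<lambda>h. 0)) (at (0::'a))"
    unfolding has_derivative_iff_norm
  proof
    have "((\<lambda>z::'a. norm z powr (b - 1)) \<longlongrightarrow> norm (0::'a) powr (b - 1)) (at 0)"
      using b by (intro tendsto_intros) auto
    moreover have "norm z powr (b - 1) = norm (rpow b z - rpow b 0 - 0) / norm (z - 0)" for z :: 'a
      by (cases "z = 0") (auto simp: rpow_def)
    ultimately show "((\<lambda>z::'a. norm (rpow b z - rpow b 0 - 0) / norm (z - 0)) \<longlongrightarrow> 0) (at 0)" by simp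
  qed simp
  then show ?thesis using True b by (intro exI[of _ "\<lambda>h. 0"]) auto
next
  case False
  let ?D = "\<lambda>h. norm y powr (b - 1) *\<^sub>R h + ((b - 1) * norm y powr (b - 2) * (h \<bullet> sgn y)) *\<^sub>R y"
  have "(rpow b has_derivative ?D) (at y)"
  proof -
    have n: "(norm has_derivative (\<lambda>h. h \<bullet> sgn y)) (at y)"
      by (rule has_derivative_norm[OF False])
    have "((\<lambda>t. t powr (b - 1)) has_real_derivative (b - 1) * norm y powr (b - 1 - 1)) (at (norm y))"
      using False by (intro has_real_derivative_powr) auto
    then have "((\<lambda>t. t powr (b - 1)) has_derivative (\<lambda>k. (b - 1) * norm y powr (b - 2) * k)) (at (norm y))"
      by (simp add: has_field_derivative_def)
    from has_derivative_scaleR[OF has_derivative_compose[OF n this] has_derivative_ident]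
    show ?thesis unfolding rpow_def .
  qed
  moreover have "norm (?D h) \<le> b * norm y powr (b - 1) * norm h" for h
  proof -
    have "norm (?D h) \<le> norm (norm y powr (b - 1) *\<^sub>R h) + norm (((b - 1) * norm y powr (b - 2) * (h \<bullet> sgn y)) *\<^sub>R y)"
      by (rule norm_triangle_ineq)
    also have "\<dots> = norm y powr (b - 1) * norm h + (b - 1) * (norm y powr (b - 2) * norm y) * \<bar>h \<bullet> sgn y\<bar>"
      using b by (simp add: abs_mult)
    also have "norm y powr (b - 2) * norm y = norm y powr (b - 1)"
      using False powr_add[of "norm y" "b - 2" 1] by simp
    also have "norm y powr (b - 1) * norm h + (b - 1) * norm y powr (b - 1) * \<bar>h \<bullet> sgn y\<bar>
        \<le> norm y powr (b - 1) * norm h + (b - 1) * norm y powr (b - 1) * norm h"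
      using Cauchy_Schwarz_ineq2[of h "sgn y"] False b by (intro add_left_mono mult_left_mono) (auto simp: norm_sgn)
    also have "\<dots> = b * norm y powr (b - 1) * norm h" by (simp add: algebra_simps)
    finally show ?thesis .
  qed
  ultimately show ?thesis by blast
qed

text \<open>A centred ball of radius \<open>\<rho>\<close> has mass
  \<open>\<kappa> * \<rho> powr (d - \<gamma>)\<close>, with \<open>\<kappa>\<close> for
  \<open>wball\<close>, and perimeter \<open>(d - \<gamma>) * \<kappa> * \<rho> powr (d - 1 -
  \<gamma> / 2)\<close> for the density \<open>norm x powr (- \<gamma> / 2)\<close>. The factor of
  \<open>l t\<close> on the left is thus the perimeter of the ball that has the mass of the
  superlevel set. Pulling \<open>w\<close> back by \<open>rpow b\<close> reduces the claim to
  \<open>isoperimetric_functional\<close>.\<close>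

theorem weighted_isoperimetric_functional:
  fixes w :: "'a::euclidean_space \<Rightarrow> real" and g :: "'a \<Rightarrow> 'a" and l :: "real \<Rightarrow> real"
  assumes d: "2 \<le> DIM('a)" and \<gamma>: "0 < \<gamma>" "\<gamma> < 2"
    and der: "\<And>x. (w has_derivative (\<lambda>h. g x \<bullet> h)) (at x)" and cg: "continuous_on UNIV g"
    and supp: "\<And>x. R \<le> norm x \<Longrightarrow> w x = 0" "\<And>x. R \<le> norm x \<Longrightarrow> g x = 0"
    and l[measurable]: "l \<in> borel_measurable borel" and l0: "\<And>t. 0 \<le> l t" and lB: "\<And>t. l t \<le> B"
    and lr: "\<And>t. 0 \<le> t \<Longrightarrow> (l \<longlongrightarrow> l t) (at_right t)"
  shows "(\<integral>\<^sup>+t. ennreal (l t * ((real DIM('a) - \<gamma>) * wball TYPE('a) \<gamma> *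
      (measure (wmeas \<gamma>) {x. t < \<bar>w x\<bar>} / wball TYPE('a) \<gamma>) powr ((real DIM('a) - 1 - \<gamma> / 2) / (real DIM('a) - \<gamma>)))) * indicator {0<..} t \<partial>lborel)
    \<le> (\<integral>\<^sup>+x. ennreal (l \<bar>w x\<bar> * norm (g x) * norm x powr (- \<gamma> / 2)) \<partial>lborel)"
proof -
  let ?d = "real DIM('a)"
  \<comment> \<open>Chosen so that \<open>?d * (b - 1) - b * (\<gamma> / 2) = b - 1\<close>: the
    Jacobian times the pulled-back perimeter density is exactly the stretching factor in
    \<open>G\<close>.\<close>
  define b where "b = (?d - 1) / (?d - 1 - \<gamma> / 2)"
  have d2: "2 \<le> ?d" using d by simp
  have den: "0 < ?d - 1 - \<gamma> / 2" using d2 \<gamma> by simp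
  have b1: "1 < b" using den \<gamma> by (simp add: b_def)
  have bd: "b * (?d - 1 - \<gamma> / 2) = ?d - 1" using den by (simp add: b_def)
  \<comment> \<open>The volume density left over is nonincreasing exactly when
    \<open>b * (1 - \<gamma> / 2) \<le> 1\<close>, which amounts to
    \<open>2 \<le> ?d\<close>.\<close>
  have s: "b * (?d - \<gamma>) \<le> ?d"
  proof -
    have "b * (?d - \<gamma>) = b * (?d - 1 - \<gamma> / 2) + b * (1 - \<gamma> / 2)" by (simp add: algebra_simps)
    also have "\<dots> = ?d - 1 + b * (1 - \<gamma> / 2)" unfolding bd ..
    also have "b * (1 - \<gamma> / 2) \<le> 1" unfolding b_def using den d2 \<gamma> by (simp add: field_simps)
    finally show ?thesis by simp
  qed
  have \<gamma>d: "\<gamma> < ?d" using d2 \<gamma> by simp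
  have cw: "continuous_on UNIV w" using der has_derivative_continuous by (intro continuous_at_imp_continuous_on) blast
  have wm[measurable]: "w \<in> borel_measurable borel" using cw by (rule borel_measurable_continuous_onI)
  have gm[measurable]: "g \<in> borel_measurable borel" using cg by (rule borel_measurable_continuous_onI)
  define u where "u = (\<lambda>y. \<bar>w (rpow b y)\<bar>)"
  define G where "G = (\<lambda>y. norm (g (rpow b y)) * (b * norm y powr (b - 1)))"
  define R' where "R' = \<bar>R\<bar> powr (1 / b)"
  have R': "R \<le> norm (rpow b y)" if "R' \<le> norm y" for y :: 'a
  proof -
    have "R' powr b \<le> norm y powr b" using that b1 by (intro powr_mono2) (auto simp: R'_def)
    then show ?thesis using b1 by (simp add: norm_rpow R'_def powr_powr)
  qed
  obtain M where M: "0 < M" "\<And>x. norm (g x) \<le> M"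
  proof -
    have "bounded (g ` cball 0 \<bar>R\<bar>)"
      using cg by (intro compact_imp_bounded compact_continuous_image) (auto intro: continuous_on_subset)
    then obtain M where M: "0 < M" "\<And>x. x \<in> cball 0 \<bar>R\<bar> \<Longrightarrow> norm (g x) \<le> M" unfolding bounded_pos by auto
    have "norm (g x) \<le> M" for x using M(1) M(2)[of x] supp(2)[of x] by (cases "norm x \<le> \<bar>R\<bar>") auto
    then show ?thesis using that M(1) by blast
  qed
  \<comment> \<open>Only the size of the derivative enters: Cauchy-Schwarz and the stretching bound
    lose nothing when \<open>g\<close> is radial.\<close>
  have Dphi: "\<exists>D. ((\<lambda>y. w (rpow b y)) has_derivative D) (at y) \<and> (\<forall>h. \<bar>D h\<bar> \<le> G y * norm h)" for y :: 'a
  proof -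
    obtain D where D: "(rpow b has_derivative D) (at y)" "\<And>h. norm (D h) \<le> b * norm y powr (b - 1) * norm h"
      using has_derivative_rpow[OF b1] by blast
    have "((\<lambda>y. w (rpow b y)) has_derivative (\<lambda>h. g (rpow b y) \<bullet> D h)) (at y)"
      using has_derivative_compose[OF D(1) der] by simp
    moreover have "\<bar>g (rpow b y) \<bullet> D h\<bar> \<le> G y * norm h" for h
    proof -
      have "\<bar>g (rpow b y) \<bullet> D h\<bar> \<le> norm (g (rpow b y)) * norm (D h)" by (rule Cauchy_Schwarz_ineq2)
      also have "\<dots> \<le> norm (g (rpow b y)) * (b * norm y powr (b - 1) * norm h)" by (intro mult_left_mono D) auto
      finally show ?thesis by (simp add: G_def mult_ac)
    qed
    ultimately show ?thesis by blast
  qed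
  define L where "L = M * (b * R' powr (b - 1))"
  have GL: "G y \<le> L" for y
  proof (cases "R' \<le> norm y")
    case True
    then show ?thesis using supp(2)[OF R'] M b1 by (simp add: G_def L_def)
  next
    case False
    then show ?thesis unfolding G_def L_def using M(2)[of "rpow b y"] M(1) b1
      by (intro mult_mono mult_left_mono powr_mono2) auto
  qed
  have main: "(\<integral>\<^sup>+t. ennreal (l t * (real DIM('a) * unit_ball_vol (real DIM('a)) powr (1 / real DIM('a)) *
      measure lborel {y. t < u y} powr (1 - 1 / real DIM('a)))) * indicator {0<..} t \<partial>lborel)
    \<le> (\<integral>\<^sup>+y. ennreal (l (u y) * G y) \<partial>lborel)"
  proof (rule isoperimetric_functional[OF _ _ _ _ _ l l0 lB lr])
    show "0 \<le> u y" for y by (simp add: u_def)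
    show "u y = 0" if "R' \<le> norm y" for y using supp(1)[OF R'[OF that]] by (simp add: u_def)
    show "0 \<le> G y" for y using b1 by (simp add: G_def)
    show "\<bar>u y - u z\<bar> \<le> L * norm (y - z)" for y z
    proof -
      obtain D where D: "\<And>y. ((\<lambda>y. w (rpow b y)) has_derivative D y) (at y)" "\<And>y h. \<bar>D y h\<bar> \<le> G y * norm h"
        using Dphi by metis
      have "norm (w (rpow b y) - w (rpow b z)) \<le> L * norm (y - z)"
      proof (rule differentiable_bound[of UNIV])
        show "((\<lambda>y. w (rpow b y)) has_derivative D x) (at x within UNIV)" for x using D(1) by simp
        show "onorm (D x) \<le> L" for x
        proof (rule onorm_le)
          show "norm (D x h) \<le> L * norm h" for h
            using D(2)[of x h] GL[of x] by (smt (verit) mult_right_mono norm_ge_zero real_norm_def)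
        qed
      qed auto
      then show ?thesis by (simp add: u_def)
    qed
    \<comment> \<open>\<open>u\<close> need not be differentiable where \<open>w\<close> vanishes;
      the triangle inequality still yields the one-sided slope bound.\<close>
    fix y :: 'a and \<eta> :: real assume \<eta>: "0 < \<eta>"
    obtain D where D: "((\<lambda>y. w (rpow b y)) has_derivative D) (at y)" "\<And>h. \<bar>D h\<bar> \<le> G y * norm h"
      using Dphi by metis
    then obtain \<delta> where \<delta>: "0 < \<delta>" "\<And>z. norm (z - y) < \<delta> \<Longrightarrow> norm (w (rpow b z) - w (rpow b y) - D (z - y)) \<le> \<eta> * norm (z - y)"
      using \<eta> unfolding has_derivative_at_alt by blast
    have "u z \<le> u y + (G y + \<eta>) * norm (z - y)" if "norm (z - y) < \<delta>" for z
      using \<delta>(2)[OF that] D(2)[of "z - y"] by (simp add: u_def algebra_simps)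
    then show "\<exists>\<delta>>0. \<forall>z. norm (z - y) < \<delta> \<longrightarrow> u z \<le> u y + (G y + \<eta>) * norm (z - y)" using \<delta>(1) by blast
  qed
  have rhs: "(\<integral>\<^sup>+y. ennreal (l (u y) * G y) \<partial>lborel) = (\<integral>\<^sup>+x. ennreal (l \<bar>w x\<bar> * norm (g x) * norm x powr (- \<gamma> / 2)) \<partial>lborel)"
  proof -
    have "(\<integral>\<^sup>+x. ennreal (l \<bar>w x\<bar> * norm (g x) * norm x powr (- \<gamma> / 2)) \<partial>lborel)
      = (\<integral>\<^sup>+y. ennreal (l \<bar>w (rpow b y)\<bar> * norm (g (rpow b y)) * norm (rpow b y) powr (- \<gamma> / 2)) * ennreal (b * norm y powr (real DIM('a) * (b - 1))) \<partial>lborel)"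
      using b1 by (intro nn_integral_rpow) auto
    also have "\<dots> = (\<integral>\<^sup>+y. ennreal (l (u y) * G y) \<partial>lborel)"
    proof (rule nn_integral_cong)
      fix y :: 'a
      have e: "b - 1 = ?d * (b - 1) - b * (\<gamma> / 2)" using bd by (simp add: algebra_simps)
      have "norm (rpow b y) powr (- \<gamma> / 2) * (b * norm y powr (real DIM('a) * (b - 1))) = b * norm y powr (?d * (b - 1) - b * (\<gamma> / 2))"
        by (simp add: norm_rpow powr_powr powr_diff powr_minus_divide)
      then have e2: "norm (rpow b y) powr (- \<gamma> / 2) * (b * norm y powr (real DIM('a) * (b - 1))) = b * norm y powr (b - 1)"
        unfolding e[symmetric] .
      have "ennreal (l \<bar>w (rpow b y)\<bar> * norm (g (rpow b y)) * norm (rpow b y) powr (- \<gamma> / 2)) * ennreal (b * norm y powr (real DIM('a) * (b - 1)))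
        = ennreal (l \<bar>w (rpow b y)\<bar> * norm (g (rpow b y)) * (norm (rpow b y) powr (- \<gamma> / 2) * (b * norm y powr (real DIM('a) * (b - 1)))))"
        using b1 l0 by (subst ennreal_mult[symmetric]) (auto simp: mult.assoc)
      then show "ennreal (l \<bar>w (rpow b y)\<bar> * norm (g (rpow b y)) * norm (rpow b y) powr (- \<gamma> / 2)) * ennreal (b * norm y powr (real DIM('a) * (b - 1))) = ennreal (l (u y) * G y)"
        unfolding e2 by (simp add: u_def G_def mult_ac)
    qed
    finally show ?thesis by simp
  qed
  \<comment> \<open>The mass is bounded by a power of the pulled-back volume. Raising this to the
    perimeter exponent, the choice of \<open>b\<close> turns the power into
    \<open>1 - 1 / ?d\<close>.\<close>
  have lhs: "(\<integral>\<^sup>+t. ennreal (l t * ((real DIM('a) - \<gamma>) * wball TYPE('a) \<gamma> *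
      (measure (wmeas \<gamma>) {x. t < \<bar>w x\<bar>} / wball TYPE('a) \<gamma>) powr ((real DIM('a) - 1 - \<gamma> / 2) / (real DIM('a) - \<gamma>)))) * indicator {0<..} t \<partial>lborel)
    \<le> (\<integral>\<^sup>+t. ennreal (l t * (real DIM('a) * unit_ball_vol (real DIM('a)) powr (1 / real DIM('a)) *
      measure lborel {y. t < u y} powr (1 - 1 / real DIM('a)))) * indicator {0<..} t \<partial>lborel)"
  proof (rule nn_integral_mono)
    fix t :: real
    let ?\<kappa> = "wball TYPE('a) \<gamma>" and ?\<omega> = "unit_ball_vol (real DIM('a))"
    let ?m = "measure (wmeas \<gamma>) {x. t < \<bar>w x\<bar>}" and ?E = "measure lborel {y. t < u y}"
    have \<kappa>: "0 < ?\<kappa>" using wball_pos[OF \<gamma>d] .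
    have \<omega>: "0 < ?\<omega>" by simp
    show "ennreal (l t * ((real DIM('a) - \<gamma>) * ?\<kappa> * (?m / ?\<kappa>) powr ((real DIM('a) - 1 - \<gamma> / 2) / (real DIM('a) - \<gamma>)))) * indicator {0<..} t
      \<le> ennreal (l t * (real DIM('a) * ?\<omega> powr (1 / real DIM('a)) * ?E powr (1 - 1 / real DIM('a)))) * indicator {0<..} t"
    proof (cases "0 < t")
      case t: True
      have Eeq: "rpow b -` {x. t < \<bar>w x\<bar>} = {y. t < u y}" by (auto simp: u_def)
      have "{y. t < u y} \<subseteq> ball 0 R'"
      proof
        fix y assume "y \<in> {y. t < u y}"
        then have "\<not> R' \<le> norm y" using supp(1)[OF R', of y] t by (auto simp: u_def)
        then show "y \<in> ball 0 R'" by simp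
      qed
      then have fin: "emeasure lborel {y. t < u y} < \<infinity>"
        using emeasure_mono[of "{y. t < u y}" "ball 0 R'" lborel] emeasure_lborel_ball_finite[of "0::'a" R']
        by (simp add: le_less_trans)
      have "emeasure (wmeas \<gamma>) {x. t < \<bar>w x\<bar>} \<le> ennreal (?\<kappa> * (?E / ?\<omega>) powr (b * (?d - \<gamma>) / ?d))"
        using wmeas_le_ball_power[of "{x. t < \<bar>w x\<bar>}" b \<gamma>] fin b1 \<gamma>d s unfolding Eeq by simp
      then have "?m \<le> ?\<kappa> * (?E / ?\<omega>) powr (b * (?d - \<gamma>) / ?d)"
        using \<kappa> unfolding measure_def by (intro enn2real_leI) auto
      then have "?m / ?\<kappa> \<le> (?E / ?\<omega>) powr (b * (?d - \<gamma>) / ?d)" using \<kappa> by (simp add: field_simps)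
      then have "(?m / ?\<kappa>) powr ((?d - 1 - \<gamma> / 2) / (?d - \<gamma>)) \<le> ((?E / ?\<omega>) powr (b * (?d - \<gamma>) / ?d)) powr ((?d - 1 - \<gamma> / 2) / (?d - \<gamma>))"
        using \<kappa> den \<gamma>d by (intro powr_mono2) auto
      also have "\<dots> = (?E / ?\<omega>) powr (b * (?d - 1 - \<gamma> / 2) / ?d)"
        using \<gamma>d by (simp add: powr_powr)
      also have "b * (?d - 1 - \<gamma> / 2) / ?d = 1 - 1 / ?d" unfolding bd by (simp add: field_simps)
      finally have "(?m / ?\<kappa>) powr ((?d - 1 - \<gamma> / 2) / (?d - \<gamma>)) \<le> (?E / ?\<omega>) powr (1 - 1 / ?d)" .
      then have "(?d - \<gamma>) * ?\<kappa> * (?m / ?\<kappa>) powr ((?d - 1 - \<gamma> / 2) / (?d - \<gamma>)) \<le> (?d - \<gamma>) * ?\<kappa> * (?E / ?\<omega>) powr (1 - 1 / ?d)"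
        using \<kappa> \<gamma>d by (intro mult_left_mono) auto
      also have "\<dots> = ?d * ?\<omega> * (?E / ?\<omega>) powr (1 - 1 / ?d)" using \<gamma>d by (simp add: wball_def)
      also have "\<dots> = ?d * ?\<omega> powr (1 / ?d) * ?E powr (1 - 1 / ?d)"
        using \<omega> by (simp add: powr_divide powr_diff)
      finally have "(?d - \<gamma>) * ?\<kappa> * (?m / ?\<kappa>) powr ((?d - 1 - \<gamma> / 2) / (?d - \<gamma>)) \<le> ?d * ?\<omega> powr (1 / ?d) * ?E powr (1 - 1 / ?d)" .
      then show ?thesis by (intro mult_right_mono ennreal_leI mult_left_mono l0) auto
    qed simp
  qed
  show ?thesis using lhs main unfolding rhs by (rule order_trans)
qed

section \<open>Rearrangement and monotone transport\<close>

text \<open>\<open>W\<close> is the generalised inverse of the distribution function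
  \<open>m\<close>. Right continuity of \<open>m\<close> gives the equivalence between
  \<open>t < W x\<close> and \<open>x < m t\<close>, and strict decrease of \<open>m\<close> on
  \<open>{0..b}\<close> excludes jumps of \<open>W\<close>. By that equivalence the positive parts
  of \<open>v\<close> and of \<open>W\<close> on \<open>{0<..<m 0}\<close> give the same mass to
  every ray, hence have the same distribution.\<close>

lemma decreasing_rearrangement:
  fixes v :: "'a \<Rightarrow> real" and M :: "'a measure" and m :: "real \<Rightarrow> real"
  assumes v[measurable]: "v \<in> borel_measurable M" and b0: "0 \<le> b" and vb: "\<And>x. x \<in> space M \<Longrightarrow> v x \<le> b"
    and fin: "emeasure M {x \<in> space M. 0 < v x} < \<infinity>"
    and m: "\<And>t. m t = measure M {x \<in> space M. t < v x}"
    and strict: "\<And>s t. 0 \<le> s \<Longrightarrow> s < t \<Longrightarrow> t \<le> b \<Longrightarrow> m t < m s"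
  obtains W where "continuous_on {0..} W" "W \<in> borel_measurable borel" "\<And>x. 0 \<le> W x"
    "\<And>x t. 0 \<le> x \<Longrightarrow> 0 \<le> t \<Longrightarrow> t < W x \<longleftrightarrow> x < m t"
    "\<And>\<phi>. \<phi> \<in> borel_measurable borel \<Longrightarrow>
      (\<integral>\<^sup>+x. \<phi> (W x) * indicator {0<..<m 0} x \<partial>lborel) = (\<integral>\<^sup>+x. \<phi> (v x) * indicator {x. 0 < v x} x \<partial>M)"
proof -
  have finm: "emeasure M {x \<in> space M. t < v x} < \<infinity>" if "0 \<le> t" for t
    using that by (intro le_less_trans[OF emeasure_mono fin]) auto
  have em: "emeasure M {x \<in> space M. t < v x} = ennreal (m t)" if "0 \<le> t" for t
    unfolding m using finm[OF that] by (intro emeasure_eq_ennreal_measure) auto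
  have m0: "0 \<le> m t" for t by (simp add: m)
  have mono: "m t \<le> m s" if "0 \<le> s" "s \<le> t" for s t
    unfolding m using that finm[of s] by (intro measure_mono_fmeasurable) (auto simp: fmeasurable_def)
  have mb: "m t = 0" if "b \<le> t" for t
  proof -
    have "{x \<in> space M. t < v x} = {}" using vb that by force
    then show ?thesis unfolding m by (simp only: measure_empty)
  qed
  \<comment> \<open>Right continuity of \<open>m\<close>, from continuity from below of the measure
    along the levels \<open>t + 1 / Suc k\<close>.\<close>
  have rc: "\<exists>s>t. x < m s" if "0 \<le> t" "x < m t" for x t
  proof -
    have "(\<lambda>k. measure M {x \<in> space M. t + 1 / Suc k < v x}) \<longlonglongrightarrow> measure M (\<Union>k::nat. {x \<in> space M. t + 1 / Suc k < v x})"
    proof (rule Lim_measure_incseq)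
      show "incseq (\<lambda>k::nat. {x \<in> space M. t + 1 / Suc k < v x})"
        unfolding incseq_def
      proof (intro allI impI subsetI)
        fix k l :: nat and x assume kl: "k \<le> l" and x: "x \<in> {x \<in> space M. t + 1 / Suc k < v x}"
        have "1 / real (Suc l) \<le> 1 / real (Suc k)" using kl by (intro divide_left_mono) auto
        then show "x \<in> {x \<in> space M. t + 1 / Suc l < v x}" using x by auto
      qed
      have "(\<Union>k::nat. {x \<in> space M. t + 1 / Suc k < v x}) \<subseteq> {x \<in> space M. t < v x}"
        by (auto elim!: le_less_trans[rotated])
      from le_less_trans[OF emeasure_mono[OF this] finm[OF that(1)]]
      show "emeasure M (\<Union>k::nat. {x \<in> space M. t + 1 / Suc k < v x}) \<noteq> \<infinity>" by auto
    qed auto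
    also have "(\<Union>k::nat. {x \<in> space M. t + 1 / Suc k < v x}) = {x \<in> space M. t < v x}"
    proof (intro equalityI subsetI)
      fix x assume "x \<in> {x \<in> space M. t < v x}"
      then have x: "x \<in> space M" "0 < v x - t" by auto
      then obtain k :: nat where "1 / Suc k < v x - t" using nat_approx_posE by blast
      then have "t + 1 / Suc k < v x" by linarith
      then show "x \<in> (\<Union>k::nat. {x \<in> space M. t + 1 / Suc k < v x})" using x by blast
    qed (auto elim!: le_less_trans[rotated])
    finally have "(\<lambda>k. m (t + 1 / Suc k)) \<longlonglongrightarrow> m t" unfolding m .
    then have "\<forall>\<^sub>F k in sequentially. x < m (t + 1 / Suc k)" using that(2) by (intro order_tendstoD)
    then obtain k :: nat where "x < m (t + 1 / Suc k)" by (auto simp: eventually_sequentially)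
    then show ?thesis by (intro exI[of _ "t + 1 / Suc k"]) auto
  qed
  define S where "S = (\<lambda>x. {t. 0 \<le> t \<and> m t \<le> x})"
  define W where "W = (\<lambda>x. if 0 \<le> x then Inf (S x) else 0)"
  have Sne: "b \<in> S x" if "0 \<le> x" for x using that b0 mb[of b] by (simp add: S_def)
  have Sbd: "bdd_below (S x)" for x by (rule bdd_belowI[of _ 0]) (simp add: S_def)
  have W0: "0 \<le> W x" for x
    unfolding W_def using Sne[of x] by (auto intro!: cInf_greatest simp: S_def)
  have Wb: "W x \<le> b" for x unfolding W_def using Sne[of x] Sbd b0 by (auto intro: cInf_lower)
  have gal: "t < W x \<longleftrightarrow> x < m t" if x0: "0 \<le> x" and t0: "0 \<le> t" for x t
  proof
    assume "t < W x"
    then have "t \<notin> S x" using cInf_lower[OF _ Sbd, of t x] x0 by (auto simp: W_def)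
    then show "x < m t" using t0 by (simp add: S_def)
  next
    assume "x < m t"
    then obtain s where s: "t < s" "x < m s" using rc[OF t0] by blast
    have "s \<le> r" if "r \<in> S x" for r
    proof (rule ccontr)
      assume "\<not> s \<le> r"
      then have "m s \<le> m r" using that s t0 by (intro mono) (auto simp: S_def)
      then show False using that s by (simp add: S_def)
    qed
    then have "s \<le> W x" unfolding W_def using x0 Sne[of x] by (auto intro!: cInf_greatest)
    then show "t < W x" using s by simp
  qed
  have cont: "continuous_on {0..} W"
    unfolding continuous_on_def
  proof (intro ballI order_tendstoI)
    fix x0 t :: real assume x0: "x0 \<in> {0..}" and t: "t < W x0"
    show "\<forall>\<^sub>F x in at x0 within {0..}. t < W x"
    proof (cases "0 \<le> t")
      case True
      then have "x0 < m t" using gal x0 t by simp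
      then have "\<forall>\<^sub>F x in at x0 within {0..}. x < m t" by (intro order_tendstoD(2)[OF tendsto_ident_at])
      moreover have "\<forall>\<^sub>F x in at x0 within {0..}. x \<in> {0..}" by (auto simp: eventually_at_filter)
      ultimately show ?thesis by eventually_elim (use gal True in auto)
    qed (use W0 in \<open>auto intro!: always_eventually elim: less_le_trans simp: not_le\<close>)
  next
    fix x0 s :: real assume x0: "x0 \<in> {0..}" and s: "W x0 < s"
    show "\<forall>\<^sub>F x in at x0 within {0..}. W x < s"
    proof (cases "b < s")
      case True
      then show ?thesis using Wb by (intro always_eventually allI) (meson le_less_trans)
    next
      case False
      \<comment> \<open>Two levels between \<open>W x0\<close> and \<open>s\<close>: the equivalence
        gives \<open>m t' \<le> x0\<close>, and strict decrease improves this to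
        \<open>m t < x0\<close>, which is an open condition on the point.\<close>
      define t where "t = (W x0 + s) / 2"
      define t' where "t' = (W x0 + t) / 2"
      have tt: "W x0 < t'" "t' < t" "t < s" "t \<le> b" "0 \<le> t'" using s False W0[of x0] by (auto simp: t_def t'_def field_simps)
      have "m t' \<le> x0" using gal[of x0 t'] x0 tt by auto
      then have "m t < x0" using strict[of t' t] tt by simp
      then have "\<forall>\<^sub>F x in at x0 within {0..}. m t < x" by (intro order_tendstoD(1)[OF tendsto_ident_at])
      moreover have "\<forall>\<^sub>F x in at x0 within {0..}. x \<in> {0..}" by (auto simp: eventually_at_filter)
      ultimately show ?thesis
      proof eventually_elim
        case (elim x)
        then have "\<not> t < W x" using gal[of x t] tt by auto
        then show ?case using tt by simp
      qed
    qed
  qed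
  have Wm[measurable]: "W \<in> borel_measurable borel"
  proof -
    have "(\<lambda>x. indicator {0..} x *\<^sub>R W x) \<in> borel_measurable borel"
      by (intro borel_measurable_continuous_on_indicator cont) auto
    moreover have "(\<lambda>x. indicator {0..} x *\<^sub>R W x) = W" by (auto simp: W_def split: split_indicator)
    ultimately show ?thesis by simp
  qed
  define M1 where "M1 = distr (density M (indicator {x. 0 < v x})) borel v"
  define M2 where "M2 = distr (density lborel (indicator {0<..<m 0})) borel W"
  have im[measurable]: "(\<lambda>x. indicator {x. 0 < v x} x :: ennreal) \<in> borel_measurable M"
  proof -
    have "(\<lambda>x. indicator {x \<in> space M. 0 < v x} x :: ennreal) \<in> borel_measurable M" by measurable
    then show ?thesis by (rule measurable_cong[THEN iffD1, rotated]) (auto split: split_indicator)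
  qed
  have M1: "emeasure M1 {t<..} = ennreal (m (max 0 t))" for t
  proof -
    have "emeasure M1 {t<..} = emeasure (density M (indicator {x. 0 < v x})) {x \<in> space M. t < v x}"
      unfolding M1_def by (subst emeasure_distr) (auto intro!: arg_cong[where f="emeasure _"])
    also have "\<dots> = (\<integral>\<^sup>+x. indicator {x. 0 < v x} x * indicator {x \<in> space M. t < v x} x \<partial>M)"
      by (rule emeasure_density) measurable
    also have "\<dots> = (\<integral>\<^sup>+x. indicator {x \<in> space M. max 0 t < v x} x \<partial>M)"
      by (rule nn_integral_cong) (auto split: split_indicator)
    also have "\<dots> = emeasure M {x \<in> space M. max 0 t < v x}" by (rule nn_integral_indicator) measurable
    finally show ?thesis using em[of "max 0 t"] by simp
  qed
  have M2: "emeasure M2 {t<..} = ennreal (m (max 0 t))" for t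
  proof -
    have "emeasure M2 {t<..} = emeasure (density lborel (indicator {0<..<m 0})) (W -` {t<..})"
      unfolding M2_def by (subst emeasure_distr) auto
    also have "\<dots> = (\<integral>\<^sup>+x. indicator {0<..<m 0} x * indicator (W -` {t<..}) x \<partial>lborel)"
      by (rule emeasure_density) (auto intro: measurable_sets_borel[OF Wm])
    also have "\<dots> = (\<integral>\<^sup>+x. indicator {0<..<m (max 0 t)} x \<partial>lborel)"
    proof (rule nn_integral_cong)
      fix x :: real
      have "0 < x \<Longrightarrow> x < m 0 \<Longrightarrow> t < W x \<longleftrightarrow> x < m (max 0 t)"
        using gal[of x "max 0 t"] gal[of x 0] by (auto simp: max_def split: if_splits)
      moreover have "m (max 0 t) \<le> m 0" by (intro mono) auto
      ultimately show "indicator {0<..<m 0} x * indicator (W -` {t<..}) x = (indicator {0<..<m (max 0 t)} x :: ennreal)"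
        by (auto split: split_indicator)
    qed
    also have "\<dots> = ennreal (m (max 0 t))" using m0 by simp
    finally show ?thesis .
  qed
  have "M1 = M2"
    by (rule measure_eqI_lessThan) (auto simp: M1 M2, auto simp: M1_def M2_def)
  have push: "(\<integral>\<^sup>+x. \<phi> (W x) * indicator {0<..<m 0} x \<partial>lborel) = (\<integral>\<^sup>+x. \<phi> (v x) * indicator {x. 0 < v x} x \<partial>M)"
    if [measurable]: "\<phi> \<in> borel_measurable borel" for \<phi>
  proof -
    have "(\<integral>\<^sup>+x. \<phi> (W x) * indicator {0<..<m 0} x \<partial>lborel) = (\<integral>\<^sup>+t. \<phi> t \<partial>M2)"
      unfolding M2_def by (subst nn_integral_distr) (auto simp: nn_integral_density mult.commute)
    also have "\<dots> = (\<integral>\<^sup>+x. \<phi> (v x) * indicator {x. 0 < v x} x \<partial>M)"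
      unfolding \<open>M1 = M2\<close>[symmetric] M1_def
      by (subst nn_integral_distr) (auto simp: nn_integral_density mult.commute)
    finally show ?thesis .
  qed
  show ?thesis using that[OF cont Wm W0 gal push] .
qed

section \<open>Monotone transport on the half-line\<close>

lemma nn_integral_Icc_continuous:
  fixes f :: "real \<Rightarrow> real"
  assumes f: "continuous_on {a..b} f" and nonneg: "\<And>x. x \<in> {a..b} \<Longrightarrow> 0 \<le> f x"
  shows "(\<integral>\<^sup>+x. ennreal (f x) * indicator {a..b} x \<partial>lborel) = ennreal (integral {a..b} f)"
proof -
  let ?h = "\<lambda>x. indicator {a..b} x *\<^sub>R f x"
  have "(\<integral>\<^sup>+x. ennreal (f x) * indicator {a..b} x \<partial>lborel) = (\<integral>\<^sup>+x. ennreal (?h x) \<partial>lborel)"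
    by (rule nn_integral_cong) (auto split: split_indicator)
  also have "\<dots> = ennreal (integral {a..b} f)"
  proof (rule nn_integral_has_integral_lborel)
    show "?h \<in> borel_measurable borel" using f by (intro borel_measurable_continuous_on_indicator) auto
    show "0 \<le> ?h x" for x using nonneg by (auto split: split_indicator)
    have "(f has_integral integral {a..b} f) {a..b}" using f by (intro integrable_integral integrable_continuous_real)
    then have "((\<lambda>x. if x \<in> {a..b} then f x else 0) has_integral integral {a..b} f) UNIV" by (simp only: has_integral_restrict_UNIV)
    then show "(?h has_integral integral {a..b} f) UNIV"
      by (rule has_integral_eq[rotated]) (auto split: split_indicator)
  qed
  finally show ?thesis .
qed

lemma indefinite_integral_pos:
  fixes f :: "real \<Rightarrow> real"
  assumes f: "continuous_on {0..} f" and pos: "\<And>x. 0 < x \<Longrightarrow> x < a \<Longrightarrow> 0 < f x"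
  shows "\<And>x. 0 < x \<Longrightarrow> ((\<lambda>x. integral {0..x} f) has_real_derivative f x) (at x)"
    "\<And>x. continuous_on {0..x} (\<lambda>x. integral {0..x} f)"
    "\<And>x y. 0 \<le> x \<Longrightarrow> x < y \<Longrightarrow> y \<le> a \<Longrightarrow> integral {0..x} f < integral {0..y} f"
proof -
  have c: "continuous_on {0..x} f" for x using f by (rule continuous_on_subset) auto
  show D: "((\<lambda>x. integral {0..x} f) has_real_derivative f x) (at x)" if "0 < x" for x
  proof -
    have "((\<lambda>x. integral {0..x} f) has_real_derivative f x) (at x within {0..x+1})"
      using that by (intro integral_has_real_derivative c) auto
    moreover have "at x within {0..x+1} = at x" using that by (intro at_within_interior) auto
    ultimately show ?thesis by simp
  qed
  show C: "continuous_on {0..x} (\<lambda>x. integral {0..x} f)" for x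
    by (intro indefinite_integral_continuous_1 integrable_continuous_real c)
  show "integral {0..x} f < integral {0..y} f" if "0 \<le> x" "x < y" "y \<le> a" for x y
  proof (rule DERIV_pos_imp_increasing_open[OF that(2)])
    show "\<exists>d. ((\<lambda>x. integral {0..x} f) has_real_derivative d) (at z) \<and> 0 < d" if "x < z" "z < y" for z
      using D[of z] pos[of z] that \<open>0 \<le> x\<close> \<open>y \<le> a\<close> by auto
    show "continuous_on {x..y} (\<lambda>x. integral {0..x} f)" using that by (intro continuous_on_subset[OF C[of y]]) auto
  qed
qed

text \<open>With the primitives \<open>F\<close> and \<open>G\<close> of the two densities,
  \<open>T\<close> is \<open>F\<close> followed by the inverse of \<open>G\<close>. Equality of the
  masses gives \<open>F\<close> on \<open>{0<..<a}\<close> and \<open>G\<close> on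
  \<open>{0<..}\<close> the same range, and differentiating \<open>G (T x) = F x\<close> produces
  the derivative of \<open>T\<close>.\<close>

lemma monotone_transport:
  fixes f g :: "real \<Rightarrow> real"
  assumes a: "0 < a" and cf: "continuous_on {0..} f" and f0: "\<And>x. 0 < x \<Longrightarrow> x < a \<Longrightarrow> 0 < f x"
    and f0': "\<And>x. 0 \<le> x \<Longrightarrow> 0 \<le> f x"
    and cg: "continuous_on {0..} g" and g0: "\<And>y. 0 \<le> y \<Longrightarrow> 0 < g y"
    and mass: "(\<integral>\<^sup>+x. ennreal (f x) * indicator {0<..<a} x \<partial>lborel) = (\<integral>\<^sup>+y. ennreal (g y) * indicator {0<..} y \<partial>lborel)"
  obtains T where "\<And>x. 0 < x \<Longrightarrow> x < a \<Longrightarrow> 0 < T x"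
    "\<And>x. 0 < x \<Longrightarrow> x < a \<Longrightarrow> (T has_real_derivative f x / g (T x)) (at x)"
    "\<And>x y. 0 < x \<Longrightarrow> x \<le> y \<Longrightarrow> y < a \<Longrightarrow> T x \<le> T y"
    "\<And>\<phi>. \<phi> \<in> borel_measurable borel \<Longrightarrow>
      (\<integral>\<^sup>+y. \<phi> y * indicator {0<..} y \<partial>lborel) = (\<integral>\<^sup>+x. \<phi> (T x) * ennreal (f x / g (T x)) * indicator {0<..<a} x \<partial>lborel)"
proof -
  define F where "F = (\<lambda>x. integral {0..x} f)"
  define G where "G = (\<lambda>x. integral {0..x} g)"
  have FI: "0 < x \<Longrightarrow> (F has_real_derivative f x) (at x)" "continuous_on {0..x} F"
    "0 \<le> x \<Longrightarrow> x < y \<Longrightarrow> y \<le> a \<Longrightarrow> F x < F y" for x y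
    using indefinite_integral_pos[OF cf f0, of a] by (simp_all add: F_def)
  have GI: "(G has_real_derivative g x) (at x)" if "0 < x" for x
    using indefinite_integral_pos(1)[OF cg, of 0] that by (simp add: G_def)
  have GC: "continuous_on {0..x} G" for x using indefinite_integral_pos(2)[OF cg, of 0] by (simp add: G_def)
  have Gless: "G x < G y" if "0 \<le> x" "x < y" for x y
    using indefinite_integral_pos(3)[OF cg, of y x y] g0 that by (simp add: G_def)
  have F00: "F 0 = 0" "G 0 = 0" by (simp_all add: F_def G_def)
  define P where "P = F a"
  have Pn: "(\<integral>\<^sup>+x. ennreal (f x) * indicator {0<..<a} x \<partial>lborel) = ennreal P"
  proof -
    have "(\<integral>\<^sup>+x. ennreal (f x) * indicator {0<..<a} x \<partial>lborel) = (\<integral>\<^sup>+x. ennreal (f x) * indicator {0..a} x \<partial>lborel)"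
    proof (rule nn_integral_cong_AE)
      have "AE x in lborel. x \<noteq> (0::real)" "AE x in lborel. x \<noteq> a" by (rule AE_lborel_singleton)+
      then show "AE x in lborel. ennreal (f x) * indicator {0<..<a} x = ennreal (f x) * indicator {0..a} x"
        by eventually_elim (auto split: split_indicator)
    qed
    also have "\<dots> = ennreal (integral {0..a} f)"
      using f0' by (intro nn_integral_Icc_continuous continuous_on_subset[OF cf]) auto
    finally show ?thesis by (simp add: P_def F_def)
  qed
  have Gn: "(\<integral>\<^sup>+x. ennreal (g x) * indicator {0..y} x \<partial>lborel) = ennreal (G y)" for y
    unfolding G_def using g0 by (intro nn_integral_Icc_continuous continuous_on_subset[OF cg]) (auto simp: less_imp_le)
  have gm: "(\<lambda>x. ennreal (g x) * indicator {0..} x) \<in> borel_measurable borel"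
  proof -
    have "(\<lambda>x. indicator {0..} x *\<^sub>R g x) \<in> borel_measurable borel"
      by (intro borel_measurable_continuous_on_indicator cg) auto
    then have "(\<lambda>x. ennreal (indicator {0..} x *\<^sub>R g x)) \<in> borel_measurable borel" by measurable
    moreover have "(\<lambda>x. ennreal (indicator {0..} x *\<^sub>R g x)) = (\<lambda>x. ennreal (g x) * indicator {0..} x)"
      by (auto split: split_indicator)
    ultimately show ?thesis by simp
  qed
  have GP: "(\<integral>\<^sup>+y. ennreal (g y) * indicator {0..} y \<partial>lborel) = ennreal P"
  proof -
    have "(\<integral>\<^sup>+x. ennreal (g x) * indicator {0<..} x \<partial>lborel) = (\<integral>\<^sup>+x. ennreal (g x) * indicator {0..} x \<partial>lborel)"
    proof (rule nn_integral_cong_AE)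
      have "AE x in lborel. x \<noteq> (0::real)" by (rule AE_lborel_singleton)
      then show "AE x in lborel. ennreal (g x) * indicator {0<..} x = ennreal (g x) * indicator {0..} x"
        by eventually_elim (auto split: split_indicator)
    qed
    then show ?thesis using mass Pn by simp
  qed
  have P0: "0 \<le> P" using FI(3)[of 0 a] a by (simp add: P_def F00)
  have GleP: "G y \<le> P" for y
  proof -
    have "ennreal (G y) \<le> ennreal P"
      unfolding Gn[symmetric] GP[symmetric] by (intro nn_integral_mono) (auto split: split_indicator)
    then show ?thesis using P0 by simp
  qed
  have GltP: "G y < P" if "0 \<le> y" for y using Gless[of y "y + 1"] GleP[of "y + 1"] that by simp
  \<comment> \<open>Monotone convergence: \<open>G\<close> comes arbitrarily close to the full mass
    \<open>P\<close>, so every value in \<open>{0..<P}\<close> is attained.\<close>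
  have Gsup: "\<exists>y\<ge>0. z < G y" if "0 \<le> z" "z < P" for z
  proof (rule ccontr)
    assume "\<not> (\<exists>y\<ge>0. z < G y)"
    then have le: "G y \<le> z" if "0 \<le> y" for y using that by force
    have U: "(\<Union>k::nat. {0..real k}) = {0..}" by (auto intro: real_arch_simple)
    have "ennreal P = (\<integral>\<^sup>+y. (ennreal (g y) * indicator {0..} y) * indicator (\<Union>k::nat. {0..real k}) y \<partial>lborel)"
      unfolding GP[symmetric] U by (rule nn_integral_cong) (auto split: split_indicator)
    also have "\<dots> = (SUP k::nat. \<integral>\<^sup>+y. (ennreal (g y) * indicator {0..} y) * indicator {0..real k} y \<partial>lborel)"
      using gm by (intro nn_integral_indicator_UN_incseq) (auto simp: incseq_def)
    also have "\<dots> = (SUP k::nat. \<integral>\<^sup>+y. ennreal (g y) * indicator {0..real k} y \<partial>lborel)"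
      by (intro SUP_cong nn_integral_cong refl) (auto split: split_indicator)
    also have "\<dots> \<le> ennreal z" unfolding Gn by (intro SUP_least ennreal_leI le) auto
    finally show False using that by (simp add: ennreal_le_iff)
  qed
  have "\<exists>y. 0 \<le> y \<and> G y = z" if z: "0 \<le> z" "z < P" for z
  proof -
    obtain y where y: "0 \<le> y" "z < G y" using Gsup[OF z] by blast
    have "\<exists>x\<ge>0. x \<le> y \<and> G x = z" using y z by (intro IVT' GC) (auto simp: F00)
    then show ?thesis by blast
  qed
  then obtain H where H: "\<And>z. 0 \<le> z \<Longrightarrow> z < P \<Longrightarrow> 0 \<le> H z" "\<And>z. 0 \<le> z \<Longrightarrow> z < P \<Longrightarrow> G (H z) = z" by metis
  have inj: "x = y" if "0 \<le> x" "0 \<le> y" "G x = G y" for x y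
    using Gless[of x y] Gless[of y x] that by (metis less_irrefl linorder_neqE_linordered_idom)
  have G0: "0 \<le> G y" if "0 \<le> y" for y using Gless[of 0 y] that F00 by (cases "y = 0") auto
  have HG: "H (G y) = y" if "0 \<le> y" for y using H[of "G y"] G0[OF that] GltP[OF that] inj that by auto
  have H0: "0 < H z" if "0 < z" "z < P" for z
    using H[of z] that F00 by (metis less_eq_real_def less_irrefl)
  have Hd: "(H has_real_derivative inverse (g (H z))) (at z)" if z: "0 < z" "z < P" for z
  proof (rule DERIV_inverse_function[where f=G and a=0 and b=P])
    show "(G has_real_derivative g (H z)) (at (H z))" using GI H0[OF z] by simp
    show "g (H z) \<noteq> 0" using g0[of "H z"] H0[OF z] by simp
    show "isCont H z"
    proof -
      have "isCont H (G (H z))"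
      proof (rule isCont_inverse_function[where f=G and g=H and x="H z" and d="H z / 2"])
        show "0 < H z / 2" using H0[OF z] by simp
        show "H (G t) = t" if "\<bar>t - H z\<bar> \<le> H z / 2" for t using HG[of t] abs_le_D2[OF that] H0[OF z] by simp
        show "isCont G t" if "\<bar>t - H z\<bar> \<le> H z / 2" for t
          using DERIV_isCont[OF GI[of t]] abs_le_D2[OF that] H0[OF z] by simp
      qed
      then show ?thesis using H(2)[of z] z by simp
    qed
  qed (use z H(2) in auto)
  have Fb: "0 < F x" "F x < P" if "0 < x" "x < a" for x
    using FI(3)[of 0 x] FI(3)[of x a] that by (auto simp: F00 P_def)
  have Fm: "F x \<le> F y" if "0 < x" "x \<le> y" "y < a" for x y
    using FI(3)[of x y] that by (cases "x = y") auto
  define T where "T = (\<lambda>x. H (F x))"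
  have T0: "0 < T x" if "0 < x" "x < a" for x unfolding T_def using Fb[OF that] by (intro H0)
  have Td: "(T has_real_derivative f x / g (T x)) (at x)" if x: "0 < x" "x < a" for x
  proof -
    have "(H \<circ> F has_real_derivative inverse (g (H (F x))) * f x) (at x)"
      by (rule DERIV_chain[OF Hd[OF Fb[OF x]] FI(1)[OF x(1)]])
    then show ?thesis by (simp add: T_def o_def field_simps)
  qed
  have GT: "G (T x) = F x" if "0 < x" "x < a" for x unfolding T_def using Fb[OF that] by (intro H) auto
  have Tm: "T x \<le> T y" if "0 < x" "x \<le> y" "y < a" for x y
  proof (rule ccontr)
    assume "\<not> T x \<le> T y"
    then have "G (T y) < G (T x)" using T0[of y] that by (intro Gless) auto
    then show False using Fm[OF that] GT[of x] GT[of y] that by simp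
  qed
  have push: "(\<integral>\<^sup>+y. \<phi> y * indicator {0<..} y \<partial>lborel) = (\<integral>\<^sup>+x. \<phi> (T x) * ennreal (f x / g (T x)) * indicator {0<..<a} x \<partial>lborel)"
    if \<phi>: "\<phi> \<in> borel_measurable borel" for \<phi>
  proof -
    \<comment> \<open>The offset 3 gives \<open>\<alpha> k < \<beta> k\<close> already for
      \<open>k = 0\<close>; with 2 both would be \<open>a / 2\<close>.\<close>
    define \<alpha> where "\<alpha> = (\<lambda>k::nat. a / (real k + 3))"
    define \<beta> where "\<beta> = (\<lambda>k::nat. a - a / (real k + 3))"
    have \<alpha>0: "0 < \<alpha> k" "\<beta> k < a" for k using a by (auto simp: \<alpha>_def \<beta>_def)
    have \<alpha>\<beta>: "\<alpha> k < \<beta> k" for k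
    proof -
      have "a * 2 < a * (real k + 3)" using a by (intro mult_strict_left_mono) auto
      then have "2 * (a / (real k + 3)) < a" by (simp add: pos_divide_less_eq)
      then show ?thesis by (simp add: \<alpha>_def \<beta>_def)
    qed
    have mono: "\<alpha> l \<le> \<alpha> k" "\<beta> k \<le> \<beta> l" if "k \<le> l" for k l
      using that a by (auto simp: \<alpha>_def \<beta>_def intro!: divide_left_mono)
    have cover: "\<exists>k. x \<in> {\<alpha> k..\<beta> k}" if x: "0 < x" "x < a" for x
    proof -
      define mm where "mm = min x (a - x)"
      have mm: "0 < mm" "mm \<le> x" "mm \<le> a - x" using x by (auto simp: mm_def)
      obtain k :: nat where k: "a / mm < k" using reals_Archimedean2 by blast
      have "a < k * mm" using k mm by (simp add: pos_divide_less_eq)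
      also have "\<dots> \<le> (real k + 3) * mm" using mm by (intro mult_right_mono) auto
      finally have "\<alpha> k < mm" by (simp add: \<alpha>_def pos_divide_less_eq mult.commute)
      then show ?thesis using mm by (intro exI[of _ k]) (auto simp: \<alpha>_def \<beta>_def)
    qed
    have A: "{0<..<a} = (\<Union>k. {\<alpha> k..\<beta> k})"
    proof (intro equalityI subsetI)
      fix x assume "x \<in> {0<..<a}" then show "x \<in> (\<Union>k. {\<alpha> k..\<beta> k})" using cover[of x] by simp
    next
      fix x assume "x \<in> (\<Union>k. {\<alpha> k..\<beta> k})"
      then obtain k where "\<alpha> k \<le> x" "x \<le> \<beta> k" by auto
      then show "x \<in> {0<..<a}" using \<alpha>0[of k] by simp
    qed
    have B: "(\<Union>k. {T (\<alpha> k)..T (\<beta> k)}) = {0<..}"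
    proof (intro equalityI subsetI)
      fix y assume "y \<in> (\<Union>k. {T (\<alpha> k)..T (\<beta> k)})"
      then obtain k where "T (\<alpha> k) \<le> y" by auto
      moreover have "0 < T (\<alpha> k)" using \<alpha>0[of k] \<alpha>\<beta>[of k] by (intro T0) auto
      ultimately show "y \<in> {0<..}" by simp
    next
      fix y :: real assume "y \<in> {0<..}"
      then have y: "0 < y" by simp
      have "0 < G y" "G y < P" using Gless[of 0 y] GltP[of y] y F00 by auto
      then have "\<exists>x\<ge>0. x \<le> a \<and> F x = G y" using a FI(2)[of a] by (intro IVT') (auto simp: F00 P_def)
      then obtain x where x: "0 \<le> x" "x \<le> a" "F x = G y" by blast
      have "x \<noteq> 0" "x \<noteq> a" using x \<open>0 < G y\<close> \<open>G y < P\<close> F00 P_def by auto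
      then have x': "0 < x" "x < a" using x by auto
      have Tx: "T x = y" using HG[of y] y x by (simp add: T_def)
      obtain k where k: "\<alpha> k \<le> x" "x \<le> \<beta> k" using cover[OF x'] by auto
      have "T (\<alpha> k) \<le> T x" "T x \<le> T (\<beta> k)" using k \<alpha>0[of k] x' by (auto intro: Tm)
      then show "y \<in> (\<Union>k. {T (\<alpha> k)..T (\<beta> k)})" using Tx by auto
    qed
    have cT: "continuous_on {0<..<a} T" using DERIV_isCont[OF Td] by (intro continuous_at_imp_continuous_on) auto
    have "(\<integral>\<^sup>+x. \<phi> (T x) * ennreal (f x / g (T x)) * indicator {0<..<a} x \<partial>lborel) = (\<integral>\<^sup>+y. \<phi> y * indicator (\<Union>k. {T (\<alpha> k)..T (\<beta> k)}) y \<partial>lborel)"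
    proof (rule nn_integral_substitution_exhaust[OF \<phi> _ _ _ \<alpha>\<beta> _ _ A])
      show "(T has_real_derivative f x / g (T x)) (at x)" if "x \<in> {0<..<a}" for x using Td that by simp
      show "continuous_on {0<..<a} (\<lambda>x. f x / g (T x))"
      proof (intro continuous_on_divide)
        show "continuous_on {0<..<a} f" by (rule continuous_on_subset[OF cf]) auto
        show "continuous_on {0<..<a} (\<lambda>x. g (T x))"
          by (rule continuous_on_compose2[OF cg cT]) (auto simp: T0 less_imp_le)
        show "\<forall>x\<in>{0<..<a}. g (T x) \<noteq> 0" using g0 T0 by (metis greaterThanLessThan_iff less_imp_le less_irrefl)
      qed
      show "0 \<le> f x / g (T x)" if "x \<in> {0<..<a}" for x using that f0'[of x] g0[of "T x"] T0[of x] by simp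
      show "decseq \<alpha>" "incseq \<beta>" using mono by (auto simp: decseq_def incseq_def)
    qed
    then show ?thesis unfolding B ..
  qed
  show ?thesis using that[OF T0 Td Tm push] .
qed

section \<open>The transport inequality in the effective dimension\<close>

lemma nn_integral_powr_layer:
  fixes q s :: real
  assumes q: "0 < q" and s: "0 \<le> s"
  shows "(\<integral>\<^sup>+t. ennreal (q * t powr (q - 1)) * indicator {0<..<s} t \<partial>lborel) = ennreal (s powr q)"
proof -
  have "(\<integral>\<^sup>+t. ennreal (q * t powr (q - 1)) * indicator {0<..<s} t \<partial>lborel)
    = (\<integral>\<^sup>+t. indicator {..<s powr q} (1 * t powr q) * ennreal (1 * q * t powr (q - 1)) * indicator {0<..} t \<partial>lborel)"
  proof (rule nn_integral_cong)
    fix t :: real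
    have "0 < t \<Longrightarrow> t powr q < s powr q \<longleftrightarrow> t < s"
      using powr_less_mono2[of q t s] powr_mono2[of q s t] q s by (smt (verit))
    then show "ennreal (q * t powr (q - 1)) * indicator {0<..<s} t
      = indicator {..<s powr q} (1 * t powr q) * ennreal (1 * q * t powr (q - 1)) * indicator {0<..} t"
      by (auto split: split_indicator)
  qed
  also have "\<dots> = (\<integral>\<^sup>+u. indicator {..<s powr q} u * indicator {0<..} u \<partial>lborel)"
    using q by (intro nn_integral_powr_substitution) auto
  also have "\<dots> = (\<integral>\<^sup>+u. indicator {0<..<s powr q} u \<partial>lborel)"
    by (rule nn_integral_cong) (auto split: split_indicator)
  finally show ?thesis by simp
qed

text \<open>The arithmetic-geometric mean inequality with weights \<open>1 - n * \<theta>\<close>, \<open>\<theta> * (n - 1)\<close> and \<open>\<theta>\<close>,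
  applied to \<open>1\<close>, \<open>A\<close> and \<open>A powr (1 - n) * J\<close>.\<close>

lemma powr_le_affine:
  fixes A J n \<theta> :: real
  assumes "0 < A" "0 < J" "1 \<le> n" "0 \<le> \<theta>" "n * \<theta> \<le> 1"
  shows "J powr \<theta> \<le> (1 - n * \<theta>) + \<theta> * ((n - 1) * A + A powr (1 - n) * J)"
proof -
  have "A powr ((n - 1) / n) * (A powr (1 - n) * J) powr (1 / n) \<le> (n - 1) / n * A + 1 / n * (A powr (1 - n) * J)"
    using assms by (intro Youngs_inequality_0) (auto simp: field_simps)
  also have "A powr ((n - 1) / n) * (A powr (1 - n) * J) powr (1 / n) = J powr (1 / n)"
    using assms by (simp add: powr_mult powr_powr mult.assoc[symmetric] powr_add[symmetric] diff_divide_distrib)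
  finally have "n * J powr (1 / n) \<le> n * ((n - 1) / n * A + 1 / n * (A powr (1 - n) * J))"
    using assms by (intro mult_left_mono) auto
  also have "\<dots> = (n - 1) * A + A powr (1 - n) * J" using assms by (simp add: distrib_left)
  finally have 1: "n * J powr (1 / n) \<le> (n - 1) * A + A powr (1 - n) * J" .
  have "1 powr (1 - n * \<theta>) * (J powr (1 / n)) powr (n * \<theta>) \<le> (1 - n * \<theta>) * 1 + n * \<theta> * J powr (1 / n)"
    using assms by (intro Youngs_inequality_0) auto
  then have "J powr \<theta> \<le> (1 - n * \<theta>) + \<theta> * (n * J powr (1 / n))"
    using assms by (simp add: powr_powr mult_ac)
  also have "\<theta> * (n * J powr (1 / n)) \<le> \<theta> * ((n - 1) * A + A powr (1 - n) * J)"
    using 1 assms by (intro mult_left_mono)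
  finally show ?thesis by simp
qed

text \<open>Since \<open>2 * p * \<theta> = p - 1\<close>, the transport equation gives \<open>V (T
  x) powr (p + 1) * J x = W x powr (p + 1) * J x powr \<theta>\<close> with \<open>J\<close> the
  derivative of \<open>T\<close>. \<open>powr_le_affine\<close> replaces
  \<open>J x powr \<theta>\<close> by an affine function of \<open>H' x\<close>, whose integral over
  \<open>{0<..<m t}\<close> is bounded by the primitive \<open>H (m t)\<close>. Slicing
  \<open>W powr (p + 1)\<close> into levels thus takes the place of an integration by parts.\<close>

theorem transport_inequality:
  fixes W V m :: "real \<Rightarrow> real" and n p \<theta> :: real
  assumes n: "1 < n" and p: "1 < p" and \<theta>: "\<theta> = (p - 1) / (2 * p)" and n\<theta>: "n * \<theta> \<le> 1"
    and a: "0 < a" and cW: "continuous_on {0..} W" and W[measurable]: "W \<in> borel_measurable borel" and W0: "\<And>x. 0 \<le> W x"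
    and gal: "\<And>x t. 0 \<le> x \<Longrightarrow> 0 \<le> t \<Longrightarrow> t < W x \<longleftrightarrow> x < m t"
    and m: "m 0 = a" "\<And>t. 0 \<le> m t" "\<And>t. 0 < t \<Longrightarrow> m t < a"
    and cV: "continuous_on {0..} V" and V0: "\<And>y. 0 \<le> y \<Longrightarrow> 0 < V y" and V[measurable]: "V \<in> borel_measurable borel"
    and mass: "(\<integral>\<^sup>+x. ennreal (W x powr (2 * p)) * indicator {0<..<a} x \<partial>lborel)
      = (\<integral>\<^sup>+y. ennreal (V y powr (2 * p)) * indicator {0<..} y \<partial>lborel)"
  obtains T where "\<And>x. 0 < x \<Longrightarrow> x < a \<Longrightarrow> 0 < T x" "continuous_on {0<..<a} T"
    "\<And>x y. 0 < x \<Longrightarrow> x \<le> y \<Longrightarrow> y < a \<Longrightarrow> T x \<le> T y"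
    "(\<integral>\<^sup>+y. ennreal (V y powr (p + 1)) * indicator {0<..} y \<partial>lborel)
      \<le> ennreal (1 - n * \<theta>) * (\<integral>\<^sup>+x. ennreal (W x powr (p + 1)) * indicator {0<..<a} x \<partial>lborel)
        + ennreal (\<theta> * (p + 1) * n) * (\<integral>\<^sup>+t. ennreal (t powr p * T (m t) powr (1 / n) * m t powr (1 - 1 / n)) * indicator {0<..} t \<partial>lborel)"
    "(\<integral>\<^sup>+x. ennreal (W x powr (2 * p) * T x powr (2 / n)) * indicator {0<..<a} x \<partial>lborel)
      = (\<integral>\<^sup>+y. ennreal (V y powr (2 * p) * y powr (2 / n)) * indicator {0<..} y \<partial>lborel)"
proof -
  have Wpos: "0 < W x" if "0 < x" "x < a" for x using gal[of x 0] that m(1) by simp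
  obtain T where T0: "\<And>x. 0 < x \<Longrightarrow> x < a \<Longrightarrow> 0 < T x"
    and Td: "\<And>x. 0 < x \<Longrightarrow> x < a \<Longrightarrow> (T has_real_derivative W x powr (2 * p) / V (T x) powr (2 * p)) (at x)"
    and Tm: "\<And>x y. 0 < x \<Longrightarrow> x \<le> y \<Longrightarrow> y < a \<Longrightarrow> T x \<le> T y"
    and push: "\<And>\<phi>. \<phi> \<in> borel_measurable borel \<Longrightarrow>
      (\<integral>\<^sup>+y. \<phi> y * indicator {0<..} y \<partial>lborel) = (\<integral>\<^sup>+x. \<phi> (T x) * ennreal (W x powr (2 * p) / V (T x) powr (2 * p)) * indicator {0<..<a} x \<partial>lborel)"
  proof (rule monotone_transport[OF a _ _ _ _ _ mass])
    show "continuous_on {0..} (\<lambda>x. W x powr (2 * p))"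
      using p W0 by (intro continuous_on_powr' cW continuous_intros) auto
    show "0 < W x powr (2 * p)" if "0 < x" "x < a" for x using Wpos[OF that] by simp
    show "continuous_on {0..} (\<lambda>y. V y powr (2 * p))"
      using p V0 by (intro continuous_on_powr' cV continuous_intros) (auto simp: less_imp_le)
    show "0 < V y powr (2 * p)" if "0 \<le> y" for y using V0[OF that] by simp
  qed auto
  let ?A = "{0<..<a}"
  define J where "J = (\<lambda>x. W x powr (2 * p) / V (T x) powr (2 * p))"
  have VT: "0 < V (T x)" if "0 < x" "x < a" for x using V0 T0[OF that] by (simp add: less_imp_le)
  have J0: "0 < J x" if "0 < x" "x < a" for x using Wpos[OF that] VT[OF that] by (simp add: J_def)
  have cT: "continuous_on ?A T" using DERIV_isCont[OF Td] by (intro continuous_at_imp_continuous_on) auto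
  have cWA: "continuous_on ?A W" using cW by (rule continuous_on_subset) auto
  have cVT: "continuous_on ?A (\<lambda>x. V (T x))"
    by (rule continuous_on_compose2[OF cV cT]) (auto simp: T0 less_imp_le)
  have cJ: "continuous_on ?A J"
    unfolding J_def by (intro continuous_intros cWA cVT) (auto simp: Wpos VT less_imp_neq[THEN not_sym])
  \<comment> \<open>In dimension \<open>n\<close>, let the masses \<open>x = r powr n\<close> and
    \<open>T x = R powr n\<close> belong to radii \<open>r\<close> and \<open>R\<close>. Then
    \<open>H'\<close> is the divergence \<open>R' + (n - 1) * R / r\<close> of the radial map
    \<open>r \<mapsto> R\<close>, and \<open>H\<close> is its flux
    \<open>n * r powr (n - 1) * R\<close> through the sphere of radius \<open>r\<close>, in units
    where the unit ball has mass 1.\<close>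
  define H where "H = (\<lambda>x. n * (x powr (1 - 1 / n) * T x powr (1 / n)))"
  define H' where "H' = (\<lambda>x. (n - 1) * (T x / x) powr (1 / n) + ((T x / x) powr (1 / n)) powr (1 - n) * J x)"
  have H'0: "0 \<le> H' x" if "x \<in> ?A" for x using that J0[of x] n by (simp add: H'_def)
  have cH': "continuous_on ?A H'"
    unfolding H'_def by (intro continuous_intros cT cJ) (auto simp: T0 less_imp_neq[THEN not_sym])
  have Hd: "(H has_real_derivative H' x) (at x)" if "x \<in> ?A" for x
  proof -
    have x: "0 < x" "x < a" "0 < T x" using that T0 by auto
    have "(H has_real_derivative n * (((1 - 1 / n) * x powr (1 - 1 / n - 1)) * T x powr (1 / n)
        + ((1 / n) * T x powr (1 / n - 1) * J x) * x powr (1 - 1 / n))) (at x)"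
      unfolding H_def J_def using x n
      by (auto intro!: derivative_eq_intros Td simp: powr_diff field_simps)
    also have "n * (((1 - 1 / n) * x powr (1 - 1 / n - 1)) * T x powr (1 / n)
        + ((1 / n) * T x powr (1 / n - 1) * J x) * x powr (1 - 1 / n)) = H' x"
    proof -
      have e1: "x powr (1 - 1 / n - 1) * T x powr (1 / n) = (T x / x) powr (1 / n)"
        using x by (simp add: powr_divide powr_minus_divide)
      have "((T x / x) powr (1 / n)) powr (1 - n) = (T x / x) powr (1 / n - 1)"
        using x n by (simp add: powr_powr diff_divide_distrib algebra_simps)
      also have "\<dots> = T x powr (1 / n - 1) * x powr (1 - 1 / n)"
        using x powr_minus_divide[of x "1 / n - 1"] by (simp add: powr_divide)
      finally have e2: "T x powr (1 / n - 1) * x powr (1 - 1 / n) = ((T x / x) powr (1 / n)) powr (1 - n)" ..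
      have "n * (((1 - 1 / n) * x powr (1 - 1 / n - 1)) * T x powr (1 / n) + ((1 / n) * T x powr (1 / n - 1) * J x) * x powr (1 - 1 / n))
        = (n * (1 - 1 / n)) * (x powr (1 - 1 / n - 1) * T x powr (1 / n)) + (n * (1 / n)) * (T x powr (1 / n - 1) * x powr (1 - 1 / n)) * J x"
        by (simp only: algebra_simps)
      also have "\<dots> = H' x" unfolding e1 e2 H'_def using n by (simp add: right_diff_distrib)
      finally show ?thesis .
    qed
    finally show ?thesis .
  qed
  \<comment> \<open>Substitution with the integrand 1 serves as the fundamental theorem of calculus;
    the value of \<open>H\<close> at the lower end is nonnegative and is dropped.\<close>
  have Hint: "(\<integral>\<^sup>+x. ennreal (H' x) * indicator {0<..<z} x \<partial>lborel) \<le> ennreal (H z)" if z: "0 < z" "z < a" for z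
  proof -
    define \<alpha> where "\<alpha> = (\<lambda>k::nat. z / (real k + 2))"
    have A: "{0<..z} = (\<Union>k. {\<alpha> k..z})"
    proof (intro equalityI subsetI)
      fix x assume "x \<in> {0<..z}"
      then have x: "0 < x" "x \<le> z" by auto
      obtain k :: nat where "z / x < k" using reals_Archimedean2 by blast
      then have "z < k * x" using x by (simp add: pos_divide_less_eq)
      also have "\<dots> \<le> (real k + 2) * x" using x by (intro mult_right_mono) auto
      finally have "\<alpha> k < x" by (simp add: \<alpha>_def pos_divide_less_eq mult.commute)
      then show "x \<in> (\<Union>k. {\<alpha> k..z})" using x by (auto intro!: exI[of _ k])
    next
      fix x assume "x \<in> (\<Union>k. {\<alpha> k..z})"
      then obtain k where "\<alpha> k \<le> x" "x \<le> z" by auto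
      moreover have "0 < \<alpha> k" using z by (simp add: \<alpha>_def add_nonneg_pos)
      ultimately show "x \<in> {0<..z}" by simp
    qed
    have sub: "{0<..z} \<subseteq> ?A" using z by auto
    have H0: "0 \<le> H x" for x using n by (simp add: H_def)
    have "(\<integral>\<^sup>+x. ennreal (H' x) * indicator {0<..<z} x \<partial>lborel) \<le> (\<integral>\<^sup>+x. 1 * ennreal (H' x) * indicator {0<..z} x \<partial>lborel)"
      by (rule nn_integral_mono) (auto split: split_indicator)
    also have "\<dots> = (\<integral>\<^sup>+y. 1 * indicator (\<Union>k. {H (\<alpha> k)..H z}) y \<partial>lborel)"
    proof (rule nn_integral_substitution_exhaust[OF _ _ _ _ _ _ _ A, where f="\<lambda>_. 1"])
      show "\<alpha> k < z" for k
      proof -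
        have "z * 1 < z * (real k + 2)" using z by (intro mult_strict_left_mono) auto
        then show ?thesis by (simp add: \<alpha>_def pos_divide_less_eq)
      qed
      show "decseq \<alpha>" using z by (auto simp: decseq_def \<alpha>_def intro!: divide_left_mono)
      show "(H has_real_derivative H' x) (at x)" "0 \<le> H' x" if "x \<in> {0<..z}" for x using that sub Hd H'0 by blast+
      show "continuous_on {0<..z} H'" using cH' sub by (rule continuous_on_subset)
    qed (auto simp: incseq_def)
    also have "\<dots> \<le> (\<integral>\<^sup>+y. indicator {0..H z} y \<partial>lborel)"
      using H0 by (intro nn_integral_mono) (auto split: split_indicator intro: order_trans)
    also have "\<dots> = ennreal (H z)" using H0 by simp
    finally show ?thesis .
  qed
  define h where "h = (\<lambda>x. indicator ?A x *\<^sub>R H' x)"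
  have hm[measurable]: "h \<in> borel_measurable borel"
    unfolding h_def by (intro borel_measurable_continuous_on_indicator cH') auto
  have h0: "0 \<le> h x" for x using H'0 by (simp add: h_def split: split_indicator)
  have \<theta>0: "0 \<le> \<theta>" using p by (simp add: \<theta>)
  have K: "(\<integral>\<^sup>+y. ennreal (V y powr (p + 1)) * indicator {0<..} y \<partial>lborel)
      \<le> ennreal (1 - n * \<theta>) * (\<integral>\<^sup>+x. ennreal (W x powr (p + 1)) * indicator ?A x \<partial>lborel)
        + ennreal \<theta> * (\<integral>\<^sup>+x. ennreal (W x powr (p + 1)) * ennreal (h x) \<partial>lborel)"
  proof -
    have "(\<integral>\<^sup>+y. ennreal (V y powr (p + 1)) * indicator {0<..} y \<partial>lborel)
      = (\<integral>\<^sup>+x. ennreal (V (T x) powr (p + 1)) * ennreal (J x) * indicator ?A x \<partial>lborel)"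
      unfolding J_def by (rule push) measurable
    also have "\<dots> \<le> (\<integral>\<^sup>+x. ennreal (1 - n * \<theta>) * (ennreal (W x powr (p + 1)) * indicator ?A x) + ennreal \<theta> * (ennreal (W x powr (p + 1)) * ennreal (h x)) \<partial>lborel)"
    proof (rule nn_integral_mono)
      fix x
      show "ennreal (V (T x) powr (p + 1)) * ennreal (J x) * indicator ?A x
        \<le> ennreal (1 - n * \<theta>) * (ennreal (W x powr (p + 1)) * indicator ?A x) + ennreal \<theta> * (ennreal (W x powr (p + 1)) * ennreal (h x))"
      proof (cases "x \<in> ?A")
        case True
        then have x: "0 < x" "x < a" by auto
        define r where "r = W x / V (T x)"
        have r: "0 < r" using Wpos[OF x] VT[OF x] by (simp add: r_def)
        have Jr: "J x = r powr (2 * p)" using Wpos[OF x] VT[OF x] by (simp add: J_def r_def powr_divide)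
        have Vr: "V (T x) = W x / r" using r Wpos[OF x] VT[OF x] by (simp add: r_def)
        have "V (T x) powr (p + 1) * J x = W x powr (p + 1) * (r powr (2 * p) / r powr (p + 1))"
          unfolding Vr Jr using r Wpos[OF x] by (simp add: powr_divide)
        also have "\<dots> = W x powr (p + 1) * r powr (2 * p - (p + 1))" by (simp only: powr_diff)
        also have "2 * p - (p + 1) = 2 * p * \<theta>" using p by (simp add: \<theta>)
        also have "r powr (2 * p * \<theta>) = J x powr \<theta>" unfolding Jr by (simp add: powr_powr)
        also have "J x powr \<theta> \<le> (1 - n * \<theta>) + \<theta> * H' x"
          unfolding H'_def using x T0[OF x] J0[OF x] n \<theta>0 n\<theta> by (intro powr_le_affine) auto
        finally have "V (T x) powr (p + 1) * J x \<le> W x powr (p + 1) * ((1 - n * \<theta>) + \<theta> * H' x)"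
          by (simp add: mult_left_mono)
        then have "ennreal (V (T x) powr (p + 1) * J x) \<le> ennreal ((1 - n * \<theta>) * W x powr (p + 1) + \<theta> * (W x powr (p + 1) * H' x))"
          by (intro ennreal_leI) (simp add: algebra_simps)
        also have "\<dots> = ennreal (1 - n * \<theta>) * ennreal (W x powr (p + 1)) + ennreal \<theta> * (ennreal (W x powr (p + 1)) * ennreal (H' x))"
          using n\<theta> \<theta>0 H'0[OF True] by (simp add: ennreal_plus ennreal_mult)
        finally show ?thesis using True J0[OF x] by (simp add: ennreal_mult h_def)
      qed simp
    qed
    also have "\<dots> = (\<integral>\<^sup>+x. ennreal (1 - n * \<theta>) * (ennreal (W x powr (p + 1)) * indicator ?A x) \<partial>lborel) + (\<integral>\<^sup>+x. ennreal \<theta> * (ennreal (W x powr (p + 1)) * ennreal (h x)) \<partial>lborel)"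
      by (rule nn_integral_add) measurable
    also have "\<dots> = ennreal (1 - n * \<theta>) * (\<integral>\<^sup>+x. ennreal (W x powr (p + 1)) * indicator ?A x \<partial>lborel)
        + ennreal \<theta> * (\<integral>\<^sup>+x. ennreal (W x powr (p + 1)) * ennreal (h x) \<partial>lborel)"
      by (subst (1 2) nn_integral_cmult) (auto intro!: borel_measurable_times_ennreal borel_measurable_indicator)
    finally show ?thesis .
  qed
  have layer: "(\<integral>\<^sup>+x. ennreal (W x powr (p + 1)) * ennreal (h x) \<partial>lborel)
    \<le> ennreal ((p + 1) * n) * (\<integral>\<^sup>+t. ennreal (t powr p * T (m t) powr (1 / n) * m t powr (1 - 1 / n)) * indicator {0<..} t \<partial>lborel)"
  proof -
    let ?f = "\<lambda>t. ennreal ((p + 1) * t powr p)"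
    have "(\<integral>\<^sup>+x. ennreal (W x powr (p + 1)) * ennreal (h x) \<partial>lborel)
      = (\<integral>\<^sup>+x. (\<integral>\<^sup>+t. ?f t * indicator {0<..} t * indicator {q. snd q < W (fst q)} (x, t) * ennreal (h x) \<partial>lborel) \<partial>lborel)"
    proof (rule nn_integral_cong)
      fix x
      have "ennreal (W x powr (p + 1)) = (\<integral>\<^sup>+t. ennreal ((p + 1) * t powr (p + 1 - 1)) * indicator {0<..<W x} t \<partial>lborel)"
        using W0 p by (intro nn_integral_powr_layer[symmetric]) auto
      also have "\<dots> = (\<integral>\<^sup>+t. ?f t * indicator {0<..} t * indicator {q. snd q < W (fst q)} (x, t) \<partial>lborel)"
        by (rule nn_integral_cong) (auto split: split_indicator)
      finally show "ennreal (W x powr (p + 1)) * ennreal (h x) = (\<integral>\<^sup>+t. ?f t * indicator {0<..} t * indicator {q. snd q < W (fst q)} (x, t) * ennreal (h x) \<partial>lborel)"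
        by (simp add: nn_integral_multc)
    qed
    also have "\<dots> = (\<integral>\<^sup>+t. (\<integral>\<^sup>+x. ?f t * indicator {0<..} t * indicator {q. snd q < W (fst q)} (x, t) * ennreal (h x) \<partial>lborel) \<partial>lborel)"
      by (rule lborel_pair.Fubini') measurable
    also have "\<dots> \<le> (\<integral>\<^sup>+t. ennreal ((p + 1) * n) * (ennreal (t powr p * T (m t) powr (1 / n) * m t powr (1 - 1 / n)) * indicator {0<..} t) \<partial>lborel)"
    proof (rule nn_integral_mono)
      fix t :: real
      show "(\<integral>\<^sup>+x. ?f t * indicator {0<..} t * indicator {q. snd q < W (fst q)} (x, t) * ennreal (h x) \<partial>lborel)
        \<le> ennreal ((p + 1) * n) * (ennreal (t powr p * T (m t) powr (1 / n) * m t powr (1 - 1 / n)) * indicator {0<..} t)"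
      proof (cases "0 < t")
        case t: True
        have "(\<integral>\<^sup>+x. ?f t * indicator {0<..} t * indicator {q. snd q < W (fst q)} (x, t) * ennreal (h x) \<partial>lborel)
          = (\<integral>\<^sup>+x. ?f t * (ennreal (h x) * indicator {0<..<m t} x) \<partial>lborel)"
        proof (rule nn_integral_cong)
          fix x
          have "x \<in> ?A \<Longrightarrow> t < W x \<longleftrightarrow> x < m t" using gal[of x t] t by simp
          then show "?f t * indicator {0<..} t * indicator {q. snd q < W (fst q)} (x, t) * ennreal (h x) = ?f t * (ennreal (h x) * indicator {0<..<m t} x)"
            using t by (auto simp: h_def split: split_indicator)
        qed
        also have "\<dots> = ?f t * (\<integral>\<^sup>+x. ennreal (h x) * indicator {0<..<m t} x \<partial>lborel)" by (rule nn_integral_cmult) measurable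
        also have "(\<integral>\<^sup>+x. ennreal (h x) * indicator {0<..<m t} x \<partial>lborel) \<le> ennreal (n * (T (m t) powr (1 / n) * m t powr (1 - 1 / n)))"
        proof (cases "0 < m t")
          case True
          have "(\<integral>\<^sup>+x. ennreal (h x) * indicator {0<..<m t} x \<partial>lborel) = (\<integral>\<^sup>+x. ennreal (H' x) * indicator {0<..<m t} x \<partial>lborel)"
            using m(3)[OF t] by (intro nn_integral_cong) (auto simp: h_def split: split_indicator)
          also have "\<dots> \<le> ennreal (H (m t))" using True m(3)[OF t] by (rule Hint)
          finally show ?thesis by (simp add: H_def mult.commute)
        next
          case False
          then have "{0<..<m t} = {}" by auto
          then show ?thesis by simp
        qed
        also have "?f t * ennreal (n * (T (m t) powr (1 / n) * m t powr (1 - 1 / n)))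
          = ennreal ((p + 1) * n) * (ennreal (t powr p * T (m t) powr (1 / n) * m t powr (1 - 1 / n)) * indicator {0<..} t)"
          using t p n by (simp add: ennreal_mult[symmetric] mult_ac)
        finally show ?thesis by (simp add: mult_left_mono)
      qed simp
    qed
    also have "\<dots> \<le> ennreal ((p + 1) * n) * (\<integral>\<^sup>+t. ennreal (t powr p * T (m t) powr (1 / n) * m t powr (1 - 1 / n)) * indicator {0<..} t \<partial>lborel)"
    proof -
      \<comment> \<open>\<open>m\<close> is monotone for nonnegative arguments and \<open>T\<close>
        continuous on \<open>?A\<close> only; extending the former constantly and the latter by 0
        makes both measurable. At \<open>m t = 0\<close> the integrand is 0 because
        \<open>0 powr (1 - 1 / n) = 0\<close>.\<close>
      define m' where "m' = (\<lambda>t. m (max 0 t))"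
      define T' where "T' = (\<lambda>x. indicator ?A x *\<^sub>R T x)"
      have "m t \<le> m s" if "0 \<le> s" "s \<le> t" for s t
      proof (rule ccontr)
        assume *: "\<not> m t \<le> m s"
        then have "t < W (m s)" "\<not> s < W (m s)" using gal[of "m s" t] gal[of "m s" s] m(2) that by auto
        then show False using that by simp
      qed
      then have "mono (\<lambda>t. - m' t)" by (intro monoI) (simp add: m'_def)
      then have "(\<lambda>t. - m' t) \<in> borel_measurable borel" by (rule borel_measurable_mono)
      then have [measurable]: "m' \<in> borel_measurable borel" by (simp add: borel_measurable_uminus_eq)
      have [measurable]: "T' \<in> borel_measurable borel"
        unfolding T'_def by (intro borel_measurable_continuous_on_indicator cT) auto
      have eq: "ennreal (t powr p * T (m t) powr (1 / n) * m t powr (1 - 1 / n)) * indicator {0<..} t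
        = ennreal (t powr p * T' (m' t) powr (1 / n) * m' t powr (1 - 1 / n)) * indicator {0<..} t" for t
        using m(2)[of t] m(3)[of t] by (cases "m t = 0") (auto simp: m'_def T'_def split: split_indicator)
      show ?thesis unfolding eq by (subst nn_integral_cmult) auto
    qed
    finally show ?thesis .
  qed
  have K': "(\<integral>\<^sup>+y. ennreal (V y powr (p + 1)) * indicator {0<..} y \<partial>lborel)
      \<le> ennreal (1 - n * \<theta>) * (\<integral>\<^sup>+x. ennreal (W x powr (p + 1)) * indicator ?A x \<partial>lborel)
        + ennreal (\<theta> * (p + 1) * n) * (\<integral>\<^sup>+t. ennreal (t powr p * T (m t) powr (1 / n) * m t powr (1 - 1 / n)) * indicator {0<..} t \<partial>lborel)"
  proof -
    have "ennreal \<theta> * (\<integral>\<^sup>+x. ennreal (W x powr (p + 1)) * ennreal (h x) \<partial>lborel)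
      \<le> ennreal \<theta> * (ennreal ((p + 1) * n) * (\<integral>\<^sup>+t. ennreal (t powr p * T (m t) powr (1 / n) * m t powr (1 - 1 / n)) * indicator {0<..} t \<partial>lborel))"
      by (intro mult_left_mono layer) auto
    also have "\<dots> = ennreal (\<theta> * (p + 1) * n) * (\<integral>\<^sup>+t. ennreal (t powr p * T (m t) powr (1 / n) * m t powr (1 - 1 / n)) * indicator {0<..} t \<partial>lborel)"
      using \<theta>0 p n by (simp add: mult.assoc[symmetric] ennreal_mult[symmetric])
    finally show ?thesis using K by (meson add_left_mono order_trans)
  qed
  have L: "(\<integral>\<^sup>+x. ennreal (W x powr (2 * p) * T x powr (2 / n)) * indicator ?A x \<partial>lborel)
      = (\<integral>\<^sup>+y. ennreal (V y powr (2 * p) * y powr (2 / n)) * indicator {0<..} y \<partial>lborel)"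
  proof -
    have "(\<integral>\<^sup>+y. ennreal (V y powr (2 * p) * y powr (2 / n)) * indicator {0<..} y \<partial>lborel)
      = (\<integral>\<^sup>+x. ennreal (V (T x) powr (2 * p) * T x powr (2 / n)) * ennreal (W x powr (2 * p) / V (T x) powr (2 * p)) * indicator ?A x \<partial>lborel)"
      by (rule push) measurable
    also have "\<dots> = (\<integral>\<^sup>+x. ennreal (W x powr (2 * p) * T x powr (2 / n)) * indicator ?A x \<partial>lborel)"
    proof (rule nn_integral_cong)
      fix x
      show "ennreal (V (T x) powr (2 * p) * T x powr (2 / n)) * ennreal (W x powr (2 * p) / V (T x) powr (2 * p)) * indicator ?A x
        = ennreal (W x powr (2 * p) * T x powr (2 / n)) * indicator ?A x"
        using VT[of x] by (cases "x \<in> ?A") (auto simp: ennreal_mult[symmetric])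
    qed
    finally show ?thesis ..
  qed
  show ?thesis using that[OF T0 cT Tm K' L] .
qed

section \<open>The interpolation inequality\<close>

lemma ennreal_le_sqrtI:
  assumes "x\<^sup>2 \<le> ennreal c" "0 \<le> c"
  shows "x \<le> ennreal (sqrt c)"
proof (cases x)
  case (real r)
  then have "r\<^sup>2 \<le> c" using assms by (simp add: ennreal_power)
  then show ?thesis using real by (simp add: real_le_rsqrt ennreal_leI)
qed (use assms in \<open>auto simp: power2_eq_square top_unique\<close>)

text \<open>Up to constants, the last integral of \<open>transport_inequality\<close> is the left
  side of the isoperimetric inequality for the multiplier
  \<open>t powr p * T (m t) powr (1 / n)\<close>. On the right side Cauchy-Schwarz separates the
  Dirichlet energy from the squared multiplier integrated against \<open>wmeas \<gamma>\<close>. By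
  equimeasurability and the push-forward under \<open>T\<close> the latter is at most
  \<open>L\<close>, which depends on \<open>V\<close> and \<open>n\<close> but not on
  \<open>w\<close>.\<close>

theorem weighted_interpolation:
  fixes w :: "'a::euclidean_space \<Rightarrow> real" and g :: "'a \<Rightarrow> 'a" and V :: "real \<Rightarrow> real" and n p \<theta> \<gamma> :: real
  assumes d: "3 \<le> DIM('a)" and \<gamma>: "0 < \<gamma>" "\<gamma> < 2" and n: "n = 2 * (real DIM('a) - \<gamma>) / (2 - \<gamma>)"
    and p: "1 < p" and \<theta>: "\<theta> = (p - 1) / (2 * p)" and n\<theta>: "n * \<theta> \<le> 1"
    and der: "\<And>x. (w has_derivative (\<lambda>h. g x \<bullet> h)) (at x)" and cg: "continuous_on UNIV g"
    and supp: "\<And>x. R \<le> norm x \<Longrightarrow> w x = 0" "\<And>x. R \<le> norm x \<Longrightarrow> g x = 0" and ne: "w z \<noteq> 0"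
    and cV: "continuous_on {0..} V" and V0: "\<And>y. 0 \<le> y \<Longrightarrow> 0 < V y" and V[measurable]: "V \<in> borel_measurable borel"
    and mass: "(\<integral>\<^sup>+x. ennreal (\<bar>w x\<bar> powr (2 * p)) \<partial>wmeas \<gamma>) = (\<integral>\<^sup>+y. ennreal (V y powr (2 * p)) * indicator {0<..} y \<partial>lborel)"
    and L: "(\<integral>\<^sup>+y. ennreal (V y powr (2 * p) * y powr (2 / n)) * indicator {0<..} y \<partial>lborel) = ennreal L" "0 \<le> L"
    and D: "(\<integral>\<^sup>+x. ennreal ((norm (g x))\<^sup>2) \<partial>lborel) = ennreal D" "0 \<le> D"
  shows "(\<integral>\<^sup>+y. ennreal (V y powr (p + 1)) * indicator {0<..} y \<partial>lborel)
    \<le> ennreal (1 - n * \<theta>) * (\<integral>\<^sup>+x. ennreal (\<bar>w x\<bar> powr (p + 1)) \<partial>wmeas \<gamma>)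
      + ennreal (\<theta> * (p + 1) * n / ((real DIM('a) - \<gamma>) * wball TYPE('a) \<gamma> powr (1 / n)) * sqrt (L * D))"
proof -
  let ?d = "real DIM('a)" and ?\<kappa> = "wball TYPE('a) \<gamma>"
  have d3: "3 \<le> ?d" using d by simp
  have \<gamma>d: "\<gamma> < ?d" using d3 \<gamma> by simp
  have \<kappa>: "0 < ?\<kappa>" using wball_pos[OF \<gamma>d] .
  have n1: "1 < n" using d3 \<gamma> unfolding n by (simp add: pos_less_divide_eq)
  \<comment> \<open>The isoperimetric exponent of an \<open>n\<close>-dimensional space: this
    identity determines the effective dimension.\<close>
  have q: "(?d - 1 - \<gamma> / 2) / (?d - \<gamma>) = 1 - 1 / n"
    unfolding n using \<gamma> \<gamma>d by (simp add: field_simps)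
  have cw: "continuous_on UNIV w" using der has_derivative_continuous by (intro continuous_at_imp_continuous_on) blast
  define v where "v = (\<lambda>x. \<bar>w x\<bar>)"
  have cv: "continuous_on UNIV v" unfolding v_def using cw by (intro continuous_intros)
  have vm[measurable]: "v \<in> borel_measurable borel" using cv by (rule borel_measurable_continuous_onI)
  have gm[measurable]: "g \<in> borel_measurable borel" using cg by (rule borel_measurable_continuous_onI)
  have vm'[measurable]: "v \<in> borel_measurable (wmeas \<gamma>)" by simp
  have v0: "0 \<le> v x" for x by (simp add: v_def)
  have vs: "v x = 0" if "R \<le> norm x" for x using supp(1)[OF that] by (simp add: v_def)
  have inR: "norm x < \<bar>R\<bar>" if "0 < v x" for x
    using vs[of x] that abs_ge_self[of R] by (cases "R \<le> norm x") auto
  obtain b where b: "0 < b" "\<And>x. v x \<le> b" "\<exists>x. v x = b"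
  proof -
    have "z \<in> cball 0 \<bar>R\<bar>" using supp(1)[of z] ne abs_ge_self[of R] by (cases "R \<le> norm z") auto
    then obtain x0 where x0: "x0 \<in> cball 0 \<bar>R\<bar>" "\<And>x. x \<in> cball 0 \<bar>R\<bar> \<Longrightarrow> v x \<le> v x0"
      using continuous_attains_sup[of "cball 0 \<bar>R\<bar>" v] continuous_on_subset[OF cv] by (metis compact_cball empty_iff subset_UNIV)
    have le: "v x \<le> v x0" for x
      using x0(2)[of x] vs[of x] v0[of x0] abs_ge_self[of R] by (cases "norm x \<le> \<bar>R\<bar>") auto
    have "0 < v z" using ne by (simp add: v_def)
    then have "0 < v x0" using le[of z] by simp
    then show ?thesis using that[of "v x0"] le by blast
  qed
  define m where "m = (\<lambda>t. measure (wmeas \<gamma>) {x \<in> space (wmeas \<gamma>). t < v x})"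
  have mU: "m t = measure (wmeas \<gamma>) {x. t < v x}" for t by (simp add: m_def)
  have fin: "emeasure (wmeas \<gamma>) {x \<in> space (wmeas \<gamma>). 0 < v x} < \<infinity>"
  proof -
    have "{x. 0 < v x} \<subseteq> ball 0 \<bar>R\<bar>" using inR by auto
    then have "emeasure (wmeas \<gamma>) {x. 0 < v x} \<le> emeasure (wmeas \<gamma>) (ball (0::'a) \<bar>R\<bar>)" by (intro emeasure_mono) auto
    also have "\<dots> < \<infinity>" using emeasure_wmeas_ball[OF \<gamma>d, of "\<bar>R\<bar>"] by simp
    finally show ?thesis by simp
  qed
  have fm: "{x. t < v x} \<in> fmeasurable (wmeas \<gamma>)" if "0 \<le> t" for t
  proof (rule fmeasurableI)
    have "emeasure (wmeas \<gamma>) {x. t < v x} \<le> emeasure (wmeas \<gamma>) {x. 0 < v x}" using that by (intro emeasure_mono) auto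
    then show "emeasure (wmeas \<gamma>) {x. t < v x} < \<infinity>" using fin by simp
  qed simp
  \<comment> \<open>By connectedness \<open>v\<close> attains every value in \<open>{0..b}\<close>,
    so the open set between two levels is nonempty and has positive mass.\<close>
  have strict: "m t < m s" if st: "0 \<le> s" "s < t" "t \<le> b" for s t
  proof -
    define U where "U = {x. s < v x \<and> v x < t}"
    have Uo: "open U" unfolding U_def using cv by (intro open_Collect_conj open_Collect_less continuous_intros) auto
    have Une: "U \<noteq> {}"
    proof -
      obtain x1 where x1: "v x1 = b" using b(3) by blast
      obtain x2 :: 'a where "norm x2 = \<bar>R\<bar>" using vector_choose_size[of "\<bar>R\<bar>"] by auto
      then have x2: "v x2 = 0" using vs by simp
      have "connected (v ` UNIV)" using cv connected_UNIV by (rule connected_continuous_image)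
      then have "{v x2..v x1} \<subseteq> v ` UNIV" by (rule connected_contains_Icc) auto
      moreover have "(s + t) / 2 \<in> {v x2..v x1}" using st x1 x2 by auto
      ultimately obtain x where "v x = (s + t) / 2" by (metis imageE subsetD)
      then have "x \<in> U" using st by (simp add: U_def)
      then show ?thesis by blast
    qed
    have Ub: "bounded U"
    proof -
      have "U \<subseteq> ball 0 \<bar>R\<bar>" using inR st by (auto simp: U_def)
      then show ?thesis using bounded_ball bounded_subset by blast
    qed
    have Um: "U \<in> sets (wmeas \<gamma>)" using Uo by simp
    have Uf: "U \<in> fmeasurable (wmeas \<gamma>)" by (rule fmeasurableI2[OF fm[OF st(1)] _ Um]) (auto simp: U_def)
    have "measure (wmeas \<gamma>) U \<noteq> 0"
    proof
      assume "measure (wmeas \<gamma>) U = 0"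
      then have "U \<in> null_sets (wmeas \<gamma>)"
        using Uf by (intro null_setsI) (auto simp: fmeasurable_def emeasure_eq_ennreal_measure less_top)
      then have "AE x in lborel. x \<in> U \<longrightarrow> ennreal (norm x powr (- \<gamma>)) = 0"
        unfolding wmeas_def by (subst (asm) null_sets_density_iff) auto
      moreover have "AE x in lborel. x \<noteq> (0::'a)" by (rule AE_lborel_singleton)
      ultimately have "AE x in lborel. x \<notin> U" by eventually_elim auto
      then have "U \<in> null_sets lborel" using Um by (subst AE_iff_null_sets) auto
      then have "measure lborel U = 0" by (auto simp: measure_def null_sets_def)
      then show False using measure_open_pos[OF Uo Ub Une] by simp
    qed
    then have Up: "0 < measure (wmeas \<gamma>) U" by (simp add: zero_less_measure_iff)
    have "m t + measure (wmeas \<gamma>) U = measure (wmeas \<gamma>) ({x. t < v x} \<union> U)"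
      unfolding mU using fm[of t] Uf st by (subst measure_Un2) (auto simp: U_def intro!: arg_cong[where f="measure _"])
    also have "\<dots> \<le> m s"
      unfolding mU using st fm[OF st(1)] Um by (intro measure_mono_fmeasurable) (auto simp: U_def)
    finally show ?thesis using Up by simp
  qed
  define a where "a = m 0"
  have m0: "0 \<le> m t" for t by (simp add: m_def)
  have a0: "0 < a" using strict[of 0 b] b(1) m0[of b] by (simp add: a_def)
  have mb: "m t = 0" if "b \<le> t" for t
  proof -
    have "{x. t < v x} = {}" using b(2) that by (auto simp: not_less intro: order_trans)
    then show ?thesis unfolding mU by (simp only: measure_empty)
  qed
  have ma: "m t < a" if "0 < t" for t
    using strict[of 0 t] mb[of t] a0 that unfolding a_def by (cases "t \<le> b") auto
  have mmono: "m t \<le> m s" if "0 \<le> s" "s \<le> t" for s t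
    unfolding mU using that fm by (intro measure_mono_fmeasurable) auto
  obtain W where W: "continuous_on {0..} W" "W \<in> borel_measurable borel" "\<And>x. 0 \<le> W x"
    and gal: "\<And>x t. 0 \<le> x \<Longrightarrow> 0 \<le> t \<Longrightarrow> t < W x \<longleftrightarrow> x < m t"
    and push: "\<And>\<phi>. \<phi> \<in> borel_measurable borel \<Longrightarrow>
      (\<integral>\<^sup>+x. \<phi> (W x) * indicator {0<..<m 0} x \<partial>lborel) = (\<integral>\<^sup>+x. \<phi> (v x) * indicator {x. 0 < v x} x \<partial>wmeas \<gamma>)"
    by (rule decreasing_rearrangement[where v=v and M="wmeas \<gamma>" and b=b and m=m])
       (use b fin strict in \<open>auto simp: m_def\<close>)
  have Wpow: "(\<integral>\<^sup>+x. ennreal (W x powr r) * indicator {0<..<a} x \<partial>lborel) = (\<integral>\<^sup>+x. ennreal (\<bar>w x\<bar> powr r) \<partial>wmeas \<gamma>)" for r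
  proof -
    have "(\<integral>\<^sup>+x. ennreal (W x powr r) * indicator {0<..<a} x \<partial>lborel) = (\<integral>\<^sup>+x. ennreal (v x powr r) * indicator {x. 0 < v x} x \<partial>wmeas \<gamma>)"
      unfolding a_def by (rule push) measurable
    also have "\<dots> = (\<integral>\<^sup>+x. ennreal (\<bar>w x\<bar> powr r) \<partial>wmeas \<gamma>)"
      by (rule nn_integral_cong) (auto simp: v_def split: split_indicator)
    finally show ?thesis .
  qed
  obtain T where T0: "\<And>x. 0 < x \<Longrightarrow> x < a \<Longrightarrow> 0 < T x" and cT: "continuous_on {0<..<a} T"
    and Tm: "\<And>x y. 0 < x \<Longrightarrow> x \<le> y \<Longrightarrow> y < a \<Longrightarrow> T x \<le> T y"
    and TK: "(\<integral>\<^sup>+y. ennreal (V y powr (p + 1)) * indicator {0<..} y \<partial>lborel)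
      \<le> ennreal (1 - n * \<theta>) * (\<integral>\<^sup>+x. ennreal (W x powr (p + 1)) * indicator {0<..<a} x \<partial>lborel)
        + ennreal (\<theta> * (p + 1) * n) * (\<integral>\<^sup>+t. ennreal (t powr p * T (m t) powr (1 / n) * m t powr (1 - 1 / n)) * indicator {0<..} t \<partial>lborel)"
    and TL: "(\<integral>\<^sup>+x. ennreal (W x powr (2 * p) * T x powr (2 / n)) * indicator {0<..<a} x \<partial>lborel)
      = (\<integral>\<^sup>+y. ennreal (V y powr (2 * p) * y powr (2 / n)) * indicator {0<..} y \<partial>lborel)"
  proof (rule transport_inequality[OF n1 p \<theta> n\<theta> a0 W(1,2,3) gal _ m0 ma cV V0 V])
    show "m 0 = a" by (simp add: a_def)
    show "(\<integral>\<^sup>+x. ennreal (W x powr (2 * p)) * indicator {0<..<a} x \<partial>lborel)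
      = (\<integral>\<^sup>+y. ennreal (V y powr (2 * p)) * indicator {0<..} y \<partial>lborel)"
      unfolding Wpow by (rule mass)
  qed auto
  define m' where "m' = (\<lambda>t. m (max 0 t))"
  define T' where "T' = (\<lambda>x. indicator {0<..<a} x *\<^sub>R T x)"
  have "mono (\<lambda>t. - m' t)" using mmono by (intro monoI) (simp add: m'_def)
  then have "(\<lambda>t. - m' t) \<in> borel_measurable borel" by (rule borel_measurable_mono)
  then have m'm[measurable]: "m' \<in> borel_measurable borel" by (simp add: borel_measurable_uminus_eq)
  have T'm[measurable]: "T' \<in> borel_measurable borel"
    unfolding T'_def by (intro borel_measurable_continuous_on_indicator cT) auto
  have T'0: "0 \<le> T' x" for x using T0[of x] by (auto simp: T'_def split: split_indicator)
  have T'T: "T' x = T x" if "0 < x" "x < a" for x using that by (simp add: T'_def)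
  define I where "I = (\<lambda>t. ennreal (t powr p * T' (m' t) powr (1 / n) * m' t powr (1 - 1 / n)))"
  have Im[measurable]: "I \<in> borel_measurable borel" unfolding I_def by measurable
  have sq: "(A powr q)\<^sup>2 = A powr (2 * q)" for A q :: real
    by (simp add: power2_eq_square powr_add[symmetric])
  define C where "C = (?d - \<gamma>) * ?\<kappa> powr (1 / n)"
  have C0: "0 < C" using \<kappa> \<gamma>d by (simp add: C_def)
  \<comment> \<open>\<open>T\<close> may be unbounded near \<open>a\<close>, that is, for levels
    near 0. Cutting off the levels below \<open>\<delta>\<close> keeps the multiplier bounded, and
    the resulting estimate does not depend on \<open>\<delta>\<close>.\<close>
  have trunc: "ennreal C * (\<integral>\<^sup>+t. I t * indicator {\<delta>..} t \<partial>lborel) \<le> ennreal (sqrt (L * D))" if \<delta>: "0 < \<delta>" for \<delta>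
  proof -
    define l where "l = (\<lambda>t. if \<delta> \<le> t then t powr p * T' (m' t) powr (1 / n) else 0)"
    have lm[measurable]: "l \<in> borel_measurable borel" unfolding l_def by measurable
    have l0: "0 \<le> l t" for t by (simp add: l_def)
    have lz: "l t = 0" if "m t = 0" "\<delta> \<le> t" for t using that \<delta> by (simp add: l_def m'_def T'_def)
    \<comment> \<open>\<open>l\<close> vanishes from the maximum \<open>b\<close> on, and for levels
      above \<open>\<delta>\<close> monotonicity bounds \<open>T (m t)\<close> by
      \<open>T (m \<delta>)\<close>.\<close>
    have lB: "l t \<le> b powr p * T' (m' \<delta>) powr (1 / n)" for t
    proof (cases "\<delta> \<le> t \<and> m t \<noteq> 0")
      case True
      then have t: "\<delta> \<le> t" "0 < m t" using m0[of t] by (auto simp: less_le)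
      have tb: "t < b" using True mb[of t] by (cases "b \<le> t") auto
      have le: "m t \<le> m \<delta>" using t \<delta> by (intro mmono) auto
      have "T (m t) \<le> T (m \<delta>)" using t le ma[OF \<delta>] by (intro Tm)
      then have "T' (m' t) \<le> T' (m' \<delta>)" using t le ma[OF \<delta>] \<delta> by (simp add: m'_def T'T)
      then show ?thesis unfolding l_def using t tb \<delta> p T'0 n1 by (auto intro!: mult_mono powr_mono2)
    next
      case False
      then have "l t = 0" using lz by (cases "\<delta> \<le> t") (auto simp: l_def)
      then show ?thesis by simp
    qed
    have lr: "(l \<longlongrightarrow> l t) (at_right t)" if t: "0 \<le> t" for t
    proof (cases "\<delta> \<le> t \<and> m t \<noteq> 0")
      case False
      have "\<forall>\<^sub>F s in at_right t. l s = l t"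
      proof (cases "\<delta> \<le> t")
        case True
        then have mt: "m t = 0" using False by simp
        have "\<forall>\<^sub>F s in at_right t. t < s" by (simp add: eventually_at_right_less)
        then show ?thesis
        proof eventually_elim
          case (elim s)
          then have "m s = 0" using mmono[of t s] m0[of s] mt t by simp
          then show ?case using lz[of s] lz[of t] mt elim True by simp
        qed
      next
        case False
        then have "\<forall>\<^sub>F s in at_right t. s < \<delta>" by (intro order_tendstoD(2)[OF tendsto_ident_at]) auto
        then show ?thesis by eventually_elim (use False in \<open>simp add: l_def\<close>)
      qed
      then show ?thesis by (rule tendsto_eventually)
    next
      case True
      then have t': "\<delta> \<le> t" "0 < m t" "0 < t" using m0[of t] \<delta> by (auto simp: less_le)
      \<comment> \<open>Right continuity of \<open>m\<close> is read off the equivalence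
        \<open>gal\<close>, together with monotonicity.\<close>
      have mlim: "(m \<longlongrightarrow> m t) (at_right t)"
      proof (rule order_tendstoI)
        fix c assume "c < m t"
        then obtain x where x: "max 0 c < x" "x < m t" using t' dense[of "max 0 c" "m t"] by auto
        then have "t < W x" using gal[of x t] t by simp
        then have "\<forall>\<^sub>F s in at_right t. s < W x" by (intro order_tendstoD(2)[OF tendsto_ident_at])
        moreover have "\<forall>\<^sub>F s in at_right t. t < s" by (simp add: eventually_at_right_less)
        ultimately show "\<forall>\<^sub>F s in at_right t. c < m s"
        proof eventually_elim
          case (elim s)
          then have "x < m s" using gal[of x s] x t by simp
          then show ?case using x by simp
        qed
      next
        fix c assume c: "m t < c"
        have "\<forall>\<^sub>F s in at_right t. t < s" by (simp add: eventually_at_right_less)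
        then show "\<forall>\<^sub>F s in at_right t. m s < c" by eventually_elim (meson c le_less_trans less_imp_le mmono t)
      qed
      have "isCont T (m t)" using cT t' ma[OF t'(3)] by (auto simp: continuous_on_eq_continuous_at)
      then have Tlim: "((\<lambda>s. T (m s)) \<longlongrightarrow> T (m t)) (at_right t)" using mlim by (rule isCont_tendsto_compose)
      have pos: "0 < T (m t)" using t' ma[OF t'(3)] by (intro T0)
      have "((\<lambda>s. s powr p * T (m s) powr (1 / n)) \<longlongrightarrow> t powr p * T (m t) powr (1 / n)) (at_right t)"
        using t' pos by (intro tendsto_intros Tlim) auto
      moreover have "\<forall>\<^sub>F s in at_right t. s powr p * T (m s) powr (1 / n) = l s"
      proof -
        have "\<forall>\<^sub>F s in at_right t. 0 < m s" using mlim t' by (intro order_tendstoD)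
        moreover have "\<forall>\<^sub>F s in at_right t. t < s" by (simp add: eventually_at_right_less)
        ultimately show ?thesis
          by eventually_elim (use t' ma in \<open>simp add: l_def m'_def T'T\<close>)
      qed
      moreover have "l t = t powr p * T (m t) powr (1 / n)" using t' ma[OF t'(3)] by (simp add: l_def m'_def T'T)
      ultimately show ?thesis by (simp add: tendsto_cong)
    qed
    have iso: "(\<integral>\<^sup>+t. ennreal (l t * ((?d - \<gamma>) * ?\<kappa> *
      (measure (wmeas \<gamma>) {x. t < \<bar>w x\<bar>} / ?\<kappa>) powr ((?d - 1 - \<gamma> / 2) / (?d - \<gamma>)))) * indicator {0<..} t \<partial>lborel)
    \<le> (\<integral>\<^sup>+x. ennreal (l \<bar>w x\<bar> * norm (g x) * norm x powr (- \<gamma> / 2)) \<partial>lborel)"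
      using d by (intro weighted_isoperimetric_functional[OF _ \<gamma> der cg supp lm l0 lB lr]) auto
    have "ennreal C * (\<integral>\<^sup>+t. I t * indicator {\<delta>..} t \<partial>lborel) = (\<integral>\<^sup>+t. ennreal C * (I t * indicator {\<delta>..} t) \<partial>lborel)"
      by (rule nn_integral_cmult[symmetric]) measurable
    also have "\<dots> = (\<integral>\<^sup>+t. ennreal (l t * ((?d - \<gamma>) * ?\<kappa> *
      (measure (wmeas \<gamma>) {x. t < \<bar>w x\<bar>} / ?\<kappa>) powr ((?d - 1 - \<gamma> / 2) / (?d - \<gamma>)))) * indicator {0<..} t \<partial>lborel)"
    proof (rule nn_integral_cong)
      fix t :: real
      show "ennreal C * (I t * indicator {\<delta>..} t) = ennreal (l t * ((?d - \<gamma>) * ?\<kappa> *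
        (measure (wmeas \<gamma>) {x. t < \<bar>w x\<bar>} / ?\<kappa>) powr ((?d - 1 - \<gamma> / 2) / (?d - \<gamma>)))) * indicator {0<..} t"
      proof (cases "\<delta> \<le> t")
        case True
        have mt: "measure (wmeas \<gamma>) {x. t < \<bar>w x\<bar>} = m' t" using True \<delta> by (simp add: mU m'_def v_def max_absorb2 del: max_less_iff_conj)
        have "(?d - \<gamma>) * ?\<kappa> * (m' t / ?\<kappa>) powr (1 - 1 / n) = C * m' t powr (1 - 1 / n)"
          using \<kappa> m0 by (simp add: C_def powr_divide powr_diff m'_def)
        then show ?thesis using True \<delta> C0 unfolding mt q I_def l_def
          by (simp add: ennreal_mult[symmetric] mult_ac)
      qed (simp add: l_def)
    qed
    also have "\<dots> \<le> (\<integral>\<^sup>+x. ennreal (l (v x) * norm x powr (- \<gamma> / 2)) * ennreal (norm (g x)) \<partial>lborel)"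
      using iso by (rule order_trans) (auto simp: v_def ennreal_mult[symmetric] l0 mult_ac intro!: nn_integral_mono)
    \<comment> \<open>Cauchy-Schwarz, with the whole weight attached to the multiplier: its square
      is the density of \<open>wmeas \<gamma>\<close>, and the gradient is left unweighted.\<close>
    also have "\<dots> \<le> ennreal (sqrt (L * D))"
    proof (rule ennreal_le_sqrtI)
      have "(\<integral>\<^sup>+x. (ennreal (l (v x) * norm x powr (- \<gamma> / 2)))\<^sup>2 \<partial>lborel) \<le> ennreal L"
      proof -
        have "(\<integral>\<^sup>+x. (ennreal (l (v x) * norm x powr (- \<gamma> / 2)))\<^sup>2 \<partial>lborel) = (\<integral>\<^sup>+x. ennreal ((l (v x))\<^sup>2) * ennreal (norm x powr (- \<gamma>)) \<partial>lborel)"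
        proof (rule nn_integral_cong)
          fix x :: 'a
          have "(norm x powr (- \<gamma> / 2))\<^sup>2 = norm x powr (- \<gamma>)" by (simp add: power2_eq_square powr_add[symmetric])
          then show "(ennreal (l (v x) * norm x powr (- \<gamma> / 2)))\<^sup>2 = ennreal ((l (v x))\<^sup>2) * ennreal (norm x powr (- \<gamma>))"
            using l0 by (simp add: ennreal_power power_mult_distrib ennreal_mult)
        qed
        also have "\<dots> = (\<integral>\<^sup>+x. ennreal ((l (v x))\<^sup>2) \<partial>wmeas \<gamma>)" by (rule nn_integral_wmeas[symmetric]) measurable
        also have "\<dots> = (\<integral>\<^sup>+x. ennreal ((l (v x))\<^sup>2) * indicator {x. 0 < v x} x \<partial>wmeas \<gamma>)"
          using \<delta> v0 by (intro nn_integral_cong) (auto simp: l_def split: split_indicator)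
        also have "\<dots> = (\<integral>\<^sup>+x. ennreal ((l (W x))\<^sup>2) * indicator {0<..<m 0} x \<partial>lborel)"
          by (rule push[symmetric]) measurable
        also have "\<dots> \<le> (\<integral>\<^sup>+x. ennreal (W x powr (2 * p) * T x powr (2 / n)) * indicator {0<..<a} x \<partial>lborel)"
        proof (rule nn_integral_mono)
          fix x
          show "ennreal ((l (W x))\<^sup>2) * indicator {0<..<m 0} x \<le> ennreal (W x powr (2 * p) * T x powr (2 / n)) * indicator {0<..<a} x"
          proof (cases "x \<in> {0<..<a}")
            case True
            then have x: "0 < x" "x < a" by auto
            have "(l (W x))\<^sup>2 \<le> W x powr (2 * p) * T x powr (2 / n)"
            proof (cases "\<delta> \<le> W x \<and> m (W x) \<noteq> 0")
              case True
              \<comment> \<open>Since \<open>W x < W x\<close> is false, \<open>gal\<close> gives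
                \<open>m (W x) \<le> x\<close>. As \<open>T\<close> is monotone, replacing
                \<open>m (W x)\<close> by \<open>x\<close> can only increase the integrand.\<close>
              have mx: "0 < m (W x)" "m (W x) \<le> x" using True m0[of "W x"] gal[of x "W x"] W(3)[of x] x by (auto simp: less_le)
              then have "T (m (W x)) \<le> T x" using x by (intro Tm)
              then have le: "T' (m' (W x)) \<le> T x" using mx x W(3)[of x] by (simp add: m'_def T'T)
              have "(l (W x))\<^sup>2 = W x powr (2 * p) * T' (m' (W x)) powr (2 / n)"
                using True sq[of "W x" p] sq[of "T' (m' (W x))" "1 / n"] by (simp add: l_def power_mult_distrib)
              also have "\<dots> \<le> W x powr (2 * p) * T x powr (2 / n)"
                using le T'0 n1 by (intro mult_left_mono powr_mono2) auto
              finally show ?thesis .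
            next
              case False
              then have "l (W x) = 0" using lz by (cases "\<delta> \<le> W x") (auto simp: l_def)
              then show ?thesis by simp
            qed
            then show ?thesis using x by (simp add: a_def ennreal_leI)
          qed (simp add: a_def)
        qed
        finally show ?thesis unfolding TL L(1) .
      qed
      moreover have "(\<integral>\<^sup>+x. (ennreal (norm (g x)))\<^sup>2 \<partial>lborel) = ennreal D"
        unfolding D(1)[symmetric] by (simp add: ennreal_power)
      ultimately have "(\<integral>\<^sup>+x. (ennreal (l (v x) * norm x powr (- \<gamma> / 2)))\<^sup>2 \<partial>lborel) * (\<integral>\<^sup>+x. (ennreal (norm (g x)))\<^sup>2 \<partial>lborel) \<le> ennreal L * ennreal D"
        by (simp add: mult_right_mono)
      then show "(\<integral>\<^sup>+x. ennreal (l (v x) * norm x powr (- \<gamma> / 2)) * ennreal (norm (g x)) \<partial>lborel)\<^sup>2 \<le> ennreal (L * D)"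
        using L(2) D(2) by (intro order_trans[OF Cauchy_Schwarz_nn_integral]) (auto simp: ennreal_mult)
    qed (use L D in auto)
    finally show ?thesis .
  qed
  have "(\<integral>\<^sup>+t. ennreal (t powr p * T (m t) powr (1 / n) * m t powr (1 - 1 / n)) * indicator {0<..} t \<partial>lborel)
    = (\<integral>\<^sup>+t. I t * indicator (\<Union>k::nat. {1 / Suc k..}) t \<partial>lborel)"
  proof (rule nn_integral_cong)
    fix t :: real
    have U: "(\<Union>k::nat. {1 / real (Suc k)..}) = {0<..}"
    proof (intro equalityI subsetI)
      fix t :: real assume "t \<in> (\<Union>k::nat. {1 / real (Suc k)..})"
      then obtain k :: nat where "1 / real (Suc k) \<le> t" by auto
      with less_le_trans[of 0 "1 / real (Suc k)" t] show "t \<in> {0<..}" by simp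
    next
      fix t :: real assume "t \<in> {0<..}"
      then obtain k :: nat where "1 / Suc k < t" using nat_approx_posE by auto
      then show "t \<in> (\<Union>k::nat. {1 / real (Suc k)..})" by (auto intro!: exI[of _ k])
    qed
    show "ennreal (t powr p * T (m t) powr (1 / n) * m t powr (1 - 1 / n)) * indicator {0<..} t = I t * indicator (\<Union>k::nat. {1 / Suc k..}) t"
      unfolding U I_def using m0[of t] ma[of t]
      by (cases "m t = 0") (auto simp: m'_def T'T split: split_indicator)
  qed
  also have "\<dots> = (SUP k::nat. \<integral>\<^sup>+t. I t * indicator {1 / Suc k..} t \<partial>lborel)"
  proof (rule nn_integral_indicator_UN_incseq)
    show "incseq (\<lambda>k::nat. {1 / real (Suc k)..})"
      unfolding incseq_def by (auto intro!: divide_left_mono elim!: order_trans[rotated])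
  qed auto
  also have "\<dots> \<le> ennreal (sqrt (L * D) / C)"
  proof (rule SUP_least)
    fix k :: nat
    have "ennreal (1 / C) * (ennreal C * (\<integral>\<^sup>+t. I t * indicator {1 / Suc k..} t \<partial>lborel)) \<le> ennreal (1 / C) * ennreal (sqrt (L * D))"
      by (intro mult_left_mono trunc) auto
    then show "(\<integral>\<^sup>+t. I t * indicator {1 / Suc k..} t \<partial>lborel) \<le> ennreal (sqrt (L * D) / C)"
      using C0 L(2) D(2) by (simp add: mult.assoc[symmetric] ennreal_mult[symmetric])
  qed
  finally have fin_le: "(\<integral>\<^sup>+t. ennreal (t powr p * T (m t) powr (1 / n) * m t powr (1 - 1 / n)) * indicator {0<..} t \<partial>lborel) \<le> ennreal (sqrt (L * D) / C)" .
  have \<theta>0: "0 \<le> \<theta>" using p by (simp add: \<theta>)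
  have "ennreal (\<theta> * (p + 1) * n) * (\<integral>\<^sup>+t. ennreal (t powr p * T (m t) powr (1 / n) * m t powr (1 - 1 / n)) * indicator {0<..} t \<partial>lborel)
    \<le> ennreal (\<theta> * (p + 1) * n) * ennreal (sqrt (L * D) / C)" by (intro mult_left_mono fin_le) auto
  also have "\<dots> = ennreal (\<theta> * (p + 1) * n / C * sqrt (L * D))"
    using \<theta>0 p n1 L(2) D(2) C0 by (simp add: ennreal_mult[symmetric])
  finally have "ennreal (\<theta> * (p + 1) * n) * (\<integral>\<^sup>+t. ennreal (t powr p * T (m t) powr (1 / n) * m t powr (1 - 1 / n)) * indicator {0<..} t \<partial>lborel)
    \<le> ennreal (\<theta> * (p + 1) * n / C * sqrt (L * D))" .
  then show ?thesis
    using TK unfolding Wpow C_def by (meson add_left_mono order_trans)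
qed

section \<open>The extremal profile\<close>

text \<open>\<open>y\<close> is the mass of the centred ball of radius \<open>norm x\<close>. Both
  sides are push-forwards to the line; the minus sign turns the rays \<open>{t<..}\<close>, on which
  the two measures are compared, into balls of finite mass.\<close>

lemma nn_integral_wmeas_radial:
  fixes \<phi> :: "real \<Rightarrow> ennreal"
  assumes \<phi>[measurable]: "\<phi> \<in> borel_measurable borel" and g: "\<gamma> < real DIM('a::euclidean_space)"
  shows "(\<integral>\<^sup>+x. \<phi> (norm x) \<partial>(wmeas \<gamma> :: 'a measure))
    = (\<integral>\<^sup>+y. \<phi> ((y / wball TYPE('a) \<gamma>) powr (1 / (real DIM('a) - \<gamma>))) * indicator {0<..} y \<partial>lborel)"
proof -
  let ?\<kappa> = "wball TYPE('a) \<gamma>" and ?e = "real DIM('a) - \<gamma>"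
  have \<kappa>: "0 < ?\<kappa>" using wball_pos[OF g] .
  have e: "0 < ?e" using g by simp
  define \<rho> where "\<rho> = (\<lambda>y. (y / ?\<kappa>) powr (1 / ?e))"
  have [measurable]: "\<rho> \<in> borel_measurable borel" unfolding \<rho>_def by measurable
  define M1 where "M1 = distr (wmeas \<gamma> :: 'a measure) borel (\<lambda>x. - norm x)"
  define M2 where "M2 = distr (density lborel (indicator {0<..})) borel (\<lambda>y. - \<rho> y)"
  have M1: "emeasure M1 {t<..} = ennreal (?\<kappa> * (max 0 (- t)) powr ?e)" for t
  proof -
    have "emeasure M1 {t<..} = emeasure (wmeas \<gamma>) ((\<lambda>x. - norm x) -` {t<..} :: 'a set)"
      unfolding M1_def by (subst emeasure_distr) auto
    also have "(\<lambda>x. - norm x) -` {t<..} = ball (0::'a) (max 0 (- t))" by (auto simp: less_max_iff_disj not_less[symmetric])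
    also have "emeasure (wmeas \<gamma>) \<dots> = ennreal (?\<kappa> * (max 0 (- t)) powr ?e)" by (rule emeasure_wmeas_ball[OF g]) simp
    finally show ?thesis .
  qed
  have M2: "emeasure M2 {t<..} = ennreal (?\<kappa> * (max 0 (- t)) powr ?e)" for t
  proof -
    let ?s = "max 0 (- t)"
    have [measurable]: "(\<lambda>y. - \<rho> y) -` {t<..} \<in> sets borel" by (rule measurable_sets_borel[where M=borel]) auto
    have "emeasure M2 {t<..} = emeasure (density lborel (indicator {0<..})) ((\<lambda>y. - \<rho> y) -` {t<..})"
      unfolding M2_def by (subst emeasure_distr) auto
    also have "\<dots> = (\<integral>\<^sup>+y. indicator {0<..} y * indicator ((\<lambda>y. - \<rho> y) -` {t<..}) y \<partial>lborel)"
      by (rule emeasure_density) auto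
    also have "\<dots> = (\<integral>\<^sup>+y. indicator {0<..<?\<kappa> * ?s powr ?e} y \<partial>lborel)"
    proof (rule nn_integral_cong)
      fix y :: real
      have "t < - \<rho> y \<longleftrightarrow> y < ?\<kappa> * ?s powr ?e" if y: "0 < y"
      proof -
        have r0: "0 < \<rho> y" using y \<kappa> by (simp add: \<rho>_def)
        have yr: "y = ?\<kappa> * \<rho> y powr ?e" using y \<kappa> e by (simp add: \<rho>_def powr_powr)
        have "t < - \<rho> y \<longleftrightarrow> \<rho> y < ?s" using r0 by auto
        also have "\<dots> \<longleftrightarrow> \<rho> y powr ?e < ?s powr ?e"
          using powr_less_mono2[of ?e "\<rho> y" ?s] powr_mono2[of ?e ?s "\<rho> y"] r0 e by (smt (verit) max.cobounded1)
        also have "\<dots> \<longleftrightarrow> ?\<kappa> * \<rho> y powr ?e < ?\<kappa> * ?s powr ?e" using \<kappa> by simp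
        finally show ?thesis using yr by simp
      qed
      then show "indicator {0<..} y * indicator ((\<lambda>y. - \<rho> y) -` {t<..}) y = (indicator {0<..<?\<kappa> * ?s powr ?e} y :: ennreal)"
        by (auto split: split_indicator)
    qed
    also have "\<dots> = ennreal (?\<kappa> * ?s powr ?e)" using \<kappa> by simp
    finally show ?thesis .
  qed
  have "M1 = M2"
    by (rule measure_eqI_lessThan) (auto simp: M1 M2, auto simp: M1_def M2_def)
  have "(\<integral>\<^sup>+x. \<phi> (norm x) \<partial>(wmeas \<gamma> :: 'a measure)) = (\<integral>\<^sup>+t. \<phi> (- t) \<partial>M1)"
    unfolding M1_def by (subst nn_integral_distr) auto
  also have "\<dots> = (\<integral>\<^sup>+y. \<phi> (\<rho> y) * indicator {0<..} y \<partial>lborel)"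
    unfolding \<open>M1 = M2\<close> M2_def by (subst nn_integral_distr) (auto simp: nn_integral_density mult.commute)
  finally show ?thesis by (simp add: \<rho>_def)
qed

text \<open>Links the extended integrals to integrals over \<open>{0..k}\<close>, where the
  fundamental theorem of calculus yields the relation between \<open>K\<close> and \<open>L\<close>
  in \<open>profile_integrals\<close>.\<close>

lemma nn_integral_atLeast_tendsto:
  fixes f :: "real \<Rightarrow> real"
  assumes f: "continuous_on {0..} f" and f0: "\<And>x. 0 \<le> x \<Longrightarrow> 0 \<le> f x" and fm: "f \<in> borel_measurable borel"
    and I: "(\<integral>\<^sup>+x. ennreal (f x) * indicator {0<..} x \<partial>lborel) = ennreal I" "0 \<le> I"
  shows "(\<lambda>k. integral {0..real k} f) \<longlonglongrightarrow> I"
proof -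
  have U: "(\<Union>k::nat. {0..real k}) = {0..}" by (auto intro: real_arch_simple)
  have "incseq (\<lambda>k::nat. \<integral>\<^sup>+x. ennreal (f x) * indicator {0..real k} x \<partial>lborel)"
    by (intro incseq_SucI nn_integral_mono) (auto split: split_indicator)
  from LIMSEQ_SUP[OF this]
  have "(\<lambda>k::nat. \<integral>\<^sup>+x. ennreal (f x) * indicator {0..real k} x \<partial>lborel) \<longlonglongrightarrow>
    (SUP k::nat. \<integral>\<^sup>+x. ennreal (f x) * indicator {0..real k} x \<partial>lborel)" .
  also have "(SUP k::nat. \<integral>\<^sup>+x. ennreal (f x) * indicator {0..real k} x \<partial>lborel) = (\<integral>\<^sup>+x. ennreal (f x) * indicator (\<Union>k::nat. {0..real k}) x \<partial>lborel)"
    using fm by (intro nn_integral_indicator_UN_incseq[symmetric]) (auto simp: incseq_def)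
  also have "\<dots> = (\<integral>\<^sup>+x. ennreal (f x) * indicator {0<..} x \<partial>lborel)"
    unfolding U
  proof (rule nn_integral_cong_AE)
    have "AE x in lborel. x \<noteq> (0::real)" by (rule AE_lborel_singleton)
    then show "AE x in lborel. ennreal (f x) * indicator {0..} x = ennreal (f x) * indicator {0<..} x"
      by eventually_elim (auto split: split_indicator)
  qed
  also have "(\<lambda>k::nat. \<integral>\<^sup>+x. ennreal (f x) * indicator {0..real k} x \<partial>lborel) = (\<lambda>k. ennreal (integral {0..real k} f))"
    using f0 by (intro ext nn_integral_Icc_continuous continuous_on_subset[OF f]) auto
  finally have "(\<lambda>k. ennreal (integral {0..real k} f)) \<longlonglongrightarrow> ennreal I" unfolding I .
  then show ?thesis
    by (rule tendsto_ennrealD) (auto intro!: always_eventually integral_nonneg integrable_continuous_real continuous_on_subset[OF f] f0 simp: I)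
qed

text \<open>\<open>w_star\<close> in the mass variable: for
  \<open>y = \<kappa> * r powr (d - \<gamma>)\<close> one has
  \<open>(y / \<kappa>) powr (2 / n) = r powr (2 - \<gamma>)\<close>.\<close>

definition profile :: "real \<Rightarrow> real \<Rightarrow> real \<Rightarrow> real \<Rightarrow> real" where
  "profile \<kappa> n p y = (1 + (y / \<kappa>) powr (2 / n)) powr (- 1 / (p - 1))"

lemma measurable_profile[measurable]: "profile \<kappa> n p \<in> borel_measurable borel"
  unfolding profile_def by measurable

lemma profile_pos: "0 < profile \<kappa> n p y"
  by (simp add: profile_def add_pos_nonneg less_imp_neq[THEN not_sym])

lemma continuous_on_profile:
  assumes "0 < \<kappa>" "0 < n"
  shows "continuous_on {0..} (profile \<kappa> n p)"
  unfolding profile_def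
  by (intro continuous_on_powr continuous_on_add continuous_on_powr' continuous_intros)
     (use assms in \<open>auto simp: add_pos_nonneg less_imp_neq[THEN not_sym]\<close>)

lemma profile_powr:
  "profile \<kappa> n p y powr q = (1 + (y / \<kappa>) powr (2 / n)) powr (- q / (p - 1))"
  by (simp add: profile_def powr_powr)

lemma profile_le:
  assumes "0 < \<kappa>" "0 < n" "1 < p" "0 < y" "0 \<le> q"
  shows "profile \<kappa> n p y powr q \<le> (y / \<kappa>) powr (- (2 * q / (n * (p - 1))))"
proof -
  have "(1 + (y / \<kappa>) powr (2 / n)) powr (- q / (p - 1)) \<le> ((y / \<kappa>) powr (2 / n)) powr (- q / (p - 1))"
    using assms by (intro powr_mono2') (auto simp: divide_nonpos_pos)
  also have "\<dots> = (y / \<kappa>) powr (- (2 * q / (n * (p - 1))))" by (simp add: powr_powr)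
  finally show ?thesis unfolding profile_powr .
qed

lemma profile_le_1:
  assumes "1 < p" "0 \<le> q"
  shows "profile \<kappa> n p y powr q \<le> 1"
proof -
  have "(1 + (y / \<kappa>) powr (2 / n)) powr (- q / (p - 1)) \<le> 1 powr (- q / (p - 1))"
    using assms by (intro powr_mono2') (auto simp: divide_nonpos_pos)
  then show ?thesis unfolding profile_powr by simp
qed

text \<open>The last identity is the integral of the derivative of \<open>y * profile \<kappa> n p y powr (p + 1)\<close>.\<close>

lemma profile_integrals:
  assumes \<kappa>: "0 < \<kappa>" and n: "0 < n" and p: "1 < p" and np: "n * (p - 1) < 2 * p"
  obtains K P L where "0 < K" "0 < P" "0 < L"
    "(\<integral>\<^sup>+y. ennreal (profile \<kappa> n p y powr (p + 1)) * indicator {0<..} y \<partial>lborel) = ennreal K"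
    "(\<integral>\<^sup>+y. ennreal (profile \<kappa> n p y powr (2 * p)) * indicator {0<..} y \<partial>lborel) = ennreal P"
    "(\<integral>\<^sup>+y. ennreal (profile \<kappa> n p y powr (2 * p) * y powr (2 / n)) * indicator {0<..} y \<partial>lborel) = ennreal L"
    "K = (p + 1) / (p - 1) * (2 / n) * \<kappa> powr (- (2 / n)) * L"
proof -
  let ?V = "profile \<kappa> n p"
  \<comment> \<open>The decay exponent of \<open>?V y powr (p + 1)\<close> at infinity.
    \<open>1 < c\<close> yields integrability and makes the boundary term of the final identity
    vanish.\<close>
  define c where "c = 2 * (p + 1) / (n * (p - 1))"
  have c1: "1 < c" using np n p by (simp add: c_def field_simps)
  have finK: "(\<integral>\<^sup>+y. ennreal (?V y powr (p + 1)) * indicator {0<..} y \<partial>lborel) < \<infinity>"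
  proof -
    have "(\<integral>\<^sup>+y. ennreal (?V y powr (p + 1)) * indicator {0<..} y \<partial>lborel)
      \<le> (\<integral>\<^sup>+y. indicator {0..\<kappa>} y + ennreal ((y / \<kappa>) powr (- c)) * indicator {\<kappa>..} y \<partial>lborel)"
    proof (rule nn_integral_mono)
      fix y
      show "ennreal (?V y powr (p + 1)) * indicator {0<..} y \<le> indicator {0..\<kappa>} y + ennreal ((y / \<kappa>) powr (- c)) * indicator {\<kappa>..} y"
      proof (cases "0 < y \<and> y \<le> \<kappa>")
        case True
        have "ennreal (?V y powr (p + 1)) \<le> 1" using profile_le_1[OF p, of "p + 1"] p by simp
        then show ?thesis using True by (auto intro: order_trans add_increasing2 split: split_indicator)
      next
        case False
        then show ?thesis using profile_le[OF \<kappa> n p, of y "p + 1"] p \<kappa>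
          by (auto simp: c_def split: split_indicator intro!: ennreal_leI)
      qed
    qed
    also have "\<dots> = (\<integral>\<^sup>+y. indicator {0..\<kappa>} y \<partial>lborel) + (\<integral>\<^sup>+y. ennreal ((y / \<kappa>) powr (- c)) * indicator {\<kappa>..} y \<partial>lborel)"
      by (rule nn_integral_add) measurable
    also have "(\<integral>\<^sup>+y. ennreal ((y / \<kappa>) powr (- c)) * indicator {\<kappa>..} y \<partial>lborel) = ennreal (0 - - \<kappa> / (c - 1) * (\<kappa> / \<kappa>) powr (1 - c))"
    proof (rule nn_integral_FTC_atLeast[where F="\<lambda>y. - \<kappa> / (c - 1) * (y / \<kappa>) powr (1 - c)"])
      show "((\<lambda>y. - \<kappa> / (c - 1) * (y / \<kappa>) powr (1 - c)) has_real_derivative (y / \<kappa>) powr (- c)) (at y)" if "\<kappa> \<le> y" for y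
      proof (rule DERIV_cong)
        show "((\<lambda>y. - \<kappa> / (c - 1) * (y / \<kappa>) powr (1 - c)) has_real_derivative - \<kappa> / (c - 1) * ((1 - c) * (y / \<kappa>) powr (1 - c - 1) * (1 / \<kappa>))) (at y)"
          using that \<kappa> by (intro DERIV_cmult DERIV_fun_powr) (auto intro!: derivative_eq_intros)
        have "- \<kappa> / (c - 1) * ((1 - c) * X * (1 / \<kappa>)) = X" for X using c1 \<kappa> by (simp add: field_simps)
        then show "- \<kappa> / (c - 1) * ((1 - c) * (y / \<kappa>) powr (1 - c - 1) * (1 / \<kappa>)) = (y / \<kappa>) powr (- c)" by simp
      qed
      have "((\<lambda>y. (y / \<kappa>) powr (1 - c)) \<longlongrightarrow> 0) at_top"
      proof (rule tendsto_neg_powr)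
        have "filterlim (\<lambda>y. inverse \<kappa> * y) at_top at_top"
          using \<kappa> by (intro filterlim_tendsto_pos_mult_at_top[OF tendsto_const] filterlim_ident) auto
        then show "filterlim (\<lambda>y. y / \<kappa>) at_top at_top" by (simp add: divide_inverse mult.commute)
      qed (use c1 in auto)
      from tendsto_mult_right_zero[OF this] show "((\<lambda>y. - \<kappa> / (c - 1) * (y / \<kappa>) powr (1 - c)) \<longlongrightarrow> 0) at_top" .
    qed auto
    finally show ?thesis using \<kappa> by (auto simp: less_top[symmetric] top_unique)
  qed
  \<comment> \<open>\<open>2 * p\<close> exceeds \<open>p + 1\<close> by \<open>p - 1\<close>, and
    \<open>?V y powr (p - 1)\<close> is
    \<open>1 / (1 + (y / \<kappa>) powr (2 / n))\<close>.\<close>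
  have s_eq: "?V y powr (2 * p) * y powr (2 / n) = \<kappa> powr (2 / n) * ((y / \<kappa>) powr (2 / n) / (1 + (y / \<kappa>) powr (2 / n)) * ?V y powr (p + 1))" if "0 \<le> y" for y
  proof -
    have e: "- (2 * p) / (p - 1) = - (p + 1) / (p - 1) - 1" using p by (simp add: field_simps)
    have "?V y powr (2 * p) = ?V y powr (p + 1) / (1 + (y / \<kappa>) powr (2 / n))"
      unfolding profile_powr e by (simp add: powr_diff add_nonneg_nonneg)
    moreover have "y powr (2 / n) = \<kappa> powr (2 / n) * (y / \<kappa>) powr (2 / n)" using \<kappa> that by (simp add: powr_divide)
    ultimately show ?thesis by simp
  qed
  have finL: "(\<integral>\<^sup>+y. ennreal (?V y powr (2 * p) * y powr (2 / n)) * indicator {0<..} y \<partial>lborel) < \<infinity>"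
  proof -
    have "(\<integral>\<^sup>+y. ennreal (?V y powr (2 * p) * y powr (2 / n)) * indicator {0<..} y \<partial>lborel)
      \<le> (\<integral>\<^sup>+y. ennreal (\<kappa> powr (2 / n)) * (ennreal (?V y powr (p + 1)) * indicator {0<..} y) \<partial>lborel)"
    proof (rule nn_integral_mono)
      fix y
      show "ennreal (?V y powr (2 * p) * y powr (2 / n)) * indicator {0<..} y \<le> ennreal (\<kappa> powr (2 / n)) * (ennreal (?V y powr (p + 1)) * indicator {0<..} y)"
      proof (cases "0 < y")
        case True
        have "(y / \<kappa>) powr (2 / n) / (1 + (y / \<kappa>) powr (2 / n)) * ?V y powr (p + 1) \<le> 1 * ?V y powr (p + 1)"
          by (intro mult_right_mono) (auto simp: divide_le_eq_1 add_pos_nonneg)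
        then have "?V y powr (2 * p) * y powr (2 / n) \<le> \<kappa> powr (2 / n) * (1 * ?V y powr (p + 1))"
          unfolding s_eq[OF less_imp_le[OF True]] by (rule mult_left_mono) simp
        then show ?thesis using True by (simp add: ennreal_mult[symmetric] ennreal_leI)
      qed simp
    qed
    also have "\<dots> = ennreal (\<kappa> powr (2 / n)) * (\<integral>\<^sup>+y. ennreal (?V y powr (p + 1)) * indicator {0<..} y \<partial>lborel)"
      by (rule nn_integral_cmult) measurable
    also have "\<dots> < \<infinity>" using finK by (simp add: ennreal_mult_less_top)
    finally show ?thesis .
  qed
  have finP: "(\<integral>\<^sup>+y. ennreal (?V y powr (2 * p)) * indicator {0<..} y \<partial>lborel) < \<infinity>"
  proof -
    have "(\<integral>\<^sup>+y. ennreal (?V y powr (2 * p)) * indicator {0<..} y \<partial>lborel) \<le> (\<integral>\<^sup>+y. ennreal (?V y powr (p + 1)) * indicator {0<..} y \<partial>lborel)"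
    proof (rule nn_integral_mono)
      fix y
      have "?V y powr (2 * p) = ?V y powr (p + 1) * ?V y powr (p - 1)" by (simp add: powr_add[symmetric])
      also have "\<dots> \<le> ?V y powr (p + 1) * 1" using profile_le_1[OF p, of "p - 1"] p by (intro mult_left_mono) auto
      finally show "ennreal (?V y powr (2 * p)) * indicator {0<..} y \<le> ennreal (?V y powr (p + 1)) * indicator {0<..} y"
        by (auto intro!: mult_right_mono ennreal_leI)
    qed
    then show ?thesis using finK by (rule le_less_trans)
  qed
  have pos: "(\<integral>\<^sup>+y. ennreal (f y) * indicator {0<..} y \<partial>lborel) \<noteq> 0"
    if [measurable]: "f \<in> borel_measurable borel" and "\<And>y. 0 < y \<Longrightarrow> 0 < f y" for f :: "real \<Rightarrow> real"
  proof
    assume "(\<integral>\<^sup>+y. ennreal (f y) * indicator {0<..} y \<partial>lborel) = 0"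
    then have "AE y in lborel. ennreal (f y) * indicator {0<..} y = 0" by (subst (asm) nn_integral_0_iff_AE) auto
    then have "AE y in lborel. y \<notin> {0<..<1::real}"
      by eventually_elim (use that(2) in \<open>force split: split_indicator_asm simp: indicator_def ennreal_eq_0_iff\<close>)
    then have "{0<..<1::real} \<in> null_sets lborel" by (subst AE_iff_null_sets) auto
    then show False by (simp add: null_sets_def)
  qed
  define K where "K = enn2real (\<integral>\<^sup>+y. ennreal (?V y powr (p + 1)) * indicator {0<..} y \<partial>lborel)"
  define P where "P = enn2real (\<integral>\<^sup>+y. ennreal (?V y powr (2 * p)) * indicator {0<..} y \<partial>lborel)"
  define L where "L = enn2real (\<integral>\<^sup>+y. ennreal (?V y powr (2 * p) * y powr (2 / n)) * indicator {0<..} y \<partial>lborel)"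
  have K: "(\<integral>\<^sup>+y. ennreal (?V y powr (p + 1)) * indicator {0<..} y \<partial>lborel) = ennreal K"
    and P: "(\<integral>\<^sup>+y. ennreal (?V y powr (2 * p)) * indicator {0<..} y \<partial>lborel) = ennreal P"
    and L: "(\<integral>\<^sup>+y. ennreal (?V y powr (2 * p) * y powr (2 / n)) * indicator {0<..} y \<partial>lborel) = ennreal L"
    using finK finP finL by (simp_all add: K_def P_def L_def less_top)
  have K0: "0 < K" "0 < P" "0 < L"
    using finK finP finL pos[of "\<lambda>y. ?V y powr (p + 1)"] pos[of "\<lambda>y. ?V y powr (2 * p)"] pos[of "\<lambda>y. ?V y powr (2 * p) * y powr (2 / n)"] profile_pos[of \<kappa> n p]
    unfolding K_def P_def L_def by (simp_all add: enn2real_positive_iff less_imp_neq[THEN not_sym] zero_less_iff_neq_zero)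
  define e where "e = (p + 1) / (p - 1) * (2 / n) * \<kappa> powr (- (2 / n))"
  let ?f1 = "\<lambda>y. ?V y powr (p + 1)" and ?f2 = "\<lambda>y. ?V y powr (2 * p) * y powr (2 / n)"
  have cV: "continuous_on {0..} ?V" using \<kappa> n by (rule continuous_on_profile)
  have c1f: "continuous_on {0..} ?f1" using profile_pos[of \<kappa> n p]
    by (intro continuous_on_powr cV continuous_intros) (auto simp: less_imp_neq[THEN not_sym])
  have c2f: "continuous_on {0..} ?f2" using profile_pos[of \<kappa> n p] n
    by (intro continuous_on_mult continuous_on_powr continuous_on_powr' cV continuous_intros) (auto simp: less_imp_neq[THEN not_sym])
  have ftc: "integral {0..x} ?f1 - e * integral {0..x} ?f2 = x * ?f1 x" if x: "0 \<le> x" for x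
  proof -
    have i1: "?f1 integrable_on {0..x}" by (intro integrable_continuous_real continuous_on_subset[OF c1f]) auto
    have i2: "?f2 integrable_on {0..x}" by (intro integrable_continuous_real continuous_on_subset[OF c2f]) auto
    have "((\<lambda>y. ?f1 y - e * ?f2 y) has_integral (x * ?f1 x - 0 * ?f1 0)) {0..x}"
    proof (rule fundamental_theorem_of_calculus_interior[OF x])
      show "continuous_on {0..x} (\<lambda>y. y * ?f1 y)"
        by (intro continuous_intros continuous_on_subset[OF c1f]) auto
      fix y assume y: "y \<in> {0<..<x}"
      define s where "s = (y / \<kappa>) powr (2 / n)"
      have s0: "0 < s" using y \<kappa> by (simp add: s_def)
      have ds: "((\<lambda>y. (y / \<kappa>) powr (2 / n)) has_real_derivative (2 / n) * s / y) (at y)"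
        using y \<kappa> n unfolding s_def by (auto intro!: derivative_eq_intros simp: powr_diff)
      have "((\<lambda>y. y * (1 + (y / \<kappa>) powr (2 / n)) powr (- (p + 1) / (p - 1))) has_real_derivative
          (1 + s) powr (- (p + 1) / (p - 1)) + y * ((- (p + 1) / (p - 1)) * (1 + s) powr (- (p + 1) / (p - 1) - 1) * ((2 / n) * s / y))) (at y)"
      proof -
        have d: "((\<lambda>y. 1 + (y / \<kappa>) powr (2 / n)) has_real_derivative (2 / n) * s / y) (at y)"
          using DERIV_add[OF DERIV_const ds] by simp
        have pos: "0 < 1 + (y / \<kappa>) powr (2 / n)" by (simp add: add_pos_nonneg)
        from DERIV_mult[OF DERIV_ident DERIV_fun_powr[OF d pos, of "- (p + 1) / (p - 1)"]]
        show ?thesis by (simp add: s_def mult_ac)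
      qed
      also have "(1 + s) powr (- (p + 1) / (p - 1)) + y * ((- (p + 1) / (p - 1)) * (1 + s) powr (- (p + 1) / (p - 1) - 1) * ((2 / n) * s / y))
        = ?f1 y - e * ?f2 y"
      proof -
        have "e * ?f2 y = (p + 1) / (p - 1) * (2 / n) * (\<kappa> powr (- (2 / n)) * \<kappa> powr (2 / n)) * (s / (1 + s) * ?f1 y)"
          unfolding s_eq[OF less_imp_le[of 0 y]] e_def s_def using y by (subst s_eq) auto
        also have "\<kappa> powr (- (2 / n)) * \<kappa> powr (2 / n) = 1" using \<kappa> by (simp add: powr_add[symmetric])
        finally have A: "e * ?f2 y = (p + 1) / (p - 1) * (2 / n) * (s / (1 + s) * ?f1 y)" by simp
        have B: "?f1 y = (1 + s) powr (- (p + 1) / (p - 1))" by (simp add: profile_powr s_def)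
        have C: "(1 + s) powr (- (p + 1) / (p - 1) - 1) = (1 + s) powr (- (p + 1) / (p - 1)) / (1 + s)" using s0 by (simp add: powr_diff)
        have D: "y * (- q1 / q2 * (X / t) * (r * s / y)) = - (q1 / q2 * r * (s / t * X))" for q1 q2 X t r :: real
          using y by simp
        show ?thesis unfolding A B C D by simp
      qed
      finally show "((\<lambda>y. y * ?f1 y) has_vector_derivative ?f1 y - e * ?f2 y) (at y)"
        unfolding profile_powr has_real_derivative_iff_has_vector_derivative[symmetric] .
    qed
    then have "integral {0..x} (\<lambda>y. ?f1 y - e * ?f2 y) = x * ?f1 x" by (simp add: integral_unique)
    moreover have "integral {0..x} (\<lambda>y. ?f1 y - e * ?f2 y) = integral {0..x} ?f1 - e * integral {0..x} ?f2"
      using i1 i2 by (subst integral_diff) (auto intro: integrable_on_mult_right)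
    ultimately show ?thesis by simp
  qed
  have "(\<lambda>k. integral {0..real k} ?f1 - e * integral {0..real k} ?f2) \<longlonglongrightarrow> K - e * L"
    using K0 by (intro tendsto_intros nn_integral_atLeast_tendsto[OF c1f _ _ K] nn_integral_atLeast_tendsto[OF c2f _ _ L]) auto
  then have "(\<lambda>k. real k * ?f1 (real k)) \<longlonglongrightarrow> K - e * L" by (simp add: ftc)
  moreover have "(\<lambda>k. real k * ?f1 (real k)) \<longlonglongrightarrow> 0"
  proof (rule tendsto_sandwich[where f="\<lambda>_. 0" and h="\<lambda>k. \<kappa> powr c * real k powr (1 - c)"])
    show "\<forall>\<^sub>F k in sequentially. real k * ?f1 (real k) \<le> \<kappa> powr c * real k powr (1 - c)"
    proof (rule eventually_sequentiallyI[of 1])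
      fix k :: nat assume "1 \<le> k"
      then have k: "0 < real k" by simp
      have "real k * ?f1 (real k) \<le> real k * (real k / \<kappa>) powr (- c)"
        using profile_le[OF \<kappa> n p k, of "p + 1"] p k by (intro mult_left_mono) (auto simp: c_def)
      also have "\<dots> = \<kappa> powr c * real k powr (1 - c)"
        using k \<kappa> by (simp add: powr_divide powr_diff powr_minus_divide)
      finally show "real k * ?f1 (real k) \<le> \<kappa> powr c * real k powr (1 - c)" .
    qed
    have "(\<lambda>k. real k powr (1 - c)) \<longlonglongrightarrow> 0" using c1 by (intro tendsto_neg_powr filterlim_real_sequentially) auto
    from tendsto_mult_right_zero[OF this] show "(\<lambda>k. \<kappa> powr c * real k powr (1 - c)) \<longlonglongrightarrow> 0" .
  qed auto
  ultimately have "K = e * L" using LIMSEQ_unique by fastforce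
  then show ?thesis using that[OF K0 K P L] by (simp add: e_def)
qed

section \<open>The lower bound\<close>

lemma emeasure_wmeas_open_ne_0:
  fixes U :: "'a::euclidean_space set"
  assumes "open U" "U \<noteq> {}"
  shows "emeasure (wmeas \<gamma>) U \<noteq> 0"
proof
  assume "emeasure (wmeas \<gamma>) U = 0"
  then have "U \<in> null_sets (wmeas \<gamma>)" using assms(1) by (intro null_setsI) auto
  then have "AE x in lborel. x \<in> U \<longrightarrow> ennreal (norm x powr (- \<gamma>)) = 0"
    unfolding wmeas_def by (subst (asm) null_sets_density_iff) auto
  moreover have "AE x in lborel. x \<noteq> (0::'a)" by (rule AE_lborel_singleton)
  ultimately have "AE x in lborel. x \<notin> U" by eventually_elim auto
  then have "U \<in> null_sets lborel" using assms(1) by (subst AE_iff_null_sets) auto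
  then have "negligible U" by (simp add: negligible_iff_null_sets null_sets_completionI)
  then show False using open_not_negligible assms by blast
qed

lemma wmeas_powr_integral:
  fixes w :: "'a::euclidean_space \<Rightarrow> real"
  assumes cw: "continuous_on UNIV w" and supp: "\<And>x. R \<le> norm x \<Longrightarrow> w x = 0" and ne: "w z \<noteq> 0"
    and g: "\<gamma> < real DIM('a)" and q: "0 < q"
  obtains A where "0 < A" "(\<integral>\<^sup>+x. ennreal (\<bar>w x\<bar> powr q) \<partial>wmeas \<gamma>) = ennreal A"
proof -
  have wm[measurable]: "w \<in> borel_measurable borel" using cw by (rule borel_measurable_continuous_onI)
  let ?I = "\<integral>\<^sup>+x. ennreal (\<bar>w x\<bar> powr q) \<partial>wmeas \<gamma>"
  have "bounded (w ` cball 0 \<bar>R\<bar>)"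
    using cw by (intro compact_imp_bounded compact_continuous_image) (auto intro: continuous_on_subset)
  then obtain M where M: "0 < M" "\<And>x. x \<in> cball 0 \<bar>R\<bar> \<Longrightarrow> \<bar>w x\<bar> \<le> M" unfolding bounded_pos by auto
  have "?I \<le> (\<integral>\<^sup>+x. ennreal (M powr q) * indicator (ball (0::'a) \<bar>R\<bar>) x \<partial>wmeas \<gamma>)"
  proof (rule nn_integral_mono)
    fix x :: 'a
    show "ennreal (\<bar>w x\<bar> powr q) \<le> ennreal (M powr q) * indicator (ball 0 \<bar>R\<bar>) x"
    proof (cases "norm x < \<bar>R\<bar>")
      case True
      then show ?thesis using M(2)[of x] q by (auto intro!: ennreal_leI powr_mono2)
    next
      case False
      then have "w x = 0" using supp[of x] abs_ge_self[of R] by auto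
      then show ?thesis by simp
    qed
  qed
  also have "\<dots> = ennreal (M powr q) * emeasure (wmeas \<gamma>) (ball (0::'a) \<bar>R\<bar>)" by (rule nn_integral_cmult_indicator) simp
  also have "\<dots> < \<infinity>" using emeasure_wmeas_ball[OF g, of "\<bar>R\<bar>"] by (simp add: ennreal_mult_less_top)
  finally have fin: "?I < \<infinity>" .
  have "?I \<noteq> 0"
  proof
    assume "?I = 0"
    then have "AE x in wmeas \<gamma>. ennreal (\<bar>w x\<bar> powr q) = 0" by (subst (asm) nn_integral_0_iff_AE) auto
    then have "AE x in wmeas \<gamma>. x \<notin> {x. w x \<noteq> 0}" by eventually_elim auto
    then have "emeasure (wmeas \<gamma>) {x. w x \<noteq> 0} = 0" by (subst (asm) AE_iff_null_sets[symmetric]) auto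
    moreover have "open {x. w x \<noteq> 0}" using cw by (intro open_Collect_neq continuous_intros)
    ultimately show False using emeasure_wmeas_open_ne_0[of "{x. w x \<noteq> 0}" \<gamma>] ne by auto
  qed
  then show ?thesis using fin that[of "enn2real ?I"] by (simp add: enn2real_positive_iff zero_less_iff_neq_zero less_top)
qed

section \<open>The functional in terms of integrals, and its scale invariance\<close>

lemma wnorm_eq:
  fixes w :: "'a::euclidean_space \<Rightarrow> real"
  assumes [measurable]: "w \<in> borel_measurable borel"
    and I: "(\<integral>\<^sup>+x. ennreal (\<bar>w x\<bar> powr q) \<partial>wmeas \<gamma>) = ennreal A" "0 \<le> A"
  shows "wnorm q \<gamma> w = A powr (1 / q)"
proof -
  have "(LINT x|lborel. norm (w x) powr q * norm x powr (- \<gamma>)) = enn2real (\<integral>\<^sup>+x. ennreal (norm (w x) powr q * norm x powr (- \<gamma>)) \<partial>lborel)"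
    by (intro integral_eq_nn_integral) auto
  also have "(\<integral>\<^sup>+x. ennreal (norm (w x) powr q * norm x powr (- \<gamma>)) \<partial>lborel) = ennreal A"
    unfolding I(1)[symmetric] by (subst nn_integral_wmeas) (auto simp: ennreal_mult)
  finally show ?thesis using I(2) by (simp add: wnorm_def)
qed

lemma grad_eq: "GDERIV w x :> D \<Longrightarrow> grad w x = D"
  unfolding grad_def
proof (rule the_equality)
  fix E assume "GDERIV w x :> D" "GDERIV w x :> E"
  then have "(\<lambda>h. h \<bullet> E) = (\<lambda>h. h \<bullet> D)" unfolding gderiv_def by (intro has_derivative_unique)
  then show "E = D" by (metis vector_eq_ldot)
qed

lemma wnorm_grad_eq:
  fixes w :: "'a::euclidean_space \<Rightarrow> real"
  assumes g: "\<And>x. x \<noteq> 0 \<Longrightarrow> GDERIV w x :> g x" and [measurable]: "g \<in> borel_measurable borel"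
    and I: "(\<integral>\<^sup>+x. ennreal ((norm (g x))\<^sup>2) \<partial>lborel) = ennreal D" "0 \<le> D"
  shows "wnorm 2 0 (grad w) = D powr (1 / 2)"
proof -
  \<comment> \<open>At the origin, where \<open>grad w\<close> may be unspecified, both sides vanish
    because \<open>0 powr 0 = 0\<close>.\<close>
  have eq: "norm (grad w x) powr 2 * norm x powr (- 0) = (norm (g x))\<^sup>2 * norm x powr 0" for x
    using grad_eq[OF g, of x] by (cases "x = 0") (auto simp: powr_numeral)
  have "(LINT x|lborel. norm (grad w x) powr 2 * norm x powr (- 0)) = enn2real (\<integral>\<^sup>+x. ennreal ((norm (g x))\<^sup>2 * norm x powr 0) \<partial>lborel)"
    unfolding eq by (intro integral_eq_nn_integral) auto
  also have "(\<integral>\<^sup>+x. ennreal ((norm (g x))\<^sup>2 * norm x powr 0) \<partial>lborel) = ennreal D"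
    unfolding I(1)[symmetric]
  proof (rule nn_integral_cong_AE)
    have "AE x in lborel. x \<noteq> (0::'a)" by (rule AE_lborel_singleton)
    then show "AE x in lborel. ennreal ((norm (g x))\<^sup>2 * norm x powr 0) = ennreal ((norm (g x))\<^sup>2)" by eventually_elim simp
  qed
  finally show ?thesis using I(2) by (simp add: wnorm_def)
qed

lemma Q_functional_eq:
  fixes w :: "'a::euclidean_space \<Rightarrow> real"
  assumes "\<And>x. x \<noteq> 0 \<Longrightarrow> GDERIV w x :> g x" "g \<in> borel_measurable borel" "w \<in> borel_measurable borel"
    and "(\<integral>\<^sup>+x. ennreal ((norm (g x))\<^sup>2) \<partial>lborel) = ennreal D" "0 \<le> D"
    and "(\<integral>\<^sup>+x. ennreal (\<bar>w x\<bar> powr (p + 1)) \<partial>wmeas \<gamma>) = ennreal A" "0 \<le> A"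
    and "(\<integral>\<^sup>+x. ennreal (\<bar>w x\<bar> powr (2 * p)) \<partial>wmeas \<gamma>) = ennreal B" "0 \<le> B"
    and "\<theta> = vartheta DIM('a) p \<gamma>"
  shows "Q_functional p \<gamma> w = D powr (\<theta> / 2) * A powr ((1 - \<theta>) / (p + 1)) / B powr (1 / (2 * p))"
proof -
  have "wnorm 2 0 (grad w) = D powr (1 / 2)" by (rule wnorm_grad_eq) (use assms in auto)
  then show ?thesis
    unfolding Q_functional_def wnorm_eq[OF assms(3,6,7)] wnorm_eq[OF assms(3,8,9)] assms(10)[symmetric]
    by (simp add: powr_powr)
qed

text \<open>The prefactors are those of \<open>dilation_integrals\<close> for
  \<open>c * w (l *\<^sub>R x)\<close>. The powers of \<open>c\<close> cancel because
  \<open>\<theta> + (1 - \<theta>) = 1\<close>; cancellation of the powers of \<open>l\<close> is a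
  linear equation for \<open>\<theta>\<close>, and \<open>vartheta\<close> is its solution.\<close>

lemma quotient_scale_invariant:
  fixes A B D c l d p \<gamma> \<theta> :: real
  assumes pos: "0 < A" "0 < B" "0 < D" "0 < c" "0 < l" and p: "1 < p"
    and den: "0 < d + 2 - 2 * \<gamma> - p * (d - 2)"
    and \<theta>: "\<theta> = ((d - \<gamma>) * (p - 1)) / (p * (d + 2 - 2 * \<gamma> - p * (d - 2)))"
  shows "(c powr 2 * l powr (2 - d) * D) powr (\<theta> / 2) * (c powr (p + 1) * l powr (\<gamma> - d) * A) powr ((1 - \<theta>) / (p + 1))
      / (c powr (2 * p) * l powr (\<gamma> - d) * B) powr (1 / (2 * p))
    = D powr (\<theta> / 2) * A powr ((1 - \<theta>) / (p + 1)) / B powr (1 / (2 * p))"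
proof -
  have c: "c powr (2 * (\<theta> / 2)) * c powr ((p + 1) * ((1 - \<theta>) / (p + 1))) / c powr (2 * p * (1 / (2 * p))) = 1"
    using p pos by (simp add: powr_add[symmetric])
  have e: "(2 - d) * (\<theta> / 2) + (\<gamma> - d) * ((1 - \<theta>) / (p + 1)) - (\<gamma> - d) * (1 / (2 * p)) = 0" (is "?e = 0")
  proof -
    have t: "\<theta> * (p * (d + 2 - 2 * \<gamma> - p * (d - 2))) = (d - \<gamma>) * (p - 1)" unfolding \<theta> using den p by simp
    have t1: "(2 - d) * (\<theta> / 2) * (2 * p * (p + 1)) = (2 - d) * \<theta> * p * (p + 1)" by simp
    have t2: "(\<gamma> - d) * ((1 - \<theta>) / (p + 1)) * (2 * p * (p + 1)) = (\<gamma> - d) * (1 - \<theta>) * (2 * p)" using p by simp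
    have t3: "(\<gamma> - d) * (1 / (2 * p)) * (2 * p * (p + 1)) = (\<gamma> - d) * (p + 1)" using p by simp
    have "?e * (2 * p * (p + 1)) = (2 - d) * \<theta> * p * (p + 1) + (\<gamma> - d) * (1 - \<theta>) * (2 * p) - (\<gamma> - d) * (p + 1)"
      unfolding left_diff_distrib[of "(2 - d) * (\<theta> / 2) + (\<gamma> - d) * ((1 - \<theta>) / (p + 1))"] distrib_right[of "(2 - d) * (\<theta> / 2)"] t1 t2 t3 ..
    also have "\<dots> = \<theta> * (p * (d + 2 - 2 * \<gamma> - p * (d - 2))) - (d - \<gamma>) * (p - 1)" by (simp add: algebra_simps)
    finally show ?thesis using t p by simp
  qed
  have l: "l powr ((2 - d) * (\<theta> / 2)) * l powr ((\<gamma> - d) * ((1 - \<theta>) / (p + 1))) / l powr ((\<gamma> - d) * (1 / (2 * p))) = 1"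
    using e pos unfolding powr_add[symmetric] powr_diff[symmetric] by simp
  have "(c powr 2 * l powr (2 - d) * D) powr (\<theta> / 2) * (c powr (p + 1) * l powr (\<gamma> - d) * A) powr ((1 - \<theta>) / (p + 1))
      / (c powr (2 * p) * l powr (\<gamma> - d) * B) powr (1 / (2 * p))
    = (c powr (2 * (\<theta> / 2)) * c powr ((p + 1) * ((1 - \<theta>) / (p + 1))) / c powr (2 * p * (1 / (2 * p)))) *
      (l powr ((2 - d) * (\<theta> / 2)) * l powr ((\<gamma> - d) * ((1 - \<theta>) / (p + 1))) / l powr ((\<gamma> - d) * (1 / (2 * p)))) *
      (D powr (\<theta> / 2) * A powr ((1 - \<theta>) / (p + 1)) / B powr (1 / (2 * p)))"
    by (simp only: powr_mult powr_powr times_divide_eq_left times_divide_eq_right divide_divide_eq_left mult_ac)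
  then show ?thesis unfolding c l by simp
qed

section \<open>Gradient and integrals of \<open>w_star\<close>\<close>

lemma GDERIV_radial:
  fixes x :: "'a::euclidean_space"
  assumes "x \<noteq> 0" "(\<phi> has_real_derivative D) (at (norm x))"
  shows "GDERIV (\<lambda>x. \<phi> (norm x)) x :> D *\<^sub>R sgn x"
  using has_derivative_compose[OF has_derivative_norm[OF assms(1)] assms(2)[unfolded has_field_derivative_def]]
  by (simp add: gderiv_def)

text \<open>In this form the equality case of Cauchy-Schwarz is visible. For the identity transport
  the multiplier is \<open>w powr p * y powr (1 / n)\<close>, and \<open>y powr (1 / n)\<close> is
  proportional to \<open>norm x powr (1 - \<gamma> / 2)\<close>; times
  \<open>norm x powr (- \<gamma> / 2)\<close> this is a multiple of the norm of
  \<open>grad_star\<close>.\<close>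

definition grad_star :: "real \<Rightarrow> real \<Rightarrow> 'a::euclidean_space \<Rightarrow> 'a" where
  "grad_star p \<gamma> x = (- ((2 - \<gamma>) / (p - 1)) * (norm x powr (1 - \<gamma>) * w_star p \<gamma> x powr p)) *\<^sub>R sgn x"

lemma measurable_w_star[measurable]: "w_star p \<gamma> \<in> borel_measurable (borel :: 'a::euclidean_space measure)"
  unfolding w_star_def by measurable

lemma measurable_grad_star[measurable]: "grad_star p \<gamma> \<in> borel_measurable (borel :: 'a::euclidean_space measure)"
  unfolding grad_star_def sgn_div_norm by measurable

lemma GDERIV_w_star:
  fixes x :: "'a::euclidean_space"
  assumes x: "x \<noteq> 0" and p: "1 < p"
  shows "GDERIV (w_star p \<gamma>) x :> grad_star p \<gamma> x"
proof -
  let ?r = "norm x"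
  have r: "0 < ?r" using x by simp
  have pos: "0 < 1 + ?r powr (2 - \<gamma>)" by (simp add: add_pos_nonneg)
  have "((\<lambda>r. 1 + r powr (2 - \<gamma>)) has_real_derivative 0 + (2 - \<gamma>) * ?r powr (2 - \<gamma> - 1)) (at ?r)"
    using r by (intro DERIV_add DERIV_const has_real_derivative_powr)
  from DERIV_fun_powr[OF this pos, of "- 1 / (p - 1)"]
  have "((\<lambda>r. (1 + r powr (2 - \<gamma>)) powr (- 1 / (p - 1))) has_real_derivative
     (- 1 / (p - 1)) * (1 + ?r powr (2 - \<gamma>)) powr (- 1 / (p - 1) - 1) * ((2 - \<gamma>) * ?r powr (1 - \<gamma>))) (at ?r)"
    by (simp add: algebra_simps)
  from GDERIV_radial[OF x this]
  have "GDERIV (w_star p \<gamma>) x :> ((- 1 / (p - 1)) * (1 + ?r powr (2 - \<gamma>)) powr (- 1 / (p - 1) - 1) * ((2 - \<gamma>) * ?r powr (1 - \<gamma>))) *\<^sub>R sgn x"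
    unfolding w_star_def[abs_def] .
  also have "- 1 / (p - 1) - 1 = - 1 / (p - 1) * p" using p by (simp add: field_simps)
  also have "(1 + ?r powr (2 - \<gamma>)) powr (- 1 / (p - 1) * p) = w_star p \<gamma> x powr p"
    by (simp add: w_star_def powr_powr)
  finally show ?thesis by (simp add: grad_star_def mult_ac)
qed

text \<open>A function of both \<open>norm x powr (2 - \<gamma>)\<close> and \<open>w_star\<close>
  covers the two power integrals and the Dirichlet energy at once.\<close>

lemma nn_integral_w_star:
  fixes h :: "real \<Rightarrow> real \<Rightarrow> ennreal"
  assumes [measurable]: "(\<lambda>(a, b). h a b) \<in> borel_measurable (borel \<Otimes>\<^sub>M borel)"
    and g: "\<gamma> < real DIM('a::euclidean_space)" and g2: "\<gamma> < 2" and n: "n = 2 * (real DIM('a) - \<gamma>) / (2 - \<gamma>)"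
  shows "(\<integral>\<^sup>+x. h (norm x powr (2 - \<gamma>)) (w_star p \<gamma> x) \<partial>(wmeas \<gamma> :: 'a measure))
    = (\<integral>\<^sup>+y. h ((y / wball TYPE('a) \<gamma>) powr (2 / n)) (profile (wball TYPE('a) \<gamma>) n p y) * indicator {0<..} y \<partial>lborel)"
proof -
  let ?\<kappa> = "wball TYPE('a) \<gamma>"
  have "(\<integral>\<^sup>+x. h (norm x powr (2 - \<gamma>)) (w_star p \<gamma> x) \<partial>(wmeas \<gamma> :: 'a measure))
    = (\<integral>\<^sup>+x. (\<lambda>r. (\<lambda>(a, b). h a b) (r powr (2 - \<gamma>), (1 + r powr (2 - \<gamma>)) powr (- 1 / (p - 1)))) (norm x) \<partial>(wmeas \<gamma> :: 'a measure))"
    by (simp add: w_star_def)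
  also have "\<dots> = (\<integral>\<^sup>+y. (\<lambda>r. (\<lambda>(a, b). h a b) (r powr (2 - \<gamma>), (1 + r powr (2 - \<gamma>)) powr (- 1 / (p - 1)))) ((y / ?\<kappa>) powr (1 / (real DIM('a) - \<gamma>))) * indicator {0<..} y \<partial>lborel)"
    by (rule nn_integral_wmeas_radial[OF _ g]) measurable
  also have "\<dots> = (\<integral>\<^sup>+y. h ((y / ?\<kappa>) powr (2 / n)) (profile ?\<kappa> n p y) * indicator {0<..} y \<partial>lborel)"
  proof (rule nn_integral_cong)
    fix y
    have "b / a = 2 / (2 * a / b)" for a b :: real by simp
    then have "(2 - \<gamma>) / (real DIM('a) - \<gamma>) = 2 / n" unfolding n .
    then show "(\<lambda>r. (\<lambda>(a, b). h a b) (r powr (2 - \<gamma>), (1 + r powr (2 - \<gamma>)) powr (- 1 / (p - 1)))) ((y / ?\<kappa>) powr (1 / (real DIM('a) - \<gamma>))) * indicator {0<..} y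
      = h ((y / ?\<kappa>) powr (2 / n)) (profile ?\<kappa> n p y) * indicator {0<..} y"
      by (simp add: powr_powr profile_def)
  qed
  finally show ?thesis .
qed

text \<open>Up to a constant the squared gradient is
  \<open>norm x powr (2 - \<gamma>) * w_star powr (2 * p)\<close> times the weight
  \<open>norm x powr (- \<gamma>)\<close>. The Dirichlet energy is therefore an integral against
  \<open>wmeas \<gamma>\<close>, and a multiple of \<open>L\<close>.\<close>

lemma nn_integral_grad_star:
  assumes g: "\<gamma> < real DIM('a::euclidean_space)" and g2: "\<gamma> < 2" and n: "n = 2 * (real DIM('a) - \<gamma>) / (2 - \<gamma>)"
    and p: "1 < p"
    and L: "(\<integral>\<^sup>+y. ennreal (profile (wball TYPE('a) \<gamma>) n p y powr (2 * p) * y powr (2 / n)) * indicator {0<..} y \<partial>lborel) = ennreal L" "0 \<le> L"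
  shows "(\<integral>\<^sup>+x. ennreal ((norm (grad_star p \<gamma> (x::'a)))\<^sup>2) \<partial>lborel) = ennreal (((2 - \<gamma>) / (p - 1))\<^sup>2 * wball TYPE('a) \<gamma> powr (- (2 / n)) * L)"
proof -
  let ?\<kappa> = "wball TYPE('a) \<gamma>"
  have \<kappa>: "0 < ?\<kappa>" using wball_pos[OF g] .
  define c where "c = ((2 - \<gamma>) / (p - 1))\<^sup>2"
  have "(\<integral>\<^sup>+x. ennreal ((norm (grad_star p \<gamma> (x::'a)))\<^sup>2) \<partial>lborel)
    = (\<integral>\<^sup>+x. ennreal (c * (norm x powr (2 - \<gamma>) * w_star p \<gamma> x powr (2 * p))) * ennreal (norm x powr (- \<gamma>)) \<partial>(lborel :: 'a measure))"
  proof (rule nn_integral_cong_AE)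
    have "AE x in lborel. x \<noteq> (0::'a)" by (rule AE_lborel_singleton)
    then show "AE x in lborel. ennreal ((norm (grad_star p \<gamma> (x::'a)))\<^sup>2) = ennreal (c * (norm x powr (2 - \<gamma>) * w_star p \<gamma> x powr (2 * p))) * ennreal (norm x powr (- \<gamma>))"
    proof eventually_elim
      case (elim x)
      have sq: "(a powr q)\<^sup>2 = a powr (2 * q)" for a q :: real by (simp add: power2_eq_square powr_add[symmetric])
      have "(norm (grad_star p \<gamma> x))\<^sup>2 = c * ((norm x powr (1 - \<gamma>))\<^sup>2 * (w_star p \<gamma> x powr p)\<^sup>2)"
        using elim by (simp add: grad_star_def norm_sgn c_def power_mult_distrib power_divide)
      also have "\<dots> = c * (norm x powr (2 - \<gamma>) * w_star p \<gamma> x powr (2 * p)) * norm x powr (- \<gamma>)"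
        unfolding sq by (simp add: powr_add[symmetric] algebra_simps)
      finally show ?case by (simp add: ennreal_mult c_def)
    qed
  qed
  also have "\<dots> = (\<integral>\<^sup>+x. ennreal (c * (norm x powr (2 - \<gamma>) * w_star p \<gamma> x powr (2 * p))) \<partial>(wmeas \<gamma> :: 'a measure))"
    by (rule nn_integral_wmeas[symmetric]) measurable
  also have "\<dots> = (\<integral>\<^sup>+y. ennreal (c * ((y / ?\<kappa>) powr (2 / n) * profile ?\<kappa> n p y powr (2 * p))) * indicator {0<..} y \<partial>lborel)"
    by (rule nn_integral_w_star[OF _ g g2 n, where h="\<lambda>a b. ennreal (c * (a * b powr (2 * p)))"]) measurable
  also have "\<dots> = (\<integral>\<^sup>+y. ennreal (c * ?\<kappa> powr (- (2 / n))) * (ennreal (profile ?\<kappa> n p y powr (2 * p) * y powr (2 / n)) * indicator {0<..} y) \<partial>lborel)"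
  proof (rule nn_integral_cong)
    fix y :: real
    show "ennreal (c * ((y / ?\<kappa>) powr (2 / n) * profile ?\<kappa> n p y powr (2 * p))) * indicator {0<..} y
      = ennreal (c * ?\<kappa> powr (- (2 / n))) * (ennreal (profile ?\<kappa> n p y powr (2 * p) * y powr (2 / n)) * indicator {0<..} y)"
      using \<kappa> by (cases "0 < y") (auto simp: ennreal_mult[symmetric] c_def powr_divide powr_minus_divide)
  qed
  also have "\<dots> = ennreal (c * ?\<kappa> powr (- (2 / n))) * ennreal L"
    unfolding L(1)[symmetric] by (rule nn_integral_cmult) measurable
  finally show ?thesis using L(2) by (simp add: ennreal_mult[symmetric] c_def)
qed

lemma test_function_gradient:
  fixes w :: "'a::euclidean_space \<Rightarrow> real"
  assumes w: "w \<in> test_functions"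
  obtains g R where "\<And>x. (w has_derivative (\<lambda>h. g x \<bullet> h)) (at x)" "continuous_on UNIV g"
    "\<And>x. R \<le> norm x \<Longrightarrow> w x = 0" "\<And>x. R \<le> norm x \<Longrightarrow> g x = 0"
proof -
  have "C_diff 1 w" using w by (simp add: test_functions_def del: C_diff.simps)
  then have diff: "w differentiable (at x)" and cfd: "continuous_on UNIV (\<lambda>x. frechet_derivative w (at x) v)" for x v
    by (auto simp: differentiable_on_def)
  define g where "g = (\<lambda>x. \<Sum>i\<in>Basis. frechet_derivative w (at x) i *\<^sub>R i)"
  have der: "(w has_derivative (\<lambda>h. g x \<bullet> h)) (at x)" for x
  proof -
    have fd: "(w has_derivative frechet_derivative w (at x)) (at x)" using diff by (simp add: frechet_derivative_works)
    then interpret bounded_linear "frechet_derivative w (at x)" by (rule has_derivative_bounded_linear)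
    have "frechet_derivative w (at x) h = g x \<bullet> h" for h
    proof -
      have "frechet_derivative w (at x) h = frechet_derivative w (at x) (\<Sum>i\<in>Basis. (h \<bullet> i) *\<^sub>R i)" by (simp add: euclidean_representation)
      also have "\<dots> = g x \<bullet> h" unfolding sum scaleR g_def by (simp add: inner_sum_left) (simp add: inner_commute mult.commute)
      finally show ?thesis .
    qed
    then show ?thesis using fd by presburger
  qed
  have cg: "continuous_on UNIV g" unfolding g_def by (intro continuous_intros cfd)
  have "bounded {x. w x \<noteq> 0}"
    using w closure_subset by (auto simp: test_functions_def intro: bounded_subset dest!: compact_imp_bounded)
  then obtain R where R: "\<And>x. w x \<noteq> 0 \<Longrightarrow> norm x \<le> R" unfolding bounded_iff by auto
  \<comment> \<open>Beyond \<open>R\<close> the function is 0 on an open set; enlarging the radius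
    by one places \<open>x\<close> in that set.\<close>
  have g0: "g x = 0" if x: "R + 1 \<le> norm x" for x
  proof -
    have "(w has_derivative (\<lambda>h. 0)) (at x)"
    proof (rule has_derivative_transform_within_open[where f="\<lambda>_. 0"])
      show "open {x. R < norm x}" by (intro open_Collect_less continuous_intros)
      show "0 = w y" if "y \<in> {x. R < norm x}" for y using R[of y] that by fastforce
    qed (use x in auto)
    from has_derivative_unique[OF this der[of x]] have "g x \<bullet> g x = 0" by (metis)
    then show ?thesis by simp
  qed
  have w0: "w x = 0" if "R + 1 \<le> norm x" for x using R[of x] that by force
  show ?thesis using that[OF der cg w0 g0] .
qed

text \<open>The bound on \<open>\<gamma>\<close> is subcriticality in the effective dimension. With
  \<open>1 < p\<close> it forces \<open>\<gamma> < 2\<close>, and then it is equivalent to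
  \<open>n * (p - 1) < 2 * p\<close>, that is, to \<open>p < n / (n - 2)\<close>.\<close>

lemma exponent_facts:
  fixes d p \<gamma> n \<theta> :: real
  assumes d: "3 \<le> d" and \<gamma>: "0 < \<gamma>" and p: "1 < p" and \<gamma>p: "\<gamma> < d - (d - 2) * p"
    and n: "n = 2 * (d - \<gamma>) / (2 - \<gamma>)" and \<theta>: "\<theta> = (p - 1) / (2 * p)"
  shows "\<gamma> < 2" "\<gamma> < d" "0 < n" "n * (p - 1) < 2 * p" "0 < n * \<theta>" "n * \<theta> < 1" "2 / n = (2 - \<gamma>) / (d - \<gamma>)"
    "0 < d + 2 - 2 * \<gamma> - p * (d - 2)"
proof -
  have "(d - 2) * 1 < (d - 2) * p" using d p by (intro mult_strict_left_mono) auto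
  then show g2: "\<gamma> < 2" using \<gamma>p by simp
  then show gd: "\<gamma> < d" using d by simp
  show n0: "0 < n" using g2 gd by (simp add: n)
  have "2 * (d - \<gamma>) * (p - 1) < 2 * p * (2 - \<gamma>)" using \<gamma>p by (simp add: algebra_simps)
  then show np: "n * (p - 1) < 2 * p" using g2 by (simp add: n field_simps)
  then show "n * \<theta> < 1" using p by (simp add: \<theta> field_simps)
  show "0 < n * \<theta>" using n0 p by (simp add: \<theta>)
  have "2 / (2 * a / b) = b / a" for a b :: real by simp
  then show "2 / n = (2 - \<gamma>) / (d - \<gamma>)" unfolding n .
  show "0 < d + 2 - 2 * \<gamma> - p * (d - 2)" using \<gamma>p g2 by (simp add: algebra_simps)
qed

text \<open>The last relation expresses equality in the interpolation inequality: inserting the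
  integrals of \<open>w_star\<close> into the right side of \<open>weighted_interpolation\<close>,
  taken with its own profile, gives \<open>(1 - n * \<theta>) * K + n * \<theta> * K\<close>, which
  is \<open>K\<close>.\<close>

lemma w_star_integrals:
  fixes p \<gamma> n :: real
  assumes d: "3 \<le> DIM('a::euclidean_space)" and \<gamma>: "0 < \<gamma>" and p: "1 < p"
    and \<gamma>p: "\<gamma> < real DIM('a) - (real DIM('a) - 2) * p"
    and n: "n = 2 * (real DIM('a) - \<gamma>) / (2 - \<gamma>)"
  obtains K P D L where "0 < K" "0 < P" "0 < D" "0 < L"
    "(\<integral>\<^sup>+x. ennreal (\<bar>w_star p \<gamma> x\<bar> powr (p + 1)) \<partial>(wmeas \<gamma> :: 'a measure)) = ennreal K"
    "(\<integral>\<^sup>+x. ennreal (\<bar>w_star p \<gamma> x\<bar> powr (2 * p)) \<partial>(wmeas \<gamma> :: 'a measure)) = ennreal P"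
    "(\<integral>\<^sup>+x. ennreal ((norm (grad_star p \<gamma> (x::'a)))\<^sup>2) \<partial>lborel) = ennreal D"
    "(\<integral>\<^sup>+y. ennreal (profile (wball TYPE('a) \<gamma>) n p y powr (p + 1)) * indicator {0<..} y \<partial>lborel) = ennreal K"
    "(\<integral>\<^sup>+y. ennreal (profile (wball TYPE('a) \<gamma>) n p y powr (2 * p)) * indicator {0<..} y \<partial>lborel) = ennreal P"
    "(\<integral>\<^sup>+y. ennreal (profile (wball TYPE('a) \<gamma>) n p y powr (2 * p) * y powr (2 / n)) * indicator {0<..} y \<partial>lborel) = ennreal L"
    "K = (p + 1) / ((real DIM('a) - \<gamma>) * wball TYPE('a) \<gamma> powr (1 / n)) * sqrt (L * D)"
proof -
  let ?\<kappa> = "wball TYPE('a) \<gamma>" and ?d = "real DIM('a)"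
  have d3: "3 \<le> ?d" using d by simp
  note e = exponent_facts[OF d3 \<gamma> p \<gamma>p n refl]
  have \<kappa>: "0 < ?\<kappa>" using wball_pos[OF e(2)] .
  obtain K P L where K: "0 < K" "0 < P" "0 < L"
    "(\<integral>\<^sup>+y. ennreal (profile ?\<kappa> n p y powr (p + 1)) * indicator {0<..} y \<partial>lborel) = ennreal K"
    "(\<integral>\<^sup>+y. ennreal (profile ?\<kappa> n p y powr (2 * p)) * indicator {0<..} y \<partial>lborel) = ennreal P"
    "(\<integral>\<^sup>+y. ennreal (profile ?\<kappa> n p y powr (2 * p) * y powr (2 / n)) * indicator {0<..} y \<partial>lborel) = ennreal L"
    "K = (p + 1) / (p - 1) * (2 / n) * ?\<kappa> powr (- (2 / n)) * L"
    by (rule profile_integrals[OF \<kappa> e(3) p e(4)])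
  have w: "(\<integral>\<^sup>+x. ennreal (\<bar>w_star p \<gamma> x\<bar> powr q) \<partial>(wmeas \<gamma> :: 'a measure))
    = (\<integral>\<^sup>+y. ennreal (profile ?\<kappa> n p y powr q) * indicator {0<..} y \<partial>lborel)" for q
  proof -
    have "(\<integral>\<^sup>+x. ennreal (\<bar>w_star p \<gamma> x\<bar> powr q) \<partial>(wmeas \<gamma> :: 'a measure))
      = (\<integral>\<^sup>+y. ennreal (\<bar>profile ?\<kappa> n p y\<bar> powr q) * indicator {0<..} y \<partial>lborel)"
      by (rule nn_integral_w_star[OF _ e(2,1) n, where h="\<lambda>a b. ennreal (\<bar>b\<bar> powr q)"]) measurable
    then show ?thesis using profile_pos[of ?\<kappa> n p] by (simp add: abs_of_pos)
  qed
  define D where "D = ((2 - \<gamma>) / (p - 1))\<^sup>2 * ?\<kappa> powr (- (2 / n)) * L"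
  have D: "(\<integral>\<^sup>+x. ennreal ((norm (grad_star p \<gamma> (x::'a)))\<^sup>2) \<partial>lborel) = ennreal D"
    unfolding D_def using K(3) by (intro nn_integral_grad_star[OF e(2,1) n p K(6)]) simp
  have D0: "0 < D" using K(3) \<kappa> p e(1) by (simp add: D_def)
  \<comment> \<open>\<open>D\<close> is a multiple of \<open>L\<close>, so \<open>L * D\<close> is a
    square and the root disappears. Then \<open>2 / n = (2 - \<gamma>) / (d - \<gamma>)\<close>
    reduces the claim to the identity of \<open>profile_integrals\<close>.\<close>
  have rel: "K = (p + 1) / ((?d - \<gamma>) * ?\<kappa> powr (1 / n)) * sqrt (L * D)"
  proof -
    define k where "k = ?\<kappa> powr (- (1 / n))"
    have k2: "?\<kappa> powr (- (2 / n)) = k\<^sup>2" by (simp add: k_def power2_eq_square powr_add[symmetric])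
    have k1: "x / (y * ?\<kappa> powr (1 / n)) = x / y * k" for x y by (simp add: k_def powr_minus_divide)
    have "L * D = ((2 - \<gamma>) / (p - 1) * k * L)\<^sup>2" unfolding D_def k2 by (simp add: power2_eq_square)
    then have "sqrt (L * D) = (2 - \<gamma>) / (p - 1) * k * L" using K(3) p e(1) by (simp add: k_def)
    then have "(p + 1) / ((?d - \<gamma>) * ?\<kappa> powr (1 / n)) * sqrt (L * D) = (p + 1) / (p - 1) * ((2 - \<gamma>) / (?d - \<gamma>)) * k\<^sup>2 * L"
      unfolding k1 by (simp add: power2_eq_square mult_ac)
    then show ?thesis unfolding K(7) k2 unfolding e(7) by simp
  qed
  show ?thesis
    by (rule that[OF K(1,2) D0 K(3) _ _ D K(4,5,6) rel]) (simp_all add: w K)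
qed

lemma w_star_integral_values:
  fixes p \<gamma> :: real
  assumes "3 \<le> DIM('a::euclidean_space)" "0 < \<gamma>" "1 < p" "\<gamma> < real DIM('a) - (real DIM('a) - 2) * p"
  obtains K P D where "0 < K" "0 < P" "0 < D"
    "(\<integral>\<^sup>+x. ennreal (\<bar>w_star p \<gamma> x\<bar> powr (p + 1)) \<partial>(wmeas \<gamma> :: 'a measure)) = ennreal K"
    "(\<integral>\<^sup>+x. ennreal (\<bar>w_star p \<gamma> x\<bar> powr (2 * p)) \<partial>(wmeas \<gamma> :: 'a measure)) = ennreal P"
    "(\<integral>\<^sup>+x. ennreal ((norm (grad_star p \<gamma> (x::'a)))\<^sup>2) \<partial>lborel) = ennreal D"
proof (rule w_star_integrals[OF assms refl])
  fix K P D L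
  assume "0 < K" "0 < P" "0 < D"
    "(\<integral>\<^sup>+x. ennreal (\<bar>w_star p \<gamma> x\<bar> powr (p + 1)) \<partial>(wmeas \<gamma> :: 'a measure)) = ennreal K"
    "(\<integral>\<^sup>+x. ennreal (\<bar>w_star p \<gamma> x\<bar> powr (2 * p)) \<partial>(wmeas \<gamma> :: 'a measure)) = ennreal P"
    "(\<integral>\<^sup>+x. ennreal ((norm (grad_star p \<gamma> (x::'a)))\<^sup>2) \<partial>lborel) = ennreal D"
  from that[OF this] show thesis .
qed

section \<open>Comparison of a test function with \<open>w_star\<close>\<close>

text \<open>As both power integrals agree with those of \<open>w_star\<close>, the interpolation
  inequality reduces to \<open>K \<le> C * sqrt (L * Dw)\<close>, while \<open>w_star\<close>
  satisfies \<open>K = C * sqrt (L * D')\<close>. Only the two energies remain to be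
  compared.\<close>

lemma normalized_lower_bound:
  fixes w :: "'a::euclidean_space \<Rightarrow> real" and g :: "'a \<Rightarrow> 'a" and p \<gamma> D K P Dw :: real
  assumes d: "3 \<le> DIM('a)" and \<gamma>: "0 < \<gamma>" and p: "1 < p"
    and \<gamma>p: "\<gamma> < real DIM('a) - (real DIM('a) - 2) * p"
    and der: "\<And>x. (w has_derivative (\<lambda>h. g x \<bullet> h)) (at x)" and cg: "continuous_on UNIV g"
    and supp: "\<And>x. R \<le> norm x \<Longrightarrow> w x = 0" "\<And>x. R \<le> norm x \<Longrightarrow> g x = 0" and ne: "w z \<noteq> 0"
    and eqK: "(\<integral>\<^sup>+x. ennreal (\<bar>w x\<bar> powr (p + 1)) \<partial>wmeas \<gamma>) = (\<integral>\<^sup>+x. ennreal (\<bar>w_star p \<gamma> x\<bar> powr (p + 1)) \<partial>(wmeas \<gamma> :: 'a measure))"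
    and eqP: "(\<integral>\<^sup>+x. ennreal (\<bar>w x\<bar> powr (2 * p)) \<partial>wmeas \<gamma>) = (\<integral>\<^sup>+x. ennreal (\<bar>w_star p \<gamma> x\<bar> powr (2 * p)) \<partial>(wmeas \<gamma> :: 'a measure))"
    and D: "(\<integral>\<^sup>+x. ennreal ((norm (grad_star p \<gamma> (x::'a)))\<^sup>2) \<partial>lborel) = ennreal D"
    and Dw: "(\<integral>\<^sup>+x. ennreal ((norm (g x))\<^sup>2) \<partial>lborel) = ennreal Dw" "0 \<le> Dw"
  shows "D \<le> Dw"
proof -
  let ?\<kappa> = "wball TYPE('a) \<gamma>" and ?d = "real DIM('a)"
  define n where "n = 2 * (?d - \<gamma>) / (2 - \<gamma>)"
  define \<theta> where "\<theta> = (p - 1) / (2 * p)"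
  have d3: "3 \<le> ?d" using d by simp
  note e = exponent_facts[OF d3 \<gamma> p \<gamma>p n_def \<theta>_def]
  have \<kappa>: "0 < ?\<kappa>" using wball_pos[OF e(2)] .
  obtain K P D' L where K: "0 < K" "0 < P" "0 < D'" "0 < L"
    "(\<integral>\<^sup>+x. ennreal (\<bar>w_star p \<gamma> x\<bar> powr (p + 1)) \<partial>(wmeas \<gamma> :: 'a measure)) = ennreal K"
    "(\<integral>\<^sup>+x. ennreal (\<bar>w_star p \<gamma> x\<bar> powr (2 * p)) \<partial>(wmeas \<gamma> :: 'a measure)) = ennreal P"
    "(\<integral>\<^sup>+x. ennreal ((norm (grad_star p \<gamma> (x::'a)))\<^sup>2) \<partial>lborel) = ennreal D'"
    "(\<integral>\<^sup>+y. ennreal (profile ?\<kappa> n p y powr (p + 1)) * indicator {0<..} y \<partial>lborel) = ennreal K"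
    "(\<integral>\<^sup>+y. ennreal (profile ?\<kappa> n p y powr (2 * p)) * indicator {0<..} y \<partial>lborel) = ennreal P"
    "(\<integral>\<^sup>+y. ennreal (profile ?\<kappa> n p y powr (2 * p) * y powr (2 / n)) * indicator {0<..} y \<partial>lborel) = ennreal L"
    "K = (p + 1) / ((?d - \<gamma>) * ?\<kappa> powr (1 / n)) * sqrt (L * D')"
    by (rule w_star_integrals[OF d \<gamma> p \<gamma>p n_def])
  define C where "C = (p + 1) / ((?d - \<gamma>) * ?\<kappa> powr (1 / n))"
  have C0: "0 < C" using p e(2) \<kappa> by (simp add: C_def)
  have nn1: "0 \<le> (1 - n * \<theta>) * K" using K(1) e(6) by simp
  have nn2: "0 \<le> n * \<theta> * (C * sqrt (L * Dw))"
    by (rule mult_nonneg_nonneg[OF less_imp_le[OF e(5)]]) (use C0 K(4) Dw(2) in simp)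
  have "(\<integral>\<^sup>+y. ennreal (profile ?\<kappa> n p y powr (p + 1)) * indicator {0<..} y \<partial>lborel)
    \<le> ennreal (1 - n * \<theta>) * (\<integral>\<^sup>+x. ennreal (\<bar>w x\<bar> powr (p + 1)) \<partial>wmeas \<gamma>)
      + ennreal (\<theta> * (p + 1) * n / ((?d - \<gamma>) * ?\<kappa> powr (1 / n)) * sqrt (L * Dw))"
  proof (rule weighted_interpolation[OF d \<gamma> e(1) n_def p \<theta>_def _ der cg supp ne _ _ _ _ K(10) _ Dw])
    show "continuous_on {0..} (profile ?\<kappa> n p)" using \<kappa> e(3) by (rule continuous_on_profile)
    show "(\<integral>\<^sup>+x. ennreal (\<bar>w x\<bar> powr (2 * p)) \<partial>wmeas \<gamma>) = (\<integral>\<^sup>+y. ennreal (profile ?\<kappa> n p y powr (2 * p)) * indicator {0<..} y \<partial>lborel)"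
      unfolding eqP K(6,9) ..
  qed (use K(4) e(6) profile_pos in auto)
  also have "\<dots> = ennreal ((1 - n * \<theta>) * K) + ennreal (n * \<theta> * (C * sqrt (L * Dw)))"
    unfolding eqK K(5) using K(1) e(6) by (simp add: ennreal_mult C_def mult_ac)
  also have "\<dots> = ennreal ((1 - n * \<theta>) * K + n * \<theta> * (C * sqrt (L * Dw)))"
    by (rule ennreal_plus[symmetric, OF nn1 nn2])
  finally have "K \<le> (1 - n * \<theta>) * K + n * \<theta> * (C * sqrt (L * Dw))"
    unfolding K(8) using add_nonneg_nonneg[OF nn1 nn2] by (simp only: ennreal_le_iff)
  then have "n * \<theta> * K \<le> n * \<theta> * (C * sqrt (L * Dw))" by (simp add: algebra_simps)
  then have "K \<le> C * sqrt (L * Dw)" using e(5) by (rule mult_left_le_imp_le)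
  then have "C * sqrt (L * D') \<le> C * sqrt (L * Dw)" using K(11) by (simp only: C_def)
  then have "D' \<le> Dw" using C0 K(4) by simp
  moreover have "D = D' \<or> D \<le> 0" using D K(3) unfolding K(7) by (cases "0 \<le> D") auto
  ultimately show ?thesis using Dw(2) by auto
qed

lemma dilation_integrals:
  fixes w :: "'a::euclidean_space \<Rightarrow> real" and g :: "'a \<Rightarrow> 'a" and c l :: real
  assumes [measurable]: "w \<in> borel_measurable borel" "g \<in> borel_measurable borel" and c: "0 < c" and l: "0 < l"
  shows "(\<integral>\<^sup>+x. ennreal (\<bar>w x\<bar> powr q) \<partial>wmeas \<gamma>) = ennreal A \<Longrightarrow> 0 \<le> A \<Longrightarrow>
      (\<integral>\<^sup>+x. ennreal (\<bar>c * w (l *\<^sub>R x)\<bar> powr q) \<partial>wmeas \<gamma>) = ennreal (c powr q * l powr (\<gamma> - real DIM('a)) * A)"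
    and "(\<integral>\<^sup>+x. ennreal ((norm (g x))\<^sup>2) \<partial>lborel) = ennreal D \<Longrightarrow> 0 \<le> D \<Longrightarrow>
      (\<integral>\<^sup>+x. ennreal ((norm ((c * l) *\<^sub>R g (l *\<^sub>R x)))\<^sup>2) \<partial>lborel) = ennreal (c powr 2 * l powr (2 - real DIM('a)) * D)"
proof -
  have ld: "ennreal (l powr (- real DIM('a))) * ennreal (l ^ DIM('a)) = 1"
    using l by (simp add: ennreal_mult[symmetric] powr_realpow[symmetric] powr_add[symmetric])
  show "(\<integral>\<^sup>+x. ennreal (\<bar>c * w (l *\<^sub>R x)\<bar> powr q) \<partial>wmeas \<gamma>) = ennreal (c powr q * l powr (\<gamma> - real DIM('a)) * A)"
    if A: "(\<integral>\<^sup>+x. ennreal (\<bar>w x\<bar> powr q) \<partial>wmeas \<gamma>) = ennreal A" "0 \<le> A"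
  proof -
    have sc: "(\<integral>\<^sup>+x. ennreal (\<bar>w x\<bar> powr q) * ennreal (norm x powr (- \<gamma>)) \<partial>lborel)
      = ennreal (l ^ DIM('a)) * (\<integral>\<^sup>+x. ennreal (\<bar>w (l *\<^sub>R x)\<bar> powr q) * ennreal (norm (l *\<^sub>R x) powr (- \<gamma>)) \<partial>lborel)"
      by (rule nn_integral_scale[OF _ l]) measurable
    have "(\<integral>\<^sup>+x. ennreal (\<bar>c * w (l *\<^sub>R x)\<bar> powr q) \<partial>wmeas \<gamma>)
      = (\<integral>\<^sup>+x. ennreal (\<bar>c * w (l *\<^sub>R x)\<bar> powr q) * ennreal (norm x powr (- \<gamma>)) \<partial>lborel)"
      by (rule nn_integral_wmeas) measurable
    also have "\<dots> = (\<integral>\<^sup>+x. ennreal (c powr q * l powr \<gamma>) * (ennreal (\<bar>w (l *\<^sub>R x)\<bar> powr q) * ennreal (norm (l *\<^sub>R x) powr (- \<gamma>))) \<partial>lborel)"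
      using c l by (intro nn_integral_cong) (auto simp: ennreal_mult[symmetric] abs_mult powr_mult powr_minus field_simps)
    also have "\<dots> = ennreal (c powr q * l powr \<gamma>) * (\<integral>\<^sup>+x. ennreal (\<bar>w (l *\<^sub>R x)\<bar> powr q) * ennreal (norm (l *\<^sub>R x) powr (- \<gamma>)) \<partial>lborel)"
      by (rule nn_integral_cmult) measurable
    also have "\<dots> = ennreal (c powr q * l powr \<gamma>) * ((ennreal (l powr (- real DIM('a))) * ennreal (l ^ DIM('a))) * (\<integral>\<^sup>+x. ennreal (\<bar>w (l *\<^sub>R x)\<bar> powr q) * ennreal (norm (l *\<^sub>R x) powr (- \<gamma>)) \<partial>lborel))"
      unfolding ld by simp
    also have "\<dots> = ennreal (c powr q * l powr \<gamma>) * (ennreal (l powr (- real DIM('a))) * ennreal A)"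
      unfolding A(1)[symmetric] by (subst nn_integral_wmeas) (auto simp: sc mult.assoc)
    also have "\<dots> = ennreal (c powr q * l powr (\<gamma> - real DIM('a)) * A)"
      using c l A(2) by (simp add: ennreal_mult[symmetric] powr_diff powr_minus divide_inverse mult_ac)
    finally show ?thesis .
  qed
  show "(\<integral>\<^sup>+x. ennreal ((norm ((c * l) *\<^sub>R g (l *\<^sub>R x)))\<^sup>2) \<partial>lborel) = ennreal (c powr 2 * l powr (2 - real DIM('a)) * D)"
    if D: "(\<integral>\<^sup>+x. ennreal ((norm (g x))\<^sup>2) \<partial>lborel) = ennreal D" "0 \<le> D"
  proof -
    have sc: "(\<integral>\<^sup>+x. ennreal ((norm (g x))\<^sup>2) \<partial>lborel) = ennreal (l ^ DIM('a)) * (\<integral>\<^sup>+x. ennreal ((norm (g (l *\<^sub>R x)))\<^sup>2) \<partial>lborel)"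
      by (rule nn_integral_scale[OF _ l]) measurable
    have "(\<integral>\<^sup>+x. ennreal ((norm ((c * l) *\<^sub>R g (l *\<^sub>R x)))\<^sup>2) \<partial>lborel) = (\<integral>\<^sup>+x. ennreal (c\<^sup>2 * l\<^sup>2) * ennreal ((norm (g (l *\<^sub>R x)))\<^sup>2) \<partial>lborel)"
      using c l by (intro nn_integral_cong) (auto simp: ennreal_mult[symmetric] power_mult_distrib)
    also have "\<dots> = ennreal (c\<^sup>2 * l\<^sup>2) * (\<integral>\<^sup>+x. ennreal ((norm (g (l *\<^sub>R x)))\<^sup>2) \<partial>lborel)"
      by (rule nn_integral_cmult) measurable
    also have "\<dots> = ennreal (c\<^sup>2 * l\<^sup>2) * ((ennreal (l powr (- real DIM('a))) * ennreal (l ^ DIM('a))) * (\<integral>\<^sup>+x. ennreal ((norm (g (l *\<^sub>R x)))\<^sup>2) \<partial>lborel))"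
      unfolding ld by simp
    also have "\<dots> = ennreal (c\<^sup>2 * l\<^sup>2) * (ennreal (l powr (- real DIM('a))) * ennreal D)"
      unfolding D(1)[symmetric] sc by (simp add: mult.assoc)
    also have "\<dots> = ennreal (c powr 2 * l powr (2 - real DIM('a)) * D)"
      using c l D(2) by (simp add: ennreal_mult[symmetric] powr_diff powr_minus divide_inverse powr_numeral mult_ac)
    finally show ?thesis .
  qed
qed

text \<open>Multiplication by \<open>c\<close> and dilation by \<open>l\<close> leave the quotient
  unchanged. These two parameters are enough to match the two power integrals of \<open>w\<close>
  with those of \<open>w_star\<close>.\<close>

theorem Q_functional_lower_bound:
  fixes w :: "'a::euclidean_space \<Rightarrow> real"
  assumes d: "3 \<le> DIM('a)" and \<gamma>: "0 < \<gamma>" and p: "1 < p"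
    and \<gamma>p: "\<gamma> < real DIM('a) - (real DIM('a) - 2) * p"
    and w: "w \<in> test_functions" and ne: "w \<noteq> (\<lambda>_. 0)"
  shows "Q_functional p \<gamma> (w_star p \<gamma> :: 'a \<Rightarrow> real) \<le> Q_functional p \<gamma> w"
proof -
  let ?d = "real DIM('a)"
  define \<theta> where "\<theta> = vartheta DIM('a) p \<gamma>"
  have d3: "3 \<le> ?d" using d by simp
  note e = exponent_facts[OF d3 \<gamma> p \<gamma>p refl refl]
  have \<theta>0: "0 \<le> \<theta>" using e(2,8) p by (simp add: \<theta>_def vartheta_def)
  obtain K P D where K: "0 < K" "0 < P" "0 < D"
    "(\<integral>\<^sup>+x. ennreal (\<bar>w_star p \<gamma> x\<bar> powr (p + 1)) \<partial>(wmeas \<gamma> :: 'a measure)) = ennreal K"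
    "(\<integral>\<^sup>+x. ennreal (\<bar>w_star p \<gamma> x\<bar> powr (2 * p)) \<partial>(wmeas \<gamma> :: 'a measure)) = ennreal P"
    "(\<integral>\<^sup>+x. ennreal ((norm (grad_star p \<gamma> (x::'a)))\<^sup>2) \<partial>lborel) = ennreal D"
    by (rule w_star_integral_values[OF d \<gamma> p \<gamma>p])
  have Qs: "Q_functional p \<gamma> (w_star p \<gamma> :: 'a \<Rightarrow> real) = D powr (\<theta> / 2) * K powr ((1 - \<theta>) / (p + 1)) / P powr (1 / (2 * p))"
    using K by (intro Q_functional_eq[where g="grad_star p \<gamma>"] GDERIV_w_star p) (auto simp: \<theta>_def)
  obtain g R where der: "\<And>x. (w has_derivative (\<lambda>h. g x \<bullet> h)) (at x)" and cg: "continuous_on UNIV g"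
    and supp: "\<And>x. R \<le> norm x \<Longrightarrow> w x = 0" "\<And>x. R \<le> norm x \<Longrightarrow> g x = 0"
    by (rule test_function_gradient[OF w], rule that)
  obtain z where z: "w z \<noteq> 0" using ne by auto
  have cw: "continuous_on UNIV w" using der has_derivative_continuous by (intro continuous_at_imp_continuous_on) blast
  have wm[measurable]: "w \<in> borel_measurable borel" using cw by (rule borel_measurable_continuous_onI)
  have gm[measurable]: "g \<in> borel_measurable borel" using cg by (rule borel_measurable_continuous_onI)
  obtain A where A: "0 < A" "(\<integral>\<^sup>+x. ennreal (\<bar>w x\<bar> powr (p + 1)) \<partial>wmeas \<gamma>) = ennreal A"
    by (rule wmeas_powr_integral[OF cw supp(1) z e(2), where q="p + 1"]) (use p in auto)
  obtain B where B: "0 < B" "(\<integral>\<^sup>+x. ennreal (\<bar>w x\<bar> powr (2 * p)) \<partial>wmeas \<gamma>) = ennreal B"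
    by (rule wmeas_powr_integral[OF cw supp(1) z e(2), where q="2 * p"]) (use p in auto)
  obtain Dw where Dw: "0 \<le> Dw" "(\<integral>\<^sup>+x. ennreal ((norm (g x))\<^sup>2) \<partial>lborel) = ennreal Dw"
  proof -
    have "bounded (g ` cball 0 \<bar>R\<bar>)"
      using cg by (intro compact_imp_bounded compact_continuous_image) (auto intro: continuous_on_subset)
    then obtain M where M: "0 < M" "\<And>x. x \<in> cball 0 \<bar>R\<bar> \<Longrightarrow> norm (g x) \<le> M" unfolding bounded_pos by auto
    have "(\<integral>\<^sup>+x. ennreal ((norm (g x))\<^sup>2) \<partial>lborel) \<le> (\<integral>\<^sup>+x. ennreal (M\<^sup>2) * indicator (ball (0::'a) \<bar>R\<bar>) x \<partial>lborel)"
    proof (rule nn_integral_mono)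
      fix x :: 'a
      show "ennreal ((norm (g x))\<^sup>2) \<le> ennreal (M\<^sup>2) * indicator (ball 0 \<bar>R\<bar>) x"
      proof (cases "norm x < \<bar>R\<bar>")
        case True
        then show ?thesis using M(2)[of x] by (auto intro!: ennreal_leI power_mono)
      next
        case False
        then have "g x = 0" using supp(2)[of x] abs_ge_self[of R] by auto
        then show ?thesis by simp
      qed
    qed
    also have "\<dots> = ennreal (M\<^sup>2) * emeasure lborel (ball (0::'a) \<bar>R\<bar>)" by (rule nn_integral_cmult_indicator) simp
    also have "\<dots> < \<infinity>" using emeasure_lborel_ball_finite[of "0::'a" "\<bar>R\<bar>"] by (simp add: ennreal_mult_less_top)
    finally show ?thesis using that[of "enn2real (\<integral>\<^sup>+x. ennreal ((norm (g x))\<^sup>2) \<partial>lborel)"] by (simp add: less_top)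
  qed
  have Qw: "Q_functional p \<gamma> w = Dw powr (\<theta> / 2) * A powr ((1 - \<theta>) / (p + 1)) / B powr (1 / (2 * p))"
    using A B Dw der by (intro Q_functional_eq[where g=g]) (auto simp: \<theta>_def gderiv_def inner_commute)
  \<comment> \<open>Solution of the system \<open>eA\<close>, \<open>eB\<close>: dividing the
    equations eliminates \<open>l\<close> and leaves
    \<open>c powr (p - 1) = (P * A) / (B * K)\<close>.\<close>
  define c where "c = ((P * A) / (B * K)) powr (1 / (p - 1))"
  define l where "l = (c powr (p + 1) * A / K) powr (1 / (?d - \<gamma>))"
  have c0: "0 < c" and l0: "0 < l" using K A B by (simp_all add: c_def l_def)
  have lp: "l powr (\<gamma> - ?d) = K / (c powr (p + 1) * A)"
  proof -
    have "l powr (\<gamma> - ?d) = (c powr (p + 1) * A / K) powr (- 1)"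
    proof -
      have "1 / x * (- x) = - 1" if "x \<noteq> 0" for x :: real using that by simp
      from this[of "?d - \<gamma>"] have "1 / (?d - \<gamma>) * (\<gamma> - ?d) = - 1" using e(2) by simp
      then show ?thesis unfolding l_def powr_powr by simp
    qed
    then show ?thesis using c0 A K by (simp add: powr_minus_divide)
  qed
  have eA: "c powr (p + 1) * l powr (\<gamma> - ?d) * A = K" unfolding lp using c0 A by simp
  have eB: "c powr (2 * p) * l powr (\<gamma> - ?d) * B = P"
  proof -
    have cp: "c powr (2 * p) = c powr (p + 1) * c powr (p - 1)" by (simp add: powr_add[symmetric])
    have "c powr (p - 1) = (P * A) / (B * K)" using p K A B by (simp add: c_def powr_powr)
    then show ?thesis unfolding cp lp using c0 A B K by simp
  qed
  let ?w = "\<lambda>x. c * w (l *\<^sub>R x)" and ?g = "\<lambda>x. (c * l) *\<^sub>R g (l *\<^sub>R x)"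
  have DD: "D \<le> c powr 2 * l powr (2 - ?d) * Dw"
  proof (rule normalized_lower_bound[OF d \<gamma> p \<gamma>p, where w="?w" and g="?g" and R="\<bar>R\<bar> / l" and z="z /\<^sub>R l"])
    show "(?w has_derivative (\<lambda>h. ?g x \<bullet> h)) (at x)" for x
    proof -
      have "((\<lambda>x. l *\<^sub>R x) has_derivative (\<lambda>h. l *\<^sub>R h)) (at x)" by (intro derivative_intros)
      from has_derivative_mult_right[OF has_derivative_compose[OF this der], of c]
      show ?thesis by (simp add: mult_ac)
    qed
    show "continuous_on UNIV ?g" by (intro continuous_intros continuous_on_compose2[OF cg]) auto
    have sc: "R \<le> norm (l *\<^sub>R x)" if "\<bar>R\<bar> / l \<le> norm x" for x :: 'a
      using that l0 by (simp add: field_simps)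
    show "?w x = 0" if "\<bar>R\<bar> / l \<le> norm x" for x using supp(1)[OF sc[OF that]] by simp
    show "?g x = 0" if "\<bar>R\<bar> / l \<le> norm x" for x using supp(2)[OF sc[OF that]] by simp
    show "?w (z /\<^sub>R l) \<noteq> 0" using z c0 l0 by simp
    show "(\<integral>\<^sup>+x. ennreal (\<bar>?w x\<bar> powr (p + 1)) \<partial>wmeas \<gamma>) = (\<integral>\<^sup>+x. ennreal (\<bar>w_star p \<gamma> x\<bar> powr (p + 1)) \<partial>(wmeas \<gamma> :: 'a measure))"
      using dilation_integrals(1)[OF wm gm c0 l0 A(2)] A(1) unfolding eA K(4) by simp
    show "(\<integral>\<^sup>+x. ennreal (\<bar>?w x\<bar> powr (2 * p)) \<partial>wmeas \<gamma>) = (\<integral>\<^sup>+x. ennreal (\<bar>w_star p \<gamma> x\<bar> powr (2 * p)) \<partial>(wmeas \<gamma> :: 'a measure))"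
      using dilation_integrals(1)[OF wm gm c0 l0 B(2)] B(1) unfolding eB K(5) by simp
    show "(\<integral>\<^sup>+x. ennreal ((norm (?g x))\<^sup>2) \<partial>lborel) = ennreal (c powr 2 * l powr (2 - ?d) * Dw)"
      using dilation_integrals(2)[OF wm gm c0 l0 Dw(2,1)] .
  qed (use K Dw(1) in auto)
  \<comment> \<open>The energy of \<open>w_star\<close> is positive, so \<open>DD\<close> excludes
    \<open>Dw = 0\<close>.\<close>
  then have Dw0: "0 < Dw" using K(3) Dw(1) by (cases "Dw = 0") auto
  have "D powr (\<theta> / 2) * K powr ((1 - \<theta>) / (p + 1)) / P powr (1 / (2 * p))
    \<le> (c powr 2 * l powr (2 - ?d) * Dw) powr (\<theta> / 2) * K powr ((1 - \<theta>) / (p + 1)) / P powr (1 / (2 * p))"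
    using DD K(3) \<theta>0 by (intro divide_right_mono mult_right_mono powr_mono2) auto
  also have "\<dots> = (c powr 2 * l powr (2 - ?d) * Dw) powr (\<theta> / 2) * (c powr (p + 1) * l powr (\<gamma> - ?d) * A) powr ((1 - \<theta>) / (p + 1)) / (c powr (2 * p) * l powr (\<gamma> - ?d) * B) powr (1 / (2 * p))"
    unfolding eA eB ..
  also have "\<dots> = Dw powr (\<theta> / 2) * A powr ((1 - \<theta>) / (p + 1)) / B powr (1 / (2 * p))"
    by (rule quotient_scale_invariant[OF A(1) B(1) Dw0 c0 l0 p e(8)]) (simp add: \<theta>_def vartheta_def)
  finally show ?thesis unfolding Qs Qw .
qed

section \<open>Approximation by radial test functions\<close>

lemma C_diff_SucI:
  assumes "\<And>x. (f has_derivative f' x) (at x)" "\<And>v. C_diff n (\<lambda>x. f' x v)"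
  shows "C_diff (Suc n) f"
proof -
  have "frechet_derivative f (at x) = f' x" for x using assms(1)[of x] by (metis frechet_derivative_at)
  then show ?thesis using assms by (auto simp: differentiable_on_def differentiable_def)
qed

lemma C_diff_SucD:
  assumes "C_diff (Suc n) f"
  shows "(f has_derivative frechet_derivative f (at x)) (at x)" "C_diff n (\<lambda>x. frechet_derivative f (at x) v)"
  using assms by (auto simp: differentiable_on_def frechet_derivative_works[symmetric])

lemma C_diff_Suc_imp: "C_diff (Suc n) f \<Longrightarrow> C_diff n f"
proof (induction n arbitrary: f)
  case 0
  then show ?case by (auto intro: differentiable_imp_continuous_on)
next
  case (Suc n)
  show ?case
    by (intro C_diff_SucI[OF C_diff_SucD(1)[OF Suc.prems]] Suc.IH C_diff_SucD(2)[OF Suc.prems])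
qed

lemma C_diff_const: "C_diff n (\<lambda>x. c)"
proof (induction n arbitrary: c)
  case (Suc n)
  then show ?case by (intro C_diff_SucI[where f'="\<lambda>x v. 0"]) auto
qed simp

lemma C_diff_inner: "C_diff n (\<lambda>x. x \<bullet> v)"
proof (cases n)
  case (Suc k)
  have "C_diff (Suc k) (\<lambda>x. x \<bullet> v)"
    by (rule C_diff_SucI[where f'="\<lambda>x h. h \<bullet> v"]) (auto intro!: derivative_eq_intros C_diff_const)
  then show ?thesis by (simp add: Suc)
qed (auto intro!: continuous_intros)

lemma C_diff_add: "C_diff n f \<Longrightarrow> C_diff n g \<Longrightarrow> C_diff n (\<lambda>x. f x + g x)"
proof (induction n arbitrary: f g)
  case (Suc n)
  show ?case
    by (rule C_diff_SucI[where f'="\<lambda>x h. frechet_derivative f (at x) h + frechet_derivative g (at x) h"])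
       (intro has_derivative_add C_diff_SucD(1)[OF Suc.prems(1)] C_diff_SucD(1)[OF Suc.prems(2)],
        intro Suc.IH C_diff_SucD(2)[OF Suc.prems(1)] C_diff_SucD(2)[OF Suc.prems(2)])
qed (auto intro: continuous_intros)

lemma C_diff_mult: "C_diff n f \<Longrightarrow> C_diff n g \<Longrightarrow> C_diff n (\<lambda>x. f x * g x)"
proof (induction n arbitrary: f g)
  case (Suc n)
  show ?case
    by (rule C_diff_SucI[where f'="\<lambda>x h. f x * frechet_derivative g (at x) h + frechet_derivative f (at x) h * g x"])
       (intro has_derivative_mult C_diff_SucD(1)[OF Suc.prems(1)] C_diff_SucD(1)[OF Suc.prems(2)],
        intro C_diff_add Suc.IH C_diff_SucD(2)[OF Suc.prems(1)] C_diff_SucD(2)[OF Suc.prems(2)]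
          C_diff_Suc_imp[OF Suc.prems(1)] C_diff_Suc_imp[OF Suc.prems(2)])
qed (auto intro: continuous_intros)

lemma C_diff_inner_self: "C_diff n (\<lambda>x::'a::euclidean_space. x \<bullet> x)"
proof (cases n)
  case (Suc k)
  have "C_diff (Suc k) (\<lambda>x::'a. x \<bullet> x)"
  proof (rule C_diff_SucI[where f'="\<lambda>x h. 2 * (x \<bullet> h)"])
    show "((\<lambda>x. x \<bullet> x) has_derivative (\<lambda>h. 2 * (x \<bullet> h))) (at x)" for x :: 'a
      by (auto intro!: derivative_eq_intros simp: inner_commute)
  qed (intro C_diff_mult C_diff_const C_diff_inner)
  then show ?thesis by (simp add: Suc)
qed (auto intro!: continuous_intros)

lemma C_diff_powr:
  assumes "C_diff n f" and pos: "\<And>x. 0 < f x"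
  shows "C_diff n (\<lambda>x. f x powr a)"
  using assms(1)
proof (induction n arbitrary: a)
  case 0
  then show ?case using pos by (auto intro!: continuous_intros simp: less_imp_neq[THEN not_sym])
next
  case (Suc n)
  show ?case
  proof (rule C_diff_SucI[where f'="\<lambda>x h. (a * f x powr (a - 1)) * frechet_derivative f (at x) h"])
    fix x
    have "((\<lambda>t. t powr a) has_derivative (\<lambda>t. (a * f x powr (a - 1)) * t)) (at (f x))"
      using has_real_derivative_powr[OF pos, of a x] unfolding has_field_derivative_def .
    from has_derivative_compose[OF C_diff_SucD(1)[OF Suc.prems] this]
    show "((\<lambda>x. f x powr a) has_derivative (\<lambda>h. (a * f x powr (a - 1)) * frechet_derivative f (at x) h)) (at x)" .
    show "C_diff n (\<lambda>x. (a * f x powr (a - 1)) * frechet_derivative f (at x) v)" for v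
      by (intro C_diff_mult C_diff_const C_diff_SucD Suc C_diff_Suc_imp)
  qed
qed

text \<open>The factor \<open>inverse t ^ j\<close> makes the family closed, up to linear combinations, under
  differentiation.\<close>

definition flat_exp :: "nat \<Rightarrow> real \<Rightarrow> real" where
  "flat_exp j t = (if 0 < t then inverse t ^ j / exp (inverse t) else 0)"

lemma flat_exp_nonneg: "0 \<le> flat_exp j t"
  by (simp add: flat_exp_def)

lemma DERIV_flat_exp: "(flat_exp j has_real_derivative - real j * flat_exp (j + 1) t + flat_exp (j + 2) t) (at t)"
proof -
  consider "0 < t" | "t < 0" | "t = 0" by linarith
  then show ?thesis
  proof cases
    case 1
    define u where "u = inverse t"
    have inv: "(inverse has_real_derivative - u\<^sup>2) (at t)"
      using 1 DERIV_inverse[of t] by (simp add: u_def power2_eq_square)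
    have "((\<lambda>t. inverse t ^ j * exp (- inverse t)) has_real_derivative
        real j * (- u\<^sup>2 * u ^ (j - Suc 0)) * exp (- u) + exp (- u) * - (- u\<^sup>2) * u ^ j) (at t)"
      unfolding u_def by (intro DERIV_mult DERIV_power DERIV_fun_exp DERIV_minus inv[unfolded u_def])
    also have "real j * (- u\<^sup>2 * u ^ (j - Suc 0)) * exp (- u) + exp (- u) * - (- u\<^sup>2) * u ^ j
      = - real j * flat_exp (j + 1) t + flat_exp (j + 2) t"
      using 1 by (cases j) (auto simp: flat_exp_def u_def[symmetric] exp_minus divide_inverse power2_eq_square algebra_simps)
    finally have "((\<lambda>t. inverse t ^ j * exp (- inverse t)) has_real_derivative - real j * flat_exp (j + 1) t + flat_exp (j + 2) t) (at t)" .
    then show ?thesis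
      by (rule has_field_derivative_transform_within_open[where S="{0<..}"])
         (use 1 in \<open>auto simp: flat_exp_def exp_minus divide_inverse\<close>)
  next
    case 2
    have "((\<lambda>t. 0) has_real_derivative - real j * flat_exp (j + 1) t + flat_exp (j + 2) t) (at t)"
      using 2 by (simp add: flat_exp_def)
    then show ?thesis
      by (rule has_field_derivative_transform_within_open[where S="{..<0}"]) (use 2 in \<open>auto simp: flat_exp_def\<close>)
  next
    case 3
    \<comment> \<open>At 0 the right difference quotient is \<open>u ^ (j + 1) / exp u\<close> with
      \<open>u = inverse h\<close> tending to infinity; the left one is 0.\<close>
    have "((\<lambda>u::real. u ^ (j + 1) / exp u) \<longlongrightarrow> 0) at_top" by (rule tendsto_power_div_exp_0)
    from filterlim_compose[OF this filterlim_inverse_at_top_right]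
    have "((\<lambda>h::real. inverse h ^ (j + 1) / exp (inverse h)) \<longlongrightarrow> 0) (at_right 0)" .
    then have r: "((\<lambda>h. (flat_exp j h - flat_exp j 0) / (h - 0)) \<longlongrightarrow> 0) (at_right 0)"
      by (rule Lim_transform_eventually)
         (auto simp: eventually_at_right_less flat_exp_def divide_inverse mult_ac intro!: eventually_mono[OF eventually_at_right_less])
    have l: "((\<lambda>h. (flat_exp j h - flat_exp j 0) / (h - 0)) \<longlongrightarrow> 0) (at_left 0)"
      by (rule tendsto_eventually) (auto simp: flat_exp_def eventually_at_filter)
    have "(flat_exp j has_real_derivative 0) (at 0)"
      unfolding has_field_derivative_iff using r l by (simp add: filterlim_split_at)
    then show ?thesis using 3 by (simp add: flat_exp_def)
  qed
qed

lemma C_diff_flat_exp: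
  assumes "\<And>n. C_diff n f"
  shows "C_diff n (\<lambda>x. flat_exp j (f x))"
proof (induction n arbitrary: j)
  case 0
  have f: "continuous_on UNIV f" using assms[of 0] by simp
  have "continuous_on UNIV (flat_exp j)"
    by (intro continuous_at_imp_continuous_on ballI DERIV_isCont[OF DERIV_flat_exp])
  from continuous_on_compose2[OF this f] show ?case by simp
next
  case (Suc n)
  show ?case
  proof (rule C_diff_SucI[where f'="\<lambda>x h. (- real j * flat_exp (j + 1) (f x) + flat_exp (j + 2) (f x)) * frechet_derivative f (at x) h"])
    fix x
    have "(flat_exp j has_derivative (\<lambda>h. (- real j * flat_exp (j + 1) (f x) + flat_exp (j + 2) (f x)) * h)) (at (f x))"
      using DERIV_flat_exp by (simp add: has_field_derivative_def)
    from has_derivative_compose[OF C_diff_SucD(1)[OF assms] this]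
    show "((\<lambda>x. flat_exp j (f x)) has_derivative (\<lambda>h. (- real j * flat_exp (j + 1) (f x) + flat_exp (j + 2) (f x)) * frechet_derivative f (at x) h)) (at x)" .
    show "C_diff n (\<lambda>x. (- real j * flat_exp (j + 1) (f x) + flat_exp (j + 2) (f x)) * frechet_derivative f (at x) v)" for v
      by (intro C_diff_mult C_diff_add C_diff_const Suc.IH C_diff_SucD(2)[OF assms])
  qed
qed

text \<open>\<open>flat_exp 2\<close> is the derivative of \<open>flat_exp 0\<close>, so this bounds
  the slope of the cutoff. In terms of \<open>u = inverse t\<close> it is the Taylor bound
  \<open>u ^ 2 / 2 \<le> exp u\<close>.\<close>

lemma flat_exp_2_le: "flat_exp 2 t \<le> 2"
proof (cases "0 < t")
  case True
  have "inverse t ^ 2 \<le> 2 * exp (inverse t)"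
    using exp_lower_Taylor_quadratic[of "inverse t"] positive_imp_inverse_positive[OF True] by linarith
  then show ?thesis using True by (simp add: flat_exp_def divide_le_eq)
qed (simp add: flat_exp_def)

text \<open>\<open>exp 1\<close> normalises the cutoff to the value 1 at \<open>t = 1\<close>, its
  maximum over \<open>t \<le> 1\<close>.\<close>

lemma flat_exp_0_le: "t \<le> 1 \<Longrightarrow> exp 1 * flat_exp 0 t \<le> 1"
  by (auto simp: flat_exp_def divide_le_eq one_le_inverse)

lemma measurable_flat_exp[measurable]: "flat_exp j \<in> borel_measurable borel"
  by (intro borel_measurable_continuous_onI continuous_at_imp_continuous_on ballI DERIV_isCont[OF DERIV_flat_exp])

text \<open>The shift \<open>1 / Suc k\<close> removes the singularity of \<open>w_star\<close> at the origin; the second factor is a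
  cutoff equal to \<open>1\<close> at the origin and supported in the ball of radius \<open>Suc k\<close>.\<close>

definition approx_star :: "real \<Rightarrow> real \<Rightarrow> nat \<Rightarrow> 'a::euclidean_space \<Rightarrow> real" where
  "approx_star p \<gamma> k x = (1 + (1 / Suc k + x \<bullet> x) powr ((2 - \<gamma>) / 2)) powr (- 1 / (p - 1)) *
     (exp 1 * flat_exp 0 (1 + (- (1 / (Suc k)\<^sup>2)) * (x \<bullet> x)))"

lemma approx_star_test: "approx_star p \<gamma> k \<in> (radial_test_functions :: ('a::euclidean_space \<Rightarrow> real) set) - {\<lambda>_. 0}"
proof -
  let ?u = "approx_star p \<gamma> k :: 'a \<Rightarrow> real"
  have C: "C_diff n ?u" for n
    unfolding approx_star_def
    by (intro C_diff_mult C_diff_powr C_diff_add C_diff_const C_diff_flat_exp C_diff_inner_self)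
       (auto intro!: add_pos_nonneg)
  have "{x. ?u x \<noteq> 0} \<subseteq> cball 0 (Suc k)"
  proof
    fix x :: 'a assume "x \<in> {x. ?u x \<noteq> 0}"
    then have "flat_exp 0 (1 + (- (1 / (Suc k)\<^sup>2)) * (x \<bullet> x)) \<noteq> 0" by (auto simp: approx_star_def)
    then have "0 < 1 + (- (1 / (Suc k)\<^sup>2)) * (x \<bullet> x)" by (auto simp: flat_exp_def split: if_splits)
    then have "(norm x)\<^sup>2 / (real (Suc k))\<^sup>2 < 1" by (simp add: power2_norm_eq_inner)
    then have "(norm x)\<^sup>2 < (real (Suc k))\<^sup>2" by (simp add: pos_divide_less_eq)
    then have "norm x < real (Suc k)" by (rule power2_less_imp_less) simp
    then show "x \<in> cball 0 (Suc k)" by simp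
  qed
  then have "bounded {x. ?u x \<noteq> 0}" using bounded_cball bounded_subset by blast
  then have "compact (closure {x. ?u x \<noteq> 0})" by (simp add: compact_closure)
  moreover have "?u x = ?u y" if "norm x = norm y" for x y
  proof -
    have "x \<bullet> x = y \<bullet> y" using that by (simp flip: power2_norm_eq_inner)
    then show ?thesis by (simp add: approx_star_def)
  qed
  moreover have "?u 0 \<noteq> 0"
  proof -
    have "0 < 1 + (1 / real (Suc k)) powr ((2 - \<gamma>) / 2)" by (simp add: add_pos_nonneg)
    then show ?thesis by (simp add: approx_star_def flat_exp_def)
  qed
  ultimately have "?u \<in> radial_test_functions" "?u \<noteq> (\<lambda>_. 0)"
    unfolding radial_test_functions_def test_functions_def mem_Collect_eq using C by (blast, metis)
  then show ?thesis by blast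
qed

section \<open>Convergence of the quotients\<close>

lemma radial_test_subset: "radial_test_functions \<subseteq> test_functions"
  by (auto simp: radial_test_functions_def)

lemma AE_wmeas_nonzero: "AE x in (wmeas \<gamma> :: 'a::euclidean_space measure). x \<noteq> 0"
  unfolding wmeas_def by (subst AE_density) (use AE_lborel_singleton[of "0::'a"] in auto)

text \<open>Dominated convergence for the three integrals. Shift and cutoff only decrease the
  function and the slope of the profile, so \<open>w_star\<close> and its gradient serve as
  majorants there. The delicate term is the gradient of the cutoff, of size
  \<open>min 1 (1 / r)\<close>, which for \<open>r \<ge> 1\<close> is absorbed by the energy density
  of \<open>w_star\<close>.\<close>

lemma approx_star_tendsto:
  assumes d: "3 \<le> DIM('a::euclidean_space)" and \<gamma>: "0 < \<gamma>" and p: "1 < p"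
    and \<gamma>p: "\<gamma> < real DIM('a) - (real DIM('a) - 2) * p"
  shows "(\<lambda>k. Q_functional p \<gamma> (approx_star p \<gamma> k :: 'a \<Rightarrow> real)) \<longlonglongrightarrow> Q_functional p \<gamma> (w_star p \<gamma> :: 'a \<Rightarrow> real)"
proof -
  have d3: "3 \<le> real DIM('a)" using d by simp
  note ef = exponent_facts[OF d3 \<gamma> p \<gamma>p refl refl]
  define \<theta> where "\<theta> = vartheta DIM('a) p \<gamma>"
  define s where "s = (2 - \<gamma>) / 2"
  define m where "m = - 1 / (p - 1)"
  define e where "e = (\<lambda>k::nat. 1 / real (Suc k))"
  define c where "c = (\<lambda>k::nat. 1 / (real (Suc k))\<^sup>2)"
  have s0: "0 < s" "s - 1 \<le> 0" using ef(1) \<gamma> by (auto simp: s_def)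
  have m0: "m < 0" using p by (simp add: m_def)
  have mp: "m - 1 = m * p" using p by (simp add: m_def field_simps)
  have e0: "0 < e k" for k by (simp add: e_def)
  have c0: "0 < c k" "c k \<le> 1" for k by (auto simp: c_def divide_le_eq one_le_power)
  have elim: "e \<longlonglongrightarrow> 0" unfolding e_def using LIMSEQ_inverse_real_of_nat by (simp add: inverse_eq_divide)
  have clim: "c \<longlonglongrightarrow> 0"
    using tendsto_power[OF elim, of 2] by (simp add: c_def e_def power_divide)
  \<comment> \<open>At radius \<open>r\<close>, \<open>approx_star\<close> is the product of the
    shifted profile \<open>V\<close> and the cutoff \<open>X\<close>. Primes denote radial
    derivatives; \<open>Vs\<close> and \<open>Gs\<close> are \<open>w_star\<close> and the norm of
    its gradient.\<close>
  define V where "V = (\<lambda>k r. (1 + (e k + r\<^sup>2) powr s) powr m)"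
  define X where "X = (\<lambda>k r. exp 1 * flat_exp 0 (1 + (- c k) * r\<^sup>2))"
  define V' where "V' = (\<lambda>k r. m * (1 + (e k + r\<^sup>2) powr s) powr (m - 1) * (s * (e k + r\<^sup>2) powr (s - 1) * (2 * r)))"
  define X' where "X' = (\<lambda>k r. exp 1 * (flat_exp 2 (1 + (- c k) * r\<^sup>2) * (- c k * (2 * r))))"
  define Vs where "Vs = (\<lambda>r. (1 + r powr (2 - \<gamma>)) powr m)"
  define Gs where "Gs = (\<lambda>r. (2 - \<gamma>) / (p - 1) * (r powr (1 - \<gamma>) * Vs r powr p))"
  define f where "f = (\<lambda>k r. V' k r * X k r + X' k r * V k r)"
  have u_eq: "approx_star p \<gamma> k x = V k (norm x) * X k (norm x)" for k and x :: 'a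
    by (simp add: approx_star_def V_def X_def e_def c_def s_def m_def power2_norm_eq_inner)
  have w_eq: "w_star p \<gamma> x = Vs (norm x)" for x :: 'a by (simp add: w_star_def Vs_def m_def)
  have gs_eq: "norm (grad_star p \<gamma> x) = Gs (norm x)" if "x \<noteq> 0" for x :: 'a
    using that p ef(1) by (simp add: grad_star_def Gs_def w_eq norm_sgn abs_mult Vs_def)
  have rp: "(r\<^sup>2) powr a = r powr (2 * a)" if "0 < r" for r a :: real
    using that by (simp add: powr_powr[symmetric] powr_numeral)
  have rs: "(r\<^sup>2) powr s = r powr (2 - \<gamma>)" "(r\<^sup>2) powr (s - 1) * r = r powr (1 - \<gamma>)" if "0 < r" for r
  proof -
    have "2 * s = 2 - \<gamma>" by (simp add: s_def)
    then show "(r\<^sup>2) powr s = r powr (2 - \<gamma>)" using rp[OF that, of s] by simp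
    have "(r\<^sup>2) powr (s - 1) * r = r powr (2 * (s - 1)) * r powr 1" using that by (simp only: rp[OF that] powr_one_eq_one powr_one)
    also have "\<dots> = r powr (2 * (s - 1) + 1)" by (simp only: powr_add)
    also have "2 * (s - 1) + 1 = 1 - \<gamma>" by (simp add: s_def)
    finally show "(r\<^sup>2) powr (s - 1) * r = r powr (1 - \<gamma>)" .
  qed
  have Gs_eq: "Gs r = - (m * (1 + (r\<^sup>2) powr s) powr (m - 1) * (s * (r\<^sup>2) powr (s - 1) * (2 * r)))" if r: "0 < r" for r
  proof -
    have "- (m * (1 + (r\<^sup>2) powr s) powr (m - 1) * (s * (r\<^sup>2) powr (s - 1) * (2 * r)))
      = - (m * (2 * s)) * (((r\<^sup>2) powr (s - 1) * r) * (1 + (r\<^sup>2) powr s) powr (m * p))" unfolding mp by (simp only: mult_ac mult_minus_left mult_minus_right)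
    also have "- (m * (2 * s)) = (2 - \<gamma>) / (p - 1)" using p by (simp add: m_def s_def field_simps)
    also have "(2 - \<gamma>) / (p - 1) * (((r\<^sup>2) powr (s - 1) * r) * (1 + (r\<^sup>2) powr s) powr (m * p)) = Gs r"
      unfolding rs[OF r] Gs_def Vs_def by (simp add: powr_powr)
    finally show ?thesis ..
  qed
  have Gs0: "0 \<le> Gs r" for r using p ef(1) by (simp add: Gs_def)
  have V0: "0 < V k r" for k r by (simp add: V_def add_pos_nonneg less_imp_neq[THEN not_sym])
  have Vs0: "0 < Vs r" for r by (simp add: Vs_def add_pos_nonneg less_imp_neq[THEN not_sym])
  have VVs: "V k r \<le> Vs r" if r: "0 < r" for k r
  proof -
    have "(r\<^sup>2) powr s \<le> (e k + r\<^sup>2) powr s" using e0[of k] s0 by (intro powr_mono2) auto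
    then show ?thesis unfolding V_def Vs_def rs[OF r, symmetric] using m0 by (intro powr_mono2') (auto simp: add_pos_nonneg)
  qed
  have X0: "0 \<le> X k r" "X k r \<le> 1" for k r
    using c0[of k] by (auto simp: X_def flat_exp_nonneg intro!: flat_exp_0_le)
  \<comment> \<open>The exponent \<open>s - 1\<close> equals \<open>- \<gamma> / 2\<close>, so the
    shift by \<open>e k\<close> decreases this factor as well as the one with exponent
    \<open>m - 1\<close>.\<close>
  have V'b: "\<bar>V' k r\<bar> \<le> Gs r" if r: "0 < r" for k r
  proof -
    have "(r\<^sup>2) powr s \<le> (e k + r\<^sup>2) powr s" using e0[of k] s0 by (intro powr_mono2) auto
    then have 1: "(1 + (e k + r\<^sup>2) powr s) powr (m - 1) \<le> (1 + (r\<^sup>2) powr s) powr (m - 1)"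
      using m0 by (intro powr_mono2') (auto simp: add_pos_nonneg)
    have 2: "(e k + r\<^sup>2) powr (s - 1) \<le> (r\<^sup>2) powr (s - 1)" using e0[of k] s0 r by (intro powr_mono2') auto
    have "\<bar>V' k r\<bar> = (- m) * (1 + (e k + r\<^sup>2) powr s) powr (m - 1) * (s * (e k + r\<^sup>2) powr (s - 1) * (2 * r))"
      using m0 s0 r by (simp add: V'_def abs_mult)
    also have "\<dots> \<le> (- m) * (1 + (r\<^sup>2) powr s) powr (m - 1) * (s * (r\<^sup>2) powr (s - 1) * (2 * r))"
      using 1 2 m0 s0 r by (intro mult_mono) (auto simp: mult_nonpos_nonneg)
    also have "\<dots> = Gs r" unfolding Gs_eq[OF r] by simp
    finally show ?thesis .
  qed
  define E where "E = 4 * exp (1::real)"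
  have E0: "0 < E" by (simp add: E_def)
  \<comment> \<open>Where the cutoff is positive one has \<open>c k * r\<^sup>2 < 1\<close>, so its
    slope, of order \<open>c k * r\<close>, is at most of order \<open>1 / r\<close>; it is also of
    order 1 because \<open>c k \<le> 1\<close>. Both bounds are uniform in \<open>k\<close>.\<close>
  have X'b: "\<bar>X' k r\<bar> \<le> E * min 1 (1 / r)" if r: "0 < r" for k r
  proof (cases "c k * r\<^sup>2 < 1")
    case True
    have "c k * r * r < 1" using True by (simp add: power2_eq_square mult_ac)
    then have 1: "c k * r \<le> 1 / r" using r by (simp add: pos_le_divide_eq)
    have 2: "c k * r \<le> 1"
    proof (cases "r \<le> 1")
      case True
      then show ?thesis using c0[of k] r by (simp add: mult_le_one)
    next
      case False
      then have "1 / r \<le> 1" by simp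
      then show ?thesis using 1 by simp
    qed
    have "\<bar>X' k r\<bar> = exp 1 * (flat_exp 2 (1 + (- c k) * r\<^sup>2) * (2 * (c k * r)))"
      using c0[of k] r flat_exp_nonneg[of 2] by (simp add: X'_def abs_mult)
    also have "\<dots> \<le> exp 1 * (2 * (2 * min 1 (1 / r)))"
      using 1 2 c0[of k] r flat_exp_2_le flat_exp_nonneg by (intro mult_left_mono mult_mono) auto
    finally show ?thesis by (simp add: E_def)
  next
    case False
    then show ?thesis using r E0 by (simp add: X'_def flat_exp_def)
  qed
  \<comment> \<open>\<open>q\<close> inverts the constant in \<open>Gs\<close>. \<open>A1\<close>
    and \<open>A2\<close> collect the constants produced by
    \<open>(a + b)\<^sup>2 \<le> 2 * a\<^sup>2 + 2 * b\<^sup>2\<close>, the slope bound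
    \<open>E\<close> and \<open>tail\<close>.\<close>
  define q where "q = (p - 1) / (2 - \<gamma>)"
  define A1 where "A1 = 2 + 8 * E\<^sup>2 * q\<^sup>2"
  define A2 where "A2 = 2 * E\<^sup>2"
  \<comment> \<open>For \<open>r \<ge> 1\<close> the term \<open>r powr (2 - \<gamma>)\<close> is at
    least half of \<open>1 + r powr (2 - \<gamma>)\<close>, so \<open>Vs r / r\<close> is at most
    \<open>2 * q * Gs r\<close>: a function that decays like a power is controlled by its own
    slope.\<close>
  have tail: "(Vs r)\<^sup>2 * (1 / r)\<^sup>2 \<le> 4 * q\<^sup>2 * (Gs r)\<^sup>2" if r: "1 \<le> r" for r
  proof -
    have r0: "0 < r" using r by simp
    define t where "t = 1 + r powr (2 - \<gamma>)"
    have t0: "0 < t" by (simp add: t_def add_pos_nonneg)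
    have "1 \<le> r powr (2 - \<gamma>)" using r ef(1) by (simp add: ge_one_powr_ge_zero)
    then have t: "t \<le> 2 * r powr (2 - \<gamma>)" by (simp add: t_def)
    have v: "Vs r powr p = Vs r / t"
    proof -
      have "Vs r powr p = t powr (m - 1)" unfolding mp by (simp add: Vs_def t_def powr_powr)
      then show ?thesis using t0 by (simp add: Vs_def t_def powr_diff)
    qed
    have "q * Gs r = r powr (1 - \<gamma>) * (Vs r / t)" using p ef(1) by (simp add: q_def Gs_def v)
    moreover have "r powr (1 - \<gamma>) / t \<ge> 1 / (2 * r)"
    proof -
      have "t * 1 \<le> 2 * r * r powr (1 - \<gamma>)" using t r0 powr_add[of r 1 "1 - \<gamma>"] by simp
      then show ?thesis using t0 r0 by (simp add: field_simps)
    qed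
    then have "Vs r * (1 / (2 * r)) \<le> Vs r * (r powr (1 - \<gamma>) / t)" using Vs0[of r] by (intro mult_left_mono) auto
    ultimately have "Vs r * (1 / (2 * r)) \<le> q * Gs r" by (simp add: mult_ac)
    then have "Vs r * (1 / r) \<le> 2 * (q * Gs r)" by simp
    then have "(Vs r * (1 / r))\<^sup>2 \<le> (2 * (q * Gs r))\<^sup>2" using Vs0[of r] r0 by (intro power_mono) auto
    then show ?thesis by (simp only: power_mult_distrib mult_ac) simp
  qed
  have fb: "(f k r)\<^sup>2 \<le> A1 * (Gs r)\<^sup>2 + A2 * (if r < 1 then 1 else 0)" if r: "0 < r" for k r
  proof -
    have "\<bar>f k r\<bar> \<le> \<bar>V' k r\<bar> * \<bar>X k r\<bar> + \<bar>X' k r\<bar> * \<bar>V k r\<bar>"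
      unfolding f_def abs_mult[symmetric] by (rule abs_triangle_ineq)
    also have "\<dots> \<le> Gs r * 1 + (E * min 1 (1 / r)) * Vs r"
      using V'b[OF r, of k] X'b[OF r, of k] X0[of k r] V0[of k r] VVs[OF r, of k] Gs0[of r] E0 r
      by (intro add_mono mult_mono) auto
    finally have le: "\<bar>f k r\<bar> \<le> Gs r + E * (min 1 (1 / r) * Vs r)" by simp
    have sq2: "(a + b)\<^sup>2 \<le> 2 * a\<^sup>2 + 2 * b\<^sup>2" for a b :: real
      using zero_le_power2[of "a - b"] by (simp add: power2_sum power2_diff)
    have "(f k r)\<^sup>2 \<le> (Gs r + E * (min 1 (1 / r) * Vs r))\<^sup>2"
      using power_mono[OF le abs_ge_zero, of 2] by simp
    also have "\<dots> \<le> 2 * (Gs r)\<^sup>2 + 2 * (E * (min 1 (1 / r) * Vs r))\<^sup>2" by (rule sq2)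
    also have "(E * (min 1 (1 / r) * Vs r))\<^sup>2 = E\<^sup>2 * (min 1 (1 / r) * Vs r)\<^sup>2" by (simp add: power_mult_distrib)
    finally have le2: "(f k r)\<^sup>2 \<le> 2 * (Gs r)\<^sup>2 + 2 * (E\<^sup>2 * (min 1 (1 / r) * Vs r)\<^sup>2)" .
    have "(min 1 (1 / r) * Vs r)\<^sup>2 \<le> 4 * q\<^sup>2 * (Gs r)\<^sup>2 + (if r < 1 then 1 else 0)"
    proof (cases "r < 1")
      case True
      have "Vs r \<le> 1 powr m" unfolding Vs_def using m0 by (intro powr_mono2') auto
      then have "(min 1 (1 / r) * Vs r)\<^sup>2 \<le> 1"
        using True r Vs0[of r] by (intro power_le_one) (auto simp: min_def)
      then show ?thesis using True by (simp add: add_increasing)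
    next
      case False
      then have "min 1 (1 / r) = 1 / r" by (simp add: min_def)
      then have "(min 1 (1 / r) * Vs r)\<^sup>2 = (Vs r)\<^sup>2 * (1 / r)\<^sup>2" by (simp only: power_mult_distrib mult.commute)
      then show ?thesis using tail[of r] False by simp
    qed
    then have "E\<^sup>2 * (min 1 (1 / r) * Vs r)\<^sup>2 \<le> E\<^sup>2 * (4 * q\<^sup>2 * (Gs r)\<^sup>2 + (if r < 1 then 1 else 0))"
      by (intro mult_left_mono) auto
    then have "(f k r)\<^sup>2 \<le> 2 * (Gs r)\<^sup>2 + 2 * (E\<^sup>2 * (4 * q\<^sup>2 * (Gs r)\<^sup>2 + (if r < 1 then 1 else 0)))"
      using le2 by linarith
    also have "\<dots> = A1 * (Gs r)\<^sup>2 + A2 * (if r < 1 then 1 else 0)"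
      by (simp add: A1_def A2_def algebra_simps)
    finally show ?thesis .
  qed
  have Vlim: "(\<lambda>k. V k r) \<longlonglongrightarrow> Vs r" if r: "0 < r" for r
  proof -
    have "(\<lambda>k. (1 + (e k + r\<^sup>2) powr s) powr m) \<longlonglongrightarrow> (1 + (0 + r\<^sup>2) powr s) powr m"
      using r by (intro tendsto_intros elim) (auto simp: add_pos_nonneg less_imp_neq[THEN not_sym])
    then show ?thesis using rs(1)[OF r] by (simp add: V_def Vs_def)
  qed
  have V'lim: "(\<lambda>k. V' k r) \<longlonglongrightarrow> - Gs r" if r: "0 < r" for r
  proof -
    have "(\<lambda>k. m * (1 + (e k + r\<^sup>2) powr s) powr (m - 1) * (s * (e k + r\<^sup>2) powr (s - 1) * (2 * r)))
      \<longlonglongrightarrow> m * (1 + (0 + r\<^sup>2) powr s) powr (m - 1) * (s * (0 + r\<^sup>2) powr (s - 1) * (2 * r))"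
      using r by (intro tendsto_intros elim) (auto simp: add_pos_nonneg less_imp_neq[THEN not_sym])
    then show ?thesis using Gs_eq[OF r] by (simp add: V'_def)
  qed
  have flim: "(\<lambda>k. flat_exp j (1 + (- c k) * r\<^sup>2)) \<longlonglongrightarrow> flat_exp j (1 + (- 0) * r\<^sup>2)" for j r
    by (intro isCont_tendsto_compose[OF DERIV_isCont[OF DERIV_flat_exp]] tendsto_intros clim)
  have Xlim: "(\<lambda>k. X k r) \<longlonglongrightarrow> 1" for r
  proof -
    have "(\<lambda>k. X k r) \<longlonglongrightarrow> exp 1 * flat_exp 0 (1 + (- 0) * r\<^sup>2)" unfolding X_def by (intro tendsto_intros flim)
    then show ?thesis by (simp add: flat_exp_def)
  qed
  have X'lim: "(\<lambda>k. X' k r) \<longlonglongrightarrow> 0" for r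
  proof -
    have "(\<lambda>k. X' k r) \<longlonglongrightarrow> exp 1 * (flat_exp 2 (1 + (- 0) * r\<^sup>2) * (- 0 * (2 * r)))" unfolding X'_def by (intro tendsto_intros flim clim)
    then show ?thesis by simp
  qed
  have flim': "(\<lambda>k. (f k r)\<^sup>2) \<longlonglongrightarrow> (Gs r)\<^sup>2" if r: "0 < r" for r
  proof -
    have "(\<lambda>k. (V' k r * X k r + X' k r * V k r)\<^sup>2) \<longlonglongrightarrow> (- Gs r * 1 + 0 * Vs r)\<^sup>2"
      by (intro tendsto_intros V'lim[OF r] Xlim X'lim Vlim[OF r])
    then show ?thesis by (simp add: f_def)
  qed
  let ?u = "\<lambda>k. approx_star p \<gamma> k :: 'a \<Rightarrow> real"
  define g where "g = (\<lambda>k (x::'a). f k (norm x) *\<^sub>R sgn x)"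
  have Gd: "GDERIV (?u k) x :> g k x" if x: "x \<noteq> 0" for k x
  proof -
    let ?r = "norm x"
    have er: "0 < e k + ?r\<^sup>2" using e0[of k] by (simp add: add_pos_nonneg)
    have "((\<lambda>r. e k + r\<^sup>2) has_real_derivative 2 * ?r) (at ?r)" by (auto intro!: derivative_eq_intros)
    from DERIV_fun_powr[OF this er, of s]
    have "((\<lambda>r. 1 + (e k + r\<^sup>2) powr s) has_real_derivative s * (e k + ?r\<^sup>2) powr (s - 1) * (2 * ?r)) (at ?r)"
      using DERIV_add[OF DERIV_const, of "\<lambda>r. (e k + r\<^sup>2) powr s" _ ?r UNIV 1] by simp
    from DERIV_fun_powr[OF this, of m]
    have dV: "(V k has_real_derivative V' k ?r) (at ?r)" unfolding V_def V'_def by (simp add: add_pos_nonneg)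
    have "((\<lambda>r. 1 + (- c k) * r\<^sup>2) has_real_derivative - c k * (2 * ?r)) (at ?r)" by (auto intro!: derivative_eq_intros)
    from DERIV_chain2[OF DERIV_flat_exp this, of 0]
    have "((\<lambda>r. flat_exp 0 (1 + (- c k) * r\<^sup>2)) has_real_derivative flat_exp 2 (1 + (- c k) * ?r\<^sup>2) * (- c k * (2 * ?r))) (at ?r)"
      by (simp add: numeral_2_eq_2)
    from DERIV_cmult[OF this, of "exp 1"]
    have dX: "(X k has_real_derivative X' k ?r) (at ?r)" unfolding X_def X'_def .
    have "((\<lambda>r. V k r * X k r) has_real_derivative f k ?r) (at ?r)" unfolding f_def by (rule DERIV_mult[OF dV dX])
    from GDERIV_radial[OF x this] have "GDERIV (\<lambda>x. V k (norm x) * X k (norm x)) x :> g k x" by (simp add: g_def)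
    moreover have "(\<lambda>x. V k (norm x) * X k (norm x)) = ?u k" by (simp add: u_eq fun_eq_iff)
    ultimately show ?thesis by simp
  qed
  have gm[measurable]: "g k \<in> borel_measurable borel" for k
    unfolding g_def f_def V_def V'_def X_def X'_def sgn_div_norm by measurable
  have um[measurable]: "?u k \<in> borel_measurable borel" for k
  proof -
    have "(\<lambda>x::'a. V k (norm x) * X k (norm x)) \<in> borel_measurable borel" unfolding V_def X_def by measurable
    then show ?thesis by (simp add: u_eq[symmetric])
  qed
  obtain K P D where K: "0 < K" "0 < P" "0 < D"
    "(\<integral>\<^sup>+x. ennreal (\<bar>w_star p \<gamma> x\<bar> powr (p + 1)) \<partial>(wmeas \<gamma> :: 'a measure)) = ennreal K"
    "(\<integral>\<^sup>+x. ennreal (\<bar>w_star p \<gamma> x\<bar> powr (2 * p)) \<partial>(wmeas \<gamma> :: 'a measure)) = ennreal P"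
    "(\<integral>\<^sup>+x. ennreal ((norm (grad_star p \<gamma> (x::'a)))\<^sup>2) \<partial>lborel) = ennreal D"
    by (rule w_star_integral_values[OF d \<gamma> p \<gamma>p])
  have Qs: "Q_functional p \<gamma> (w_star p \<gamma> :: 'a \<Rightarrow> real) = D powr (\<theta> / 2) * K powr ((1 - \<theta>) / (p + 1)) / P powr (1 / (2 * p))"
    using K by (intro Q_functional_eq[where g="grad_star p \<gamma>"] GDERIV_w_star p) (auto simp: \<theta>_def)
  have powlim: "\<exists>I. (\<forall>k. (\<integral>\<^sup>+x. ennreal (\<bar>?u k x\<bar> powr r) \<partial>wmeas \<gamma>) = ennreal (I k) \<and> 0 \<le> I k) \<and> I \<longlonglongrightarrow> J"
    if r: "0 < r" and J: "(\<integral>\<^sup>+x. ennreal (\<bar>w_star p \<gamma> x\<bar> powr r) \<partial>(wmeas \<gamma> :: 'a measure)) = ennreal J" "0 < J" for r J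
  proof -
    have ub: "\<bar>?u k x\<bar> powr r \<le> \<bar>w_star p \<gamma> x\<bar> powr r" if "x \<noteq> 0" for k x
    proof -
      have "V k (norm x) * X k (norm x) \<le> Vs (norm x) * 1"
        using that VVs[of "norm x" k] X0[of k "norm x"] V0[of k "norm x"] Vs0[of "norm x"] by (intro mult_mono) auto
      moreover have "0 \<le> V k (norm x) * X k (norm x)" using X0[of k "norm x"] V0[of k "norm x"] by (simp add: less_imp_le)
      ultimately show ?thesis using r Vs0[of "norm x"] unfolding u_eq w_eq by (intro powr_mono2) auto
    qed
    have lim: "(\<lambda>k. \<integral>\<^sup>+x. ennreal (\<bar>?u k x\<bar> powr r) \<partial>wmeas \<gamma>) \<longlonglongrightarrow> (\<integral>\<^sup>+x. ennreal (\<bar>w_star p \<gamma> x\<bar> powr r) \<partial>(wmeas \<gamma> :: 'a measure))"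
    proof (rule nn_integral_dominated_convergence[where w="\<lambda>x. ennreal (\<bar>w_star p \<gamma> x\<bar> powr r)"])
      show "AE x in wmeas \<gamma>. ennreal (\<bar>?u k x\<bar> powr r) \<le> ennreal (\<bar>w_star p \<gamma> x\<bar> powr r)" for k
        using AE_wmeas_nonzero by eventually_elim (intro ennreal_leI ub)
      show "AE x in wmeas \<gamma>. (\<lambda>k. ennreal (\<bar>?u k x\<bar> powr r)) \<longlonglongrightarrow> ennreal (\<bar>w_star p \<gamma> x\<bar> powr r)"
        using AE_wmeas_nonzero
      proof eventually_elim
        case (elim x)
        have "(\<lambda>k. \<bar>V k (norm x) * X k (norm x)\<bar> powr r) \<longlonglongrightarrow> \<bar>Vs (norm x) * 1\<bar> powr r"
          using elim Vs0[of "norm x"] by (intro tendsto_intros Vlim Xlim) auto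
        then show ?case unfolding u_eq w_eq by (intro tendsto_ennrealI) simp
      qed
      show "(\<integral>\<^sup>+x. ennreal (\<bar>w_star p \<gamma> x\<bar> powr r) \<partial>(wmeas \<gamma> :: 'a measure)) < \<infinity>" unfolding J(1) by simp
    qed measurable
    define I where "I = (\<lambda>k. enn2real (\<integral>\<^sup>+x. ennreal (\<bar>?u k x\<bar> powr r) \<partial>wmeas \<gamma>))"
    have fin: "(\<integral>\<^sup>+x. ennreal (\<bar>?u k x\<bar> powr r) \<partial>wmeas \<gamma>) < \<infinity>" for k
    proof -
      have "(\<integral>\<^sup>+x. ennreal (\<bar>?u k x\<bar> powr r) \<partial>wmeas \<gamma>) \<le> (\<integral>\<^sup>+x. ennreal (\<bar>w_star p \<gamma> x\<bar> powr r) \<partial>(wmeas \<gamma> :: 'a measure))"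
      proof (rule nn_integral_mono_AE)
        show "AE x in wmeas \<gamma>. ennreal (\<bar>?u k x\<bar> powr r) \<le> ennreal (\<bar>w_star p \<gamma> x\<bar> powr r)"
          using AE_wmeas_nonzero by eventually_elim (intro ennreal_leI ub)
      qed
      also have "\<dots> < \<infinity>" unfolding J(1) by simp
      finally show ?thesis .
    qed
    have I: "(\<integral>\<^sup>+x. ennreal (\<bar>?u k x\<bar> powr r) \<partial>wmeas \<gamma>) = ennreal (I k)" for k using fin[of k] by (simp add: I_def less_top)
    have "(\<lambda>k. ennreal (I k)) \<longlonglongrightarrow> ennreal J" using lim unfolding I J(1) .
    then have "I \<longlonglongrightarrow> J" by (rule tendsto_ennrealD) (use J(2) in \<open>auto simp: I_def\<close>)
    moreover have "0 \<le> I k" for k by (simp add: I_def)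
    ultimately show ?thesis using I by blast
  qed
  have "\<exists>I. (\<forall>k. (\<integral>\<^sup>+x. ennreal ((norm (g k x))\<^sup>2) \<partial>lborel) = ennreal (I k) \<and> 0 \<le> I k) \<and> I \<longlonglongrightarrow> D"
  proof -
    define h where "h = (\<lambda>x::'a. ennreal A1 * ennreal ((norm (grad_star p \<gamma> x))\<^sup>2) + ennreal A2 * indicator (ball 0 1) x)"
    have [measurable]: "h \<in> borel_measurable borel" unfolding h_def
      by (intro borel_measurable_add borel_measurable_times_ennreal borel_measurable_indicator) auto
    have A0: "0 \<le> A1" "0 \<le> A2" by (simp_all add: A1_def A2_def)
    have hfin: "(\<integral>\<^sup>+x. h x \<partial>lborel) < \<infinity>"
    proof -
      have "(\<integral>\<^sup>+x. h x \<partial>lborel) = (\<integral>\<^sup>+x. ennreal A1 * ennreal ((norm (grad_star p \<gamma> (x::'a)))\<^sup>2) \<partial>lborel) + (\<integral>\<^sup>+x. ennreal A2 * indicator (ball (0::'a) 1) x \<partial>lborel)"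
        unfolding h_def by (intro nn_integral_add borel_measurable_times_ennreal borel_measurable_indicator) auto
      also have "(\<integral>\<^sup>+x. ennreal A1 * ennreal ((norm (grad_star p \<gamma> (x::'a)))\<^sup>2) \<partial>lborel) = ennreal A1 * ennreal D"
        unfolding K(6)[symmetric] by (rule nn_integral_cmult) measurable
      also have "(\<integral>\<^sup>+x. ennreal A2 * indicator (ball (0::'a) 1) x \<partial>lborel) = ennreal A2 * emeasure lborel (ball (0::'a) 1)"
        by (rule nn_integral_cmult_indicator) simp
      finally show ?thesis using emeasure_lborel_ball_finite[of "0::'a" 1] by (simp add: ennreal_mult_less_top)
    qed
    have nf: "(norm (g k x))\<^sup>2 = (f k (norm x))\<^sup>2" if "x \<noteq> 0" for k x using that by (simp add: g_def norm_sgn)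
    have gb: "ennreal ((norm (g k x))\<^sup>2) \<le> h x" if x: "x \<noteq> 0" for k x
    proof -
      have "(norm (g k x))\<^sup>2 \<le> A1 * (norm (grad_star p \<gamma> x))\<^sup>2 + A2 * (if norm x < 1 then 1 else 0)"
        unfolding nf[OF x] gs_eq[OF x] using x by (intro fb) simp
      then have "ennreal ((norm (g k x))\<^sup>2) \<le> ennreal (A1 * (norm (grad_star p \<gamma> x))\<^sup>2 + A2 * (if norm x < 1 then 1 else 0))"
        by (rule ennreal_leI)
      also have "\<dots> = h x" unfolding h_def using A0 by (cases "norm x < 1") (simp_all add: ennreal_plus ennreal_mult)
      finally show ?thesis .
    qed
    have nz: "AE x in lborel. x \<noteq> (0::'a)" by (rule AE_lborel_singleton)
    have lim: "(\<lambda>k. \<integral>\<^sup>+x. ennreal ((norm (g k x))\<^sup>2) \<partial>lborel) \<longlonglongrightarrow> (\<integral>\<^sup>+x. ennreal ((norm (grad_star p \<gamma> (x::'a)))\<^sup>2) \<partial>lborel)"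
    proof (rule nn_integral_dominated_convergence[where w=h])
      show "AE x in lborel. ennreal ((norm (g k x))\<^sup>2) \<le> h x" for k using nz by eventually_elim (rule gb)
      show "AE x in lborel. (\<lambda>k. ennreal ((norm (g k x))\<^sup>2)) \<longlonglongrightarrow> ennreal ((norm (grad_star p \<gamma> x))\<^sup>2)"
        using nz by eventually_elim (use flim' in \<open>auto simp: nf gs_eq intro!: tendsto_ennrealI\<close>)
      show "(\<integral>\<^sup>+x. h x \<partial>lborel) < \<infinity>" by (rule hfin)
    qed measurable
    define I where "I = (\<lambda>k. enn2real (\<integral>\<^sup>+x. ennreal ((norm (g k x))\<^sup>2) \<partial>lborel))"
    have fin: "(\<integral>\<^sup>+x. ennreal ((norm (g k x))\<^sup>2) \<partial>lborel) < \<infinity>" for k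
    proof -
      have "(\<integral>\<^sup>+x. ennreal ((norm (g k x))\<^sup>2) \<partial>lborel) \<le> (\<integral>\<^sup>+x. h x \<partial>lborel)"
      proof (rule nn_integral_mono_AE)
        show "AE x in lborel. ennreal ((norm (g k x))\<^sup>2) \<le> h x" using nz by eventually_elim (rule gb)
      qed
      then show ?thesis using hfin by (rule le_less_trans)
    qed
    have I: "(\<integral>\<^sup>+x. ennreal ((norm (g k x))\<^sup>2) \<partial>lborel) = ennreal (I k)" for k using fin[of k] by (simp add: I_def less_top)
    have "(\<lambda>k. ennreal (I k)) \<longlonglongrightarrow> ennreal D" using lim unfolding I K(6) .
    then have "I \<longlonglongrightarrow> D" by (rule tendsto_ennrealD) (use K(3) in \<open>auto simp: I_def\<close>)
    moreover have "0 \<le> I k" for k by (simp add: I_def)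
    ultimately show ?thesis using I by blast
  qed
  then obtain ID where ID: "\<And>k. (\<integral>\<^sup>+x. ennreal ((norm (g k x))\<^sup>2) \<partial>lborel) = ennreal (ID k)" "\<And>k. 0 \<le> ID k" "ID \<longlonglongrightarrow> D" by blast
  obtain IK where IK: "\<And>k. (\<integral>\<^sup>+x. ennreal (\<bar>?u k x\<bar> powr (p + 1)) \<partial>wmeas \<gamma>) = ennreal (IK k)" "\<And>k. 0 \<le> IK k" "IK \<longlonglongrightarrow> K"
    using powlim[OF _ K(4,1)] p by auto
  obtain IP where IP: "\<And>k. (\<integral>\<^sup>+x. ennreal (\<bar>?u k x\<bar> powr (2 * p)) \<partial>wmeas \<gamma>) = ennreal (IP k)" "\<And>k. 0 \<le> IP k" "IP \<longlonglongrightarrow> P"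
    using powlim[OF _ K(5,2)] p by auto
  have Qk: "Q_functional p \<gamma> (?u k) = ID k powr (\<theta> / 2) * IK k powr ((1 - \<theta>) / (p + 1)) / IP k powr (1 / (2 * p))" for k
    by (rule Q_functional_eq[OF Gd gm um ID(1,2) IK(1,2) IP(1,2) \<theta>_def])
  have "K \<noteq> 0" "P \<noteq> 0" "D \<noteq> 0" using K(1,2,3) by auto
  then show ?thesis unfolding Qk Qs
    by (intro tendsto_divide tendsto_mult tendsto_powr tendsto_const ID(3) IK(3) IP(3)) simp_all
qed

section \<open>Conclusion\<close>

theorem theorem1p1:
  fixes d :: nat and p :: real
  assumes "d = CARD('n::finite)"
    and "d \<ge> 3"
    and "1 < p" and "p < real d / (real d - 2)"
  shows "\<exists>\<gamma>s > 0. \<gamma>s \<le> real d - (real d - 2) * p \<and>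
    (\<forall>\<gamma>. 0 < \<gamma> \<and> \<gamma> < \<gamma>s \<longrightarrow>
      (INF w\<in>(radial_test_functions :: (real ^ 'n \<Rightarrow> real) set) - {\<lambda>_. 0}. Q_functional p \<gamma> w)
        = Q_functional p \<gamma> (w_star p \<gamma> :: real ^ 'n \<Rightarrow> real) \<and>
      Q_functional p \<gamma> (w_star p \<gamma> :: real ^ 'n \<Rightarrow> real)
        = (INF w\<in>(test_functions :: (real ^ 'n \<Rightarrow> real) set) - {\<lambda>_. 0}. Q_functional p \<gamma> w) \<and>
      optimal_const (radial_test_functions :: (real ^ 'n \<Rightarrow> real) set) p \<gamma>
        = optimal_const (test_functions :: (real ^ 'n \<Rightarrow> real) set) p \<gamma>)"
proof (intro exI[of _ "real d - (real d - 2) * p"] conjI allI impI)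
  \<comment> \<open>Positivity of this threshold is exactly the hypothesis
    \<open>p < d / (d - 2)\<close>.\<close>
  show "0 < real d - (real d - 2) * p" using assms by (simp add: field_simps)
  fix \<gamma> :: real assume "0 < \<gamma> \<and> \<gamma> < real d - (real d - 2) * p"
  then have \<gamma>: "0 < \<gamma>" and \<gamma>p: "\<gamma> < real DIM(real ^ 'n) - (real DIM(real ^ 'n) - 2) * p" using assms(1) by auto
  have d: "3 \<le> DIM(real ^ 'n)" using assms(1,2) by simp
  let ?Q = "Q_functional p \<gamma>" and ?ws = "w_star p \<gamma> :: real ^ 'n \<Rightarrow> real"
  \<comment> \<open>Every class between the radial and all test functions has the same infimum: the
    lower bound holds on the largest class, and the minimising sequence lies in the
    smallest.\<close>
  have inf: "(INF w\<in>S - {\<lambda>_. 0}. ?Q w) = ?Q ?ws"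
    if S: "radial_test_functions \<subseteq> S" "S \<subseteq> test_functions" for S :: "(real ^ 'n \<Rightarrow> real) set"
  proof (rule antisym)
    have lb: "?Q ?ws \<le> ?Q w" if "w \<in> S - {\<lambda>_. 0}" for w
      using that S by (intro Q_functional_lower_bound[OF d \<gamma> assms(3) \<gamma>p]) auto
    have bdd: "bdd_below (?Q ` (S - {\<lambda>_. 0}))" using lb by (rule bdd_belowI2)
    have mem: "approx_star p \<gamma> k \<in> S - {\<lambda>_. 0}" for k using approx_star_test[of p \<gamma> k] S(1) by blast
    show "?Q ?ws \<le> (INF w\<in>S - {\<lambda>_. 0}. ?Q w)" using mem lb by (intro cINF_greatest) auto
    have "(INF w\<in>S - {\<lambda>_. 0}. ?Q w) \<le> ?Q (approx_star p \<gamma> k :: real ^ 'n \<Rightarrow> real)" for k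
      by (rule cINF_lower[OF bdd mem])
    then show "(INF w\<in>S - {\<lambda>_. 0}. ?Q w) \<le> ?Q ?ws"
      by (intro LIMSEQ_le_const[OF approx_star_tendsto[OF d \<gamma> assms(3) \<gamma>p]]) auto
  qed
  show R: "(INF w\<in>(radial_test_functions :: (real ^ 'n \<Rightarrow> real) set) - {\<lambda>_. 0}. ?Q w) = ?Q ?ws" by (rule inf[OF order_refl radial_test_subset])
  show T: "?Q ?ws = (INF w\<in>(test_functions :: (real ^ 'n \<Rightarrow> real) set) - {\<lambda>_. 0}. ?Q w)" by (rule inf[OF radial_test_subset order_refl, symmetric])
  show "optimal_const (radial_test_functions :: (real ^ 'n \<Rightarrow> real) set) p \<gamma> = optimal_const (test_functions :: (real ^ 'n \<Rightarrow> real) set) p \<gamma>"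
    unfolding optimal_const_def R T[symmetric] ..
qed simp

end
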